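(* Let $f:\mathbb{W}\to\mathbb{R}$ be a measurable function such that $$-\log\mathbb{E}_\nu\left[e^{-f}\right]=\inf_{u\in\widetilde{\mathcal{D}}\cap L^2_a(\nu,H)}\mathbb{E}_\nu\left[f\circ W^u+\frac12|u|_H^2\right].$$ Denote this infimum $J_*$. It is attained at $u\in\widetilde{\mathcal{D}}\cap L^2_a(\nu,H)$ if and only if $W^u$ is $\nu$-a.s. left-invertible and $$\frac{dW^u\nu}{d\nu}=\frac{e^{-f}}{\mathbb{E}_\nu\left[e^{-f}\right]}.$$
   Context: Notation. Let $n\ge 1$, $\mathbb{W}=C([0,1],\mathbb{R}^n)$, $H=\{\int_0^\cdot\dot h(s)ds:\dot h\in L^2([0,1],\mathbb{R}^n)\}$ with $|h|_H^2=\int_0^1|\dot h(s)|^2ds$. $W=(W(t))_{t\in[0,1]}$ is the coordinate process on $\mathbb{W}$ (so, as a map, $W=I_{\mathbb{W}}$, the identity). $\nu$ is a probability measure on $\mathbb{W}$; all filtrations are completed with respect to $\nu$, and $(\mathcal{F}_t)$ is the filtration of $W$. For $p\ge 0$, $L^p_a(\nu,H)$ is the set of $u\in L^p(\nu,H)$ whose density $\dot u$ is $(\mathcal{F}_t)$-adapted ($L^0$: all measurable maps). $\mathcal{D}=\{u\in L^0_a(\nu,H):\dot u \text{ is } d\nu\times dt\text{-a.s. bounded}\}$. For a $\nu$-Brownian motion $\beta$, $\delta_\beta u=\int_0^1\dot u(s)d\beta(s)$, $\rho(-\delta_\beta u)=\exp\left(-\int_0^1\dot u(s)d\beta(s)-\frac12\int_0^1|\dot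 u(s)|^2ds\right)$ and $G_p(\nu,\beta)=\{u\in L^p_a(\nu,H):\mathbb{E}_\nu[\rho(-\delta_\beta u)]=1\}$. $U\nu$ denotes the image measure of $\nu$ under $U$. A measurable $U:\mathbb{W}\to\mathbb{W}$ is $\nu$-a.s. left-invertible if $U\nu\ll\nu$ and there is a measurable $V:\mathbb{W}\to\mathbb{W}$ with $V\circ U=I_{\mathbb{W}}$ $\nu$-a.s. Standing assumption. There are an $\mathbb{R}^n$-valued $\nu$-Brownian motion $\beta$ on $\mathbb{W}$ whose completed canonical filtration equals that of $W$, and a family $(W^u)_{u\in\mathcal{D}}$ of continuous processes on $\mathbb{W}$ (measurable maps $W^u:\mathbb{W}\to\mathbb{W}$) with $W^0=W$; moreover the map $u\mapsto W^u$ is extended to a set $\widetilde{\mathcal{D}}$ such that: (i) $\mathcal{D}\subset\widetilde{\mathcal{D}}\subset G_0(\nu,\beta)$; (ii) for every $u\in\widetilde{\mathcal{D}}$, $W^u$ is $(\mathcal{F}_t)$-adapted; (iii) for every $u\in\widetilde{\mathcal{D}}$, the law of $W^u$ under $\tilde\nu^u$, where $\frac{d\tilde\nu^u}{d\nu}=\rho(-\delta_\beta u)$, equals the law of $W$ under $\nu$; (iv) for every $u\in\widetilde{\mathcal{D}}$, $\beta\circ W^u=\beta+u$ $\nu$-a.s.; (v) for all $u,v\in\widetilde{\mathcal{D}}$ with $v+u\circ W^v\in\widetilde{\mathcal{D}}$, $W^u\circ W^v=W^{v+u\circ W^v}$ $\nu$-a.s. (and this holds for all $u,v\in\mathcal{D}$);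 (vi) there is a set $\widetilde{\widetilde{\mathcal{D}}}$ with $\widetilde{\mathcal{D}}\subset\widetilde{\widetilde{\mathcal{D}}}\subset L^0_a(\nu,H)$, $\widetilde{\mathcal{D}}=\widetilde{\widetilde{\mathcal{D}}}\cap G_0(\nu,\beta)$, and such that for every $u\in\widetilde{\mathcal{D}}$, if the equation $u+v\circ W^u=0$ ($\nu$-a.s.) has a solution $v\in G_0(\nu,\beta)$, then it has a solution $v\in\widetilde{\widetilde{\mathcal{D}}}$. *)

theory Defs
  imports "HOL-Probability.Probability"
begin

section \<open>The path space\<close>

text \<open>Continuous paths on the unit interval with values in \<open>\<real>\<^sup>n\<close> (\<open>n\<close> is the cardinality of the
  nonempty finite index type). Extending a path by \<open>0\<close> outside the unit interval makes the
  representation unique.\<close>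

typedef (overloaded) ('n::finite) path =
  "{w :: real \<Rightarrow> real ^ 'n. continuous_on {0..1} w \<and> (\<forall>t. t \<notin> {0..1} \<longrightarrow> w t = 0)}"
  morphisms path_val Path
  by (rule exI[of _ "\<lambda>_. 0"]) simp

instantiation path :: (finite) ab_group_add
begin

definition "0 = Path (\<lambda>_. 0)"
definition "x + y = Path (\<lambda>t. path_val x t + path_val y t)"
definition "- x = Path (\<lambda>t. - path_val x t)"
definition "x - y = Path (\<lambda>t. path_val x t - path_val y t)"

lemma path_val_simps:
  "path_val (0 :: 'a path) t = 0"
  "path_val (x + y :: 'a path) t = path_val x t + path_val y t"
  "path_val (- x :: 'a path) t = - path_val x t"
  "path_val (x - y :: 'a path) t = path_val x t - path_val y t"
proof -
  note P = path_val[of x] path_val[of y]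
  show "path_val (0 :: 'a path) t = 0"
    unfolding zero_path_def by (subst Path_inverse) auto
  show "path_val (x + y) t = path_val x t + path_val y t"
    unfolding plus_path_def using P by (subst Path_inverse) (auto intro: continuous_on_add)
  show "path_val (- x) t = - path_val x t"
    unfolding uminus_path_def using P by (subst Path_inverse) (auto intro: continuous_on_minus)
  show "path_val (x - y) t = path_val x t - path_val y t"
    unfolding minus_path_def using P by (subst Path_inverse) (auto intro: continuous_on_diff)
qed

instance
  by standard (auto simp: path_val_inject[symmetric] path_val_simps fun_eq_iff)

end

declare path_val_simps [simp]

text \<open>The \<open>\<sigma>\<close>-algebra generated by the coordinates, which is the Borel \<open>\<sigma>\<close>-algebra of the topology
  of uniform convergence (the coordinates outside the unit interval are constant).\<close>

definition path_borel :: "('n::finite) path measure" where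
  "path_borel = vimage_algebra UNIV path_val (Pi\<^sub>M UNIV (\<lambda>_. borel))"

text \<open>Measurability of maps defined on the path space always refers to the completion of \<open>\<nu>\<close>.\<close>

definition law :: "('n::finite) path measure \<Rightarrow> ('n path \<Rightarrow> 'n path) \<Rightarrow> 'n path measure" where
  "law M U = distr M path_borel U"

definition left_invertible :: "('n::finite) path measure \<Rightarrow> ('n path \<Rightarrow> 'n path) \<Rightarrow> bool" where
  "left_invertible \<nu> U \<longleftrightarrow>
     U \<in> completion \<nu> \<rightarrow>\<^sub>M path_borel \<and>
     absolutely_continuous \<nu> (law (completion \<nu>) U) \<and>
     (\<exists>V \<in> completion \<nu> \<rightarrow>\<^sub>M path_borel. AE w in \<nu>. V (U w) = w)"

section \<open>Filtrations and Brownian motion\<close>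

text \<open>The \<open>\<nu>\<close>-completed canonical filtration of a path-valued map; the filtration of the coordinate
  process is the one of \<open>id\<close>.\<close>

definition filtr :: "('n::finite) path measure \<Rightarrow> ('n path \<Rightarrow> 'n path) \<Rightarrow> real \<Rightarrow> 'n path measure" where
  "filtr \<nu> X t = sigma UNIV
     ({{w. path_val (X w) s \<in> A} | s A. s \<in> {0..t} \<and> A \<in> sets borel} \<union> null_sets (completion \<nu>))"

definition adapted_process :: "('n::finite) path measure \<Rightarrow> ('n path \<Rightarrow> 'n path) \<Rightarrow> bool" where
  "adapted_process \<nu> X \<longleftrightarrow>
     (\<forall>t\<in>{0..1}. (\<lambda>w. path_val (X w) t) \<in> borel_measurable (filtr \<nu> id t))"

definition brownian_motion :: "('n::finite) path measure \<Rightarrow> ('n path \<Rightarrow> 'n path) \<Rightarrow> bool" where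
  "brownian_motion \<nu> \<beta> \<longleftrightarrow>
     \<beta> \<in> completion \<nu> \<rightarrow>\<^sub>M path_borel \<and>
     (AE w in \<nu>. path_val (\<beta> w) 0 = 0) \<and>
     (\<forall>s t. 0 \<le> s \<and> s < t \<and> t \<le> 1 \<longrightarrow>
        distributed (completion \<nu>) lborel (\<lambda>w. path_val (\<beta> w) t - path_val (\<beta> w) s)
          (\<lambda>x. ennreal (\<Prod>i\<in>UNIV. normal_density 0 (sqrt (t - s)) (x $ i))) \<and>
        prob_space.indep_set (completion \<nu>) (sets (filtr \<nu> \<beta> s))
          (sets (vimage_algebra UNIV (\<lambda>w. path_val (\<beta> w) t - path_val (\<beta> w) s) borel)))"

section \<open>The Cameron--Martin space\<close>

definition is_cm_density :: "('n::finite) path \<Rightarrow> (real \<Rightarrow> real ^ 'n) \<Rightarrow> bool" where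
  "is_cm_density h g \<longleftrightarrow>
     g \<in> borel_measurable lborel \<and>
     set_integrable lborel {0..1} (\<lambda>s. (norm (g s))\<^sup>2) \<and>
     (\<forall>t\<in>{0..1}. path_val h t = (LINT s:{0..t}|lborel. g s))"

definition cameron_martin :: "('n::finite) path set" where
  "cameron_martin = {h. \<exists>g. is_cm_density h g}"

text \<open>The density is unique almost everywhere on the unit interval; nothing below depends on the
  choice of a version.\<close>

definition cm_density :: "('n::finite) path \<Rightarrow> real \<Rightarrow> real ^ 'n" where
  "cm_density h = (SOME g. is_cm_density h g)"

definition cm_norm :: "('n::finite) path \<Rightarrow> real" where
  "cm_norm h = sqrt (LINT s:{0..1}|lborel. (norm (cm_density h s))\<^sup>2)"

text \<open>\<open>v w s\<close> is an adapted, jointly measurable version of the density of \<open>u w\<close> at time \<open>s\<close>.\<close>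

definition adapted_density ::
    "('n::finite) path measure \<Rightarrow> ('n path \<Rightarrow> 'n path) \<Rightarrow> ('n path \<Rightarrow> real \<Rightarrow> real ^ 'n) \<Rightarrow> bool" where
  "adapted_density \<nu> u v \<longleftrightarrow>
     (\<lambda>(w, s). v w s) \<in> borel_measurable (completion \<nu> \<Otimes>\<^sub>M lborel) \<and>
     (\<forall>s\<in>{0..1}. (\<lambda>w. v w s) \<in> borel_measurable (filtr \<nu> id s)) \<and>
     (AE w in \<nu>. is_cm_density (u w) (v w))"

text \<open>The spaces \<open>L\<^sup>p\<^sub>a(\<nu>, H)\<close>. The Borel \<open>\<sigma>\<close>-algebra of the separable Hilbert space \<open>H\<close> is the trace of
  the \<open>\<sigma>\<close>-algebra \<open>path_borel\<close>. For \<open>p = 0\<close> the integrability condition is void.\<close>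

definition Lpa :: "real \<Rightarrow> ('n::finite) path measure \<Rightarrow> ('n path \<Rightarrow> 'n path) set" where
  "Lpa p \<nu> = {u. range u \<subseteq> cameron_martin \<and>
      u \<in> completion \<nu> \<rightarrow>\<^sub>M path_borel \<and>
      (\<exists>v. adapted_density \<nu> u v) \<and>
      integrable (completion \<nu>) (\<lambda>w. cm_norm (u w) powr p)}"

definition bounded_drifts :: "('n::finite) path measure \<Rightarrow> ('n path \<Rightarrow> 'n path) set" where
  "bounded_drifts \<nu> = {u \<in> Lpa 0 \<nu>. \<exists>v C. adapted_density \<nu> u v \<and>
      (AE (w, s) in completion \<nu> \<Otimes>\<^sub>M lborel. s \<in> {0..1} \<longrightarrow> norm (v w s) \<le> C)}"

section \<open>The stochastic integral of a Cameron--Martin valued adapted map\<close>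

definition simple_integrand ::
    "('n::finite) path measure \<Rightarrow> nat \<Rightarrow> (nat \<Rightarrow> real) \<Rightarrow> (nat \<Rightarrow> 'n path \<Rightarrow> real ^ 'n) \<Rightarrow> bool" where
  "simple_integrand \<nu> m t \<xi> \<longleftrightarrow>
     0 \<le> t 0 \<and> (\<forall>i<m. t i < t (Suc i)) \<and> t m \<le> 1 \<and>
     (\<forall>i<m. \<xi> i \<in> borel_measurable (filtr \<nu> id (t i)) \<and> bounded (range (\<xi> i)))"

definition simple_process ::
    "nat \<Rightarrow> (nat \<Rightarrow> real) \<Rightarrow> (nat \<Rightarrow> ('n::finite) path \<Rightarrow> real ^ 'n) \<Rightarrow> 'n path \<Rightarrow> real \<Rightarrow> real ^ 'n" where
  "simple_process m t \<xi> w s = (\<Sum>i<m. indicator {t i<..t (Suc i)} s *\<^sub>R \<xi> i w)"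

definition simple_integral ::
    "(('n::finite) path \<Rightarrow> 'n path) \<Rightarrow> nat \<Rightarrow> (nat \<Rightarrow> real) \<Rightarrow> (nat \<Rightarrow> 'n path \<Rightarrow> real ^ 'n) \<Rightarrow> 'n path \<Rightarrow> real"
  where
  "simple_integral \<beta> m t \<xi> w =
     (\<Sum>i<m. \<xi> i w \<bullet> (path_val (\<beta> w) (t (Suc i)) - path_val (\<beta> w) (t i)))"

text \<open>The Ito integral over the unit interval of a density that is almost surely square integrable:
  the limit in probability of integrals of simple processes which approximate the density in \<open>L\<^sup>2\<close>
  of the unit interval, in probability.\<close>

definition has_stoch_integral ::
    "('n::finite) path measure \<Rightarrow> ('n path \<Rightarrow> 'n path) \<Rightarrow> ('n path \<Rightarrow> 'n path) \<Rightarrow> ('n path \<Rightarrow> real) \<Rightarrow> bool"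
  where
  "has_stoch_integral \<nu> \<beta> u X \<longleftrightarrow>
     X \<in> borel_measurable (completion \<nu>) \<and>
     (\<exists>m t \<xi>. (\<forall>k. simple_integrand \<nu> (m k) (t k) (\<xi> k)) \<and>
        (\<forall>\<epsilon>>0. (\<lambda>k. measure (completion \<nu>)
           {w. (\<integral>\<^sup>+s\<in>{0..1}. ennreal ((norm (simple_process (m k) (t k) (\<xi> k) w s - cm_density (u w) s))\<^sup>2) \<partial>lborel)
                 > ennreal \<epsilon>}) \<longlonglongrightarrow> 0) \<and>
        (\<forall>\<epsilon>>0. (\<lambda>k. measure (completion \<nu>)
           {w. \<bar>simple_integral \<beta> (m k) (t k) (\<xi> k) w - X w\<bar> > \<epsilon>}) \<longlonglongrightarrow> 0))"

text \<open>\<open>\<delta>\<^sub>\<beta> u\<close>, determined up to almost sure equality.\<close>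

definition stoch_integral ::
    "('n::finite) path measure \<Rightarrow> ('n path \<Rightarrow> 'n path) \<Rightarrow> ('n path \<Rightarrow> 'n path) \<Rightarrow> 'n path \<Rightarrow> real" where
  "stoch_integral \<nu> \<beta> u = (SOME X. has_stoch_integral \<nu> \<beta> u X)"

text \<open>\<open>\<rho>(- \<delta>\<^sub>\<beta> u)\<close>\<close>

definition girsanov_exp ::
    "('n::finite) path measure \<Rightarrow> ('n path \<Rightarrow> 'n path) \<Rightarrow> ('n path \<Rightarrow> 'n path) \<Rightarrow> 'n path \<Rightarrow> real" where
  "girsanov_exp \<nu> \<beta> u w = exp (- stoch_integral \<nu> \<beta> u w - (cm_norm (u w))\<^sup>2 / 2)"

definition Gp ::
    "real \<Rightarrow> ('n::finite) path measure \<Rightarrow> ('n path \<Rightarrow> 'n path) \<Rightarrow> ('n path \<Rightarrow> 'n path) set" where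
  "Gp p \<nu> \<beta> = {u \<in> Lpa p \<nu>. (\<integral>w. girsanov_exp \<nu> \<beta> u w \<partial>completion \<nu>) = 1}"

section \<open>The variational functional\<close>

text \<open>The expectation with values in the extended reals; it has its usual meaning unless both the
  positive and the negative part have infinite expectation.\<close>

definition ext_expectation :: "'a measure \<Rightarrow> ('a \<Rightarrow> real) \<Rightarrow> ereal" where
  "ext_expectation M X =
     enn2ereal (\<integral>\<^sup>+w. ennreal (X w) \<partial>M) - enn2ereal (\<integral>\<^sup>+w. ennreal (- X w) \<partial>M)"

text \<open>\<open>E\<^sub>\<nu>[f \<circ> U + |u|\<^sub>H\<^sup>2 / 2]\<close>, to be used with \<open>U = W\<^sup>u\<close>\<close>

definition cost ::
    "('n::finite) path measure \<Rightarrow> ('n path \<Rightarrow> real) \<Rightarrow> ('n path \<Rightarrow> 'n path) \<Rightarrow> ('n path \<Rightarrow> 'n path) \<Rightarrow> ereal" where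
  "cost \<nu> f U u = ext_expectation (completion \<nu>) (\<lambda>w. f (U w) + (cm_norm (u w))\<^sup>2 / 2)"

end

theory Submission
  imports Defs
begin

text \<open>Put \<open>\<rho> = \<rho>(- \<delta>\<^sub>\<beta> u)\<close>, \<open>U = W\<^sup>u\<close>, \<open>L = e\<^sup>-\<^sup>f / E[e\<^sup>-\<^sup>f]\<close> and \<open>e\<^sup>g = \<rho> \<cdot> (L \<circ> U)\<close>. Since \<open>U\<close> maps \<open>\<rho>\<nu>\<close> to
  \<open>\<nu>\<close>, \<open>E[e\<^sup>g] = 1\<close>, while \<open>- E[g]\<close> is the cost of \<open>u\<close> plus \<open>ln E[e\<^sup>-\<^sup>f]\<close>, because \<open>\<delta>\<^sub>\<beta> u\<close> is centred. As
  \<open>e\<^sup>x - 1 - x\<close> is nonnegative and vanishes only at \<open>0\<close>, the infimum is attained at \<open>u\<close> iff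
  \<open>\<rho> \<cdot> (L \<circ> U) = 1\<close> almost surely. This identity says that \<open>U\<nu>\<close> has density \<open>L\<close> and it makes \<open>\<rho>\<close> a
  function of \<open>U\<close>; conversely it follows from the density of \<open>U\<nu>\<close> if every event is, up to null
  sets, the preimage of an event under \<open>U\<close>.

  It remains to obtain the left inverse. By Girsanov's theorem \<open>Y = \<beta> \<circ> U = \<beta> + u\<close> has, under \<open>\<rho>\<nu>\<close>,
  increments which are independent of the past of the large filtration. If \<open>\<rho>\<close> is \<open>\<sigma>(Y)\<close>-measurable,
  it follows that conditioning on \<open>\<sigma>(Y)\<close> under \<open>\<nu>\<close> preserves adaptedness. The innovations
  \<open>\<beta> - E[\<beta> | \<sigma>(Y)]\<close> then have orthogonal increments, and they are controlled by the drift \<open>u\<close> only, so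
  their quadratic variation is zero. Hence \<open>\<beta>\<close>, and with it every event, is \<open>\<sigma>(Y)\<close>-measurable.\<close>

text \<open>Why \<open>\<rho>\<close> is a function of \<open>Y\<close>: the identity gives
  \<open>\<rho> = 1 / (L \<circ> U)\<close>. Since \<open>\<beta>\<close> and the coordinates have
  the same completed filtration, every event is up to null sets an event of \<open>\<beta>\<close>,
  so its preimage under \<open>U\<close> is an event of \<open>Y = \<beta> \<circ> U\<close>. Why
  conditioning preserves adaptedness: under \<open>\<rho>\<nu>\<close> the increments of
  \<open>Y\<close> after \<open>t\<close> are independent of the past, so a variable known at time
  \<open>t\<close> has the same conditional expectation given all of \<open>Y\<close> as given
  \<open>Y\<close> up to \<open>t\<close>. This is a statement about \<open>\<rho>\<nu>\<close>,
  while the innovations live under \<open>\<nu>\<close>; a density that is a function of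
  \<open>Y\<close> cancels from conditional expectations given \<open>Y\<close>, and only this
  bridges the two measures. Why the quadratic variation vanishes: by Cauchy--Schwarz the square of a
  drift increment carries a factor of the mesh size. The obstacle is that the stochastic integral is
  given only as a limit in probability of simple integrals. Girsanov's theorem is therefore an
  explicit Gaussian computation for simple integrands, carried to the limit by Scheffe's lemma, for
  which the exponential of \<open>u\<close> must have expectation one.\<close>

section \<open>Path-valued maps and their filtrations\<close>

lemma space_path_borel [simp]: "space path_borel = UNIV"
  by (simp add: path_borel_def)

lemma measurable_path_val [measurable]: "(\<lambda>w. path_val w t) \<in> borel_measurable path_borel"
proof -
  have "path_val \<in> (path_borel :: 'a path measure) \<rightarrow>\<^sub>M Pi\<^sub>M UNIV (\<lambda>_. borel)"
    unfolding path_borel_def by (rule measurable_vimage_algebra1) (auto simp: space_PiM)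
  from measurable_compose[OF this measurable_component_singleton[of t UNIV]]
  show ?thesis by simp
qed

lemma measurable_path_borelI:
  assumes "\<And>t. (\<lambda>x. path_val (X x) t) \<in> borel_measurable N"
  shows "X \<in> N \<rightarrow>\<^sub>M path_borel"
  unfolding path_borel_def
proof (rule measurable_vimage_algebra2)
  show "(\<lambda>x. path_val (X x)) \<in> N \<rightarrow>\<^sub>M Pi\<^sub>M UNIV (\<lambda>_. borel)"
    by (rule measurable_PiM_single') (use assms in \<open>auto simp: space_PiM\<close>)
qed simp

lemma space_filtr [simp]: "space (filtr \<nu> X t) = UNIV"
  by (simp add: filtr_def)

lemma sets_filtr:
  "sets (filtr \<nu> X t) = sigma_sets UNIV
     ({{w. path_val (X w) s \<in> A} | s A. s \<in> {0..t} \<and> A \<in> sets borel} \<union> null_sets (completion \<nu>))"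
  unfolding filtr_def by (rule sets_measure_of) auto

lemma sets_filtr_mono: "s \<le> t \<Longrightarrow> sets (filtr \<nu> X s) \<subseteq> sets (filtr \<nu> X t)"
  unfolding sets_filtr by (rule sigma_sets_mono') fastforce

lemma null_sets_in_filtr: "N \<in> null_sets (completion \<nu>) \<Longrightarrow> N \<in> sets (filtr \<nu> X t)"
  unfolding sets_filtr by (intro sigma_sets.Basic) auto

lemma path_val_measurable_filtr:
  fixes X :: "('n::finite) path \<Rightarrow> 'n path"
  assumes "s \<in> {0..t}"
  shows "(\<lambda>w. path_val (X w) s) \<in> borel_measurable (filtr \<nu> X t)"
proof (rule measurableI)
  fix A :: "(real ^ 'n) set" assume "A \<in> sets borel"
  then have "{w. path_val (X w) s \<in> A} \<in> sets (filtr \<nu> X t)"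
    unfolding sets_filtr using assms by (intro sigma_sets.Basic) auto
  then show "(\<lambda>w. path_val (X w) s) -` A \<inter> space (filtr \<nu> X t) \<in> sets (filtr \<nu> X t)"
    by (simp add: vimage_def)
qed simp

lemma sets_filtr_subset:
  assumes "\<And>s. s \<in> {0..t} \<Longrightarrow> (\<lambda>w. path_val (X w) s) \<in> borel_measurable N"
    and "null_sets (completion \<nu>) \<subseteq> sets N" and "space N = UNIV"
  shows "sets (filtr \<nu> X t) \<subseteq> sets N"
proof -
  have "{w. path_val (X w) s \<in> A} \<in> sets N" if "s \<in> {0..t}" "A \<in> sets borel" for s A
    using measurable_sets[OF assms(1)[OF that(1)] that(2)] assms(3) by (simp add: vimage_def)
  then have "{{w. path_val (X w) s \<in> A} | s A. s \<in> {0..t} \<and> A \<in> sets borel} \<union> null_sets (completion \<nu>) \<subseteq> sets N"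
    using assms(2) by blast
  then show ?thesis
    unfolding sets_filtr assms(3)[symmetric] by (rule sets.sigma_sets_subset)
qed

text \<open>The exceptional set is a null set and \<open>F\<close> contains all null sets of
  \<open>M\<close>. This is how identities that hold only almost surely transfer measurability to
  the completed filtrations.\<close>

lemma measurable_AE_cong_complete:
  fixes f g :: "'a \<Rightarrow> 'b::{second_countable_topology, t2_space}"
  assumes f: "f \<in> borel_measurable F" and g: "g \<in> borel_measurable M"
    and F: "subalgebra M F" "null_sets M \<subseteq> sets F" and eq: "AE x in M. f x = g x"
  shows "g \<in> borel_measurable F"
proof (rule measurableI)
  fix A :: "'b set" assume A: "A \<in> sets borel"
  have sp: "space F = space M" using F by (simp add: subalgebra_def)
  have f': "f \<in> borel_measurable M" by (rule measurable_from_subalg[OF F(1) f])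
  define N where "N = {x \<in> space M. f x \<noteq> g x}"
  have NM: "N \<in> sets M" unfolding N_def using f' g by measurable
  have null: "N \<in> null_sets M" using eq NM unfolding N_def by (simp add: AE_iff_null)
  have fA: "f -` A \<inter> space M \<in> sets F" using measurable_sets[OF f A] sp by simp
  have gA: "g -` A \<inter> space M \<in> sets M" using measurable_sets[OF g A] .
  have gN: "g -` A \<inter> space M \<inter> N \<in> null_sets M" by (rule null_set_Int1[OF null gA])
  have eq: "g -` A \<inter> space M = ((f -` A \<inter> space M) - N) \<union> (g -` A \<inter> space M \<inter> N)"
    by (auto simp: N_def)
  show "g -` A \<inter> space F \<in> sets F"
    unfolding sp by (subst eq) (intro sets.Un sets.Diff fA subsetD[OF F(2)] gN null)
qed simp

section \<open>The centred Gaussian density with covariance a multiple of the identity\<close>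

definition gauss_density :: "real \<Rightarrow> real ^ ('n::finite) \<Rightarrow> real" where
  "gauss_density d x = (\<Prod>i\<in>UNIV. normal_density 0 (sqrt d) (x $ i))"

lemma gauss_density_nonneg [simp]: "0 \<le> gauss_density d x"
  unfolding gauss_density_def by (intro prod_nonneg) auto

lemma measurable_gauss_density [measurable]: "gauss_density d \<in> borel_measurable borel"
  unfolding gauss_density_def by measurable

lemma gauss_density_minus: "gauss_density d (- x) = gauss_density d x"
  unfolding gauss_density_def normal_density_def by simp

text \<open>Completing the square in each coordinate. This is Girsanov's formula for a single
  Gaussian increment: the exponential weight is the likelihood ratio of a translation by
  \<open>d *\<^sub>R \<xi>\<close>.\<close>

lemma gauss_density_shift:
  fixes x \<xi> :: "real ^ ('n::finite)"
  assumes "0 < d"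
  shows "exp (- (\<xi> \<bullet> x) - d * (norm \<xi>)\<^sup>2 / 2) * gauss_density d x = gauss_density d (x + d *\<^sub>R \<xi>)"
proof -
  have sq: "(norm \<xi>)\<^sup>2 = (\<Sum>i\<in>UNIV. (\<xi> $ i)\<^sup>2)"
    unfolding power2_norm_eq_inner inner_vec_def by (simp add: power2_eq_square)
  have "exp (- (\<xi> \<bullet> x) - d * (norm \<xi>)\<^sup>2 / 2) = (\<Prod>i\<in>UNIV. exp (- (\<xi> $ i * x $ i) - d * (\<xi> $ i)\<^sup>2 / 2))"
    unfolding exp_sum[OF finite, symmetric] sq inner_vec_def
    by (simp add: sum_subtractf sum_negf sum_distrib_left sum_divide_distrib)
  moreover have "exp (- (a * b) - d * a\<^sup>2 / 2) * normal_density 0 (sqrt d) b = normal_density 0 (sqrt d) (b + d * a)" for a b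
  proof -
    have "- (a * b) - d * a\<^sup>2 / 2 + - b\<^sup>2 / (2 * d) = - (b + d * a)\<^sup>2 / (2 * d)"
      using assms by (simp add: field_simps power2_eq_square)
    then show ?thesis
      using assms unfolding normal_density_def by (simp add: exp_add[symmetric] mult.left_commute)
  qed
  ultimately show ?thesis
    unfolding gauss_density_def by (simp only: prod.distrib[symmetric] vector_add_component vector_scaleR_component real_scaleR_def)
qed

lemma nn_integral_vec_prod:
  fixes f :: "'n::finite \<Rightarrow> real \<Rightarrow> ennreal"
  assumes [measurable]: "\<And>i. f i \<in> borel_measurable borel"
  shows "(\<integral>\<^sup>+x. (\<Prod>i\<in>UNIV. f i (x $ i)) \<partial>lborel) = (\<Prod>i\<in>UNIV. \<integral>\<^sup>+y. f i y \<partial>lborel)"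
proof -
  \<comment> \<open>\<open>nn_integral_lborel_prod\<close> runs over \<open>Basis\<close>, the
    product here over the index type; \<open>e\<close> enumerates the basis and \<open>inv e\<close>
    transports the factors.\<close>
  define e where "e = (\<lambda>i::'n. axis i (1::real))"
  define g where "g = (\<lambda>b. f (inv e b))"
  have inj: "inj e" by (auto simp: e_def inj_def axis_eq_axis)
  have B: "(Basis :: (real^'n) set) = e ` UNIV" by (auto simp: Basis_vec_def e_def)
  have g: "g (e i) = f i" for i unfolding g_def using inj by simp
  have prodB: "(\<Prod>b\<in>Basis. G b) = (\<Prod>i\<in>UNIV. G (e i))" for G :: "real^'n \<Rightarrow> ennreal"
    unfolding B by (subst prod.reindex[OF inj]) (simp add: o_def)
  have "(\<integral>\<^sup>+x. (\<Prod>b\<in>Basis. g b (x \<bullet> b)) \<partial>lborel) = (\<Prod>b\<in>Basis. (\<integral>\<^sup>+y. g b y \<partial>lborel))"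
    by (rule nn_integral_lborel_prod) (auto simp: g_def)
  then show ?thesis unfolding prodB g by (simp add: e_def inner_axis)
qed

lemma nn_integral_gauss_density:
  assumes "0 < d"
  shows "(\<integral>\<^sup>+(x::real^('n::finite)). ennreal (gauss_density d x) \<partial>lborel) = 1"
proof -
  have 1: "(\<integral>\<^sup>+y. ennreal (normal_density 0 (sqrt d) y) \<partial>lborel) = 1"
    using assms by (subst nn_integral_eq_integral) auto
  have "(\<integral>\<^sup>+(x::real^'n). ennreal (gauss_density d x) \<partial>lborel)
      = (\<integral>\<^sup>+(x::real^'n). (\<Prod>i\<in>UNIV. ennreal (normal_density 0 (sqrt d) (x $ i))) \<partial>lborel)"
    unfolding gauss_density_def by (simp add: prod_ennreal)
  also have "\<dots> = 1" by (subst nn_integral_vec_prod) (auto simp: 1)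
  finally show ?thesis .
qed

lemma nn_integral_gauss_density_norm_sq:
  fixes d :: real
  assumes "0 < d"
  shows "(\<integral>\<^sup>+(x::real^('n::finite)). ennreal ((norm x)\<^sup>2) * ennreal (gauss_density d x) \<partial>lborel) = ennreal (CARD('n) * d)"
proof -
  let ?N = "normal_density 0 (sqrt d)"
  have 1: "(\<integral>\<^sup>+y. ennreal (?N y) \<partial>lborel) = 1"
    using assms by (subst nn_integral_eq_integral) auto
  have "has_bochner_integral lborel (\<lambda>x. ?N x * (x - 0) ^ (2 * 1)) (fact (2 * 1) / ((2 / (sqrt d)\<^sup>2)^1 * fact 1))"
    by (rule normal_moment_even) (use assms in auto)
  then have hb: "has_bochner_integral lborel (\<lambda>x. ?N x * x\<^sup>2) d"
    using assms by simp
  have 2: "(\<integral>\<^sup>+y. ennreal (y\<^sup>2 * ?N y) \<partial>lborel) = ennreal d"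
    using hb assms by (subst nn_integral_eq_integral) (auto simp: has_bochner_integral_iff mult.commute)
  \<comment> \<open>The squared norm is a sum of squared coordinates; attaching the square to the
    factor of index \<open>j\<close> turns each summand into a product over coordinates, to which
    \<open>nn_integral_vec_prod\<close> applies.\<close>
  have "(\<integral>\<^sup>+(x::real^'n). ennreal ((norm x)\<^sup>2) * ennreal (gauss_density d x) \<partial>lborel)
      = (\<integral>\<^sup>+(x::real^'n). (\<Sum>j\<in>UNIV. (\<Prod>i\<in>UNIV. ennreal ((if i = j then (x $ i)\<^sup>2 else 1) * ?N (x $ i)))) \<partial>lborel)"
  proof (rule nn_integral_cong)
    fix x :: "real^'n"
    have "(\<Prod>i\<in>UNIV. (if i = j then (x $ i)\<^sup>2 else 1) * ?N (x $ i)) = (x $ j)\<^sup>2 * gauss_density d x" for j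
      unfolding gauss_density_def by (simp add: prod.distrib)
    then have *: "(\<Prod>i\<in>UNIV. ennreal ((if i = j then (x $ i)\<^sup>2 else 1) * ?N (x $ i))) = ennreal ((x $ j)\<^sup>2 * gauss_density d x)" for j
      by (subst prod_ennreal) auto
    have "(norm x)\<^sup>2 = (\<Sum>i\<in>UNIV. (x $ i)\<^sup>2)"
      unfolding power2_norm_eq_inner inner_vec_def by (simp add: power2_eq_square)
    then show "ennreal ((norm x)\<^sup>2) * ennreal (gauss_density d x)
      = (\<Sum>j\<in>UNIV. (\<Prod>i\<in>UNIV. ennreal ((if i = j then (x $ i)\<^sup>2 else 1) * ?N (x $ i))))"
      unfolding * by (subst sum_ennreal) (simp_all add: ennreal_mult[symmetric] sum_nonneg sum_distrib_right)
  qed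
  also have "\<dots> = (\<Sum>j\<in>(UNIV::'n set). (\<Prod>i\<in>UNIV. \<integral>\<^sup>+y. ennreal ((if i = j then y\<^sup>2 else 1) * ?N y) \<partial>lborel))"
    by (subst nn_integral_sum) (auto intro!: sum.cong nn_integral_vec_prod)
  also have "\<dots> = (\<Sum>j\<in>(UNIV::'n set). (\<Prod>i\<in>UNIV. if i = j then ennreal d else 1))"
    by (intro sum.cong prod.cong refl) (auto simp: 1 2)
  also have "\<dots> = ennreal (CARD('n) * d)"
    using assms by (simp add: ennreal_mult' ennreal_of_nat_eq_real_of_nat)
  finally show ?thesis .
qed

lemma lborel_nn_integral_translation:
  fixes f :: "'a::euclidean_space \<Rightarrow> ennreal"
  assumes [measurable]: "f \<in> borel_measurable borel"
  shows "(\<integral>\<^sup>+x. f (x + c) \<partial>lborel) = (\<integral>\<^sup>+x. f x \<partial>lborel)"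
  by (subst (2) lborel_distr_plus[symmetric, of c]) (simp add: nn_integral_distr add.commute)

section \<open>Brownian motion on path space\<close>

text \<open>Independence makes the joint law of the identity, seen through \<open>F\<close>, and of
  \<open>D\<close> a product measure; Tonelli then integrates the \<open>D\<close> argument out with
  the other one held fixed. It is applied both under the original and under the tilted
  measure.\<close>

lemma (in prob_space) nn_integral_freezing:
  assumes F: "subalgebra M F" and D: "D \<in> M \<rightarrow>\<^sub>M N"
    and indep: "\<And>A B. A \<in> sets F \<Longrightarrow> B \<in> sets N \<Longrightarrow>
      prob (A \<inter> (D -` B \<inter> space M)) = prob A * prob (D -` B \<inter> space M)"
    and h: "case_prod h \<in> borel_measurable (F \<Otimes>\<^sub>M N)"
  shows "(\<integral>\<^sup>+w. h w (D w) \<partial>M) = (\<integral>\<^sup>+w. (\<integral>\<^sup>+w'. h w (D w') \<partial>M) \<partial>M)"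
proof -
  have id: "(\<lambda>w. w) \<in> M \<rightarrow>\<^sub>M F" by (rule measurable_from_subalg[OF F]) simp
  interpret D: prob_space "distr M N D" by (rule prob_space_distr[OF D])
  interpret I: prob_space "distr M F (\<lambda>w. w)" by (rule prob_space_distr[OF id])
  have pair: "(\<lambda>w. (w, D w)) \<in> M \<rightarrow>\<^sub>M F \<Otimes>\<^sub>M N" using id D by (rule measurable_Pair)
  have eq: "distr M F (\<lambda>w. w) \<Otimes>\<^sub>M distr M N D = distr M (F \<Otimes>\<^sub>M N) (\<lambda>w. (w, D w))"
  proof (rule pair_measure_eqI)
    fix A B assume A: "A \<in> sets (distr M F (\<lambda>w. w))" and B: "B \<in> sets (distr M N D)"
    have 1: "(\<lambda>w. w) -` A \<inter> space M \<in> events" "D -` B \<inter> space M \<in> events"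
      using measurable_sets[OF id] measurable_sets[OF D] A B by auto
    have 2: "(\<lambda>w. (w, D w)) -` (A \<times> B) \<inter> space M = A \<inter> (D -` B \<inter> space M)" by auto
    have 3: "(\<lambda>w. w) -` A \<inter> space M = A"
      using A F sets.sets_into_space[of A F] by (auto simp: subalgebra_def)
    show "emeasure (distr M F (\<lambda>w. w)) A * emeasure (distr M N D) B
        = emeasure (distr M (F \<Otimes>\<^sub>M N) (\<lambda>w. (w, D w))) (A \<times> B)"
      using A B indep[of A B] 1 2 3
      by (simp add: emeasure_distr id D pair emeasure_eq_measure ennreal_mult')
  qed (auto intro: I.sigma_finite_measure_axioms D.sigma_finite_measure_axioms cong: sets_pair_measure_cong)
  have "(\<integral>\<^sup>+w. h w (D w) \<partial>M) = (\<integral>\<^sup>+z. case_prod h z \<partial>distr M (F \<Otimes>\<^sub>M N) (\<lambda>w. (w, D w)))"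
    by (subst nn_integral_distr[OF pair]) (use h in auto)
  also have "\<dots> = (\<integral>\<^sup>+w. (\<integral>\<^sup>+x. h w x \<partial>distr M N D) \<partial>distr M F (\<lambda>w. w))"
    unfolding eq[symmetric] using h by (subst D.nn_integral_fst[symmetric]) (simp_all cong: measurable_cong_sets)
  also have "\<dots> = (\<integral>\<^sup>+w. (\<integral>\<^sup>+x. h w x \<partial>distr M N D) \<partial>M)"
    by (subst nn_integral_distr[OF id])
      (use D.borel_measurable_nn_integral_fst[of "case_prod h" F] h in \<open>auto cong: measurable_cong_sets\<close>)
  also have "\<dots> = (\<integral>\<^sup>+w. (\<integral>\<^sup>+w'. h w (D w') \<partial>M) \<partial>M)"
  proof (rule nn_integral_cong)
    fix w assume "w \<in> space M"
    then have "w \<in> space F" using measurable_space[OF id] by auto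
    then have "h w \<in> borel_measurable N" using measurable_Pair2[OF h] by simp
    then show "(\<integral>\<^sup>+x. h w x \<partial>distr M N D) = (\<integral>\<^sup>+w'. h w (D w') \<partial>M)"
      by (subst nn_integral_distr[OF D]) auto
  qed
  finally show ?thesis .
qed

text \<open>The working measure \<open>M\<close> is the completion of \<open>\<nu>\<close>: the
  filtrations contain all null sets of the completion and so are subalgebras of \<open>M\<close>, in
  general not of \<open>\<nu>\<close>.\<close>

locale path_brownian =
  fixes \<nu> :: "('n::finite) path measure" and \<beta> :: "'n path \<Rightarrow> 'n path"
  assumes prob_nu: "prob_space \<nu>" and sets_nu: "sets \<nu> = sets path_borel"
    and bm: "brownian_motion \<nu> \<beta>"
    and filtr_eq: "\<And>t. t \<in> {0..1} \<Longrightarrow> sets (filtr \<nu> \<beta> t) = sets (filtr \<nu> id t)"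
begin

abbreviation "M \<equiv> completion \<nu>"
abbreviation "F \<equiv> filtr \<nu> id"
abbreviation "b \<equiv> (\<lambda>w. path_val (\<beta> w))"

sublocale prob_space M
  using prob_nu by (rule prob_space.prob_space_completion)

lemma space_nu [simp]: "space \<nu> = UNIV"
  using sets_eq_imp_space_eq[OF sets_nu] by simp

lemma measurable_beta [measurable]: "\<beta> \<in> M \<rightarrow>\<^sub>M path_borel"
  using bm by (simp add: brownian_motion_def)

lemma measurable_path_val_M:
  "X \<in> M \<rightarrow>\<^sub>M path_borel \<Longrightarrow> (\<lambda>w. path_val (X w) t) \<in> borel_measurable M"
  by (rule measurable_compose[OF _ measurable_path_val])

lemma measurable_id_M: "id \<in> M \<rightarrow>\<^sub>M path_borel"
  unfolding id_def by (intro measurable_completion measurable_ident_sets sets_nu)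

lemma subalgebra_filtr: "X \<in> M \<rightarrow>\<^sub>M path_borel \<Longrightarrow> subalgebra M (filtr \<nu> X t)"
  unfolding subalgebra_def
  by (intro conjI sets_filtr_subset measurable_path_val_M) (auto simp: null_sets_def)

lemma subalgebra_F: "subalgebra M (F t)"
  by (rule subalgebra_filtr[OF measurable_id_M])

lemma F_measurable_M: "f \<in> F t \<rightarrow>\<^sub>M N \<Longrightarrow> f \<in> M \<rightarrow>\<^sub>M N"
  by (rule measurable_from_subalg[OF subalgebra_F])

lemma F_mono: "s \<le> t \<Longrightarrow> f \<in> F s \<rightarrow>\<^sub>M N \<Longrightarrow> f \<in> F t \<rightarrow>\<^sub>M N"
  using sets_filtr_mono[of s t \<nu> id] unfolding measurable_def by auto

lemma F_AE_cong:
  fixes f g :: "'n path \<Rightarrow> 'b::{second_countable_topology, t2_space}"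
  shows "f \<in> borel_measurable (F t) \<Longrightarrow> g \<in> borel_measurable M \<Longrightarrow> AE x in M. f x = g x \<Longrightarrow>
    g \<in> borel_measurable (F t)"
  by (rule measurable_AE_cong_complete[OF _ _ subalgebra_F]) (auto intro: null_sets_in_filtr)

lemma b_measurable_F:
  assumes "0 \<le> s" "s \<le> t" "t \<le> 1"
  shows "(\<lambda>w. b w s) \<in> borel_measurable (F t)"
proof -
  have "(\<lambda>w. b w s) \<in> borel_measurable (filtr \<nu> \<beta> t)"
    by (rule path_val_measurable_filtr) (use assms in auto)
  then show ?thesis
    using filtr_eq[of t] assms by (simp cong: measurable_cong_sets)
qed

definition incr :: "real \<Rightarrow> real \<Rightarrow> 'n path \<Rightarrow> real ^ 'n" where
  "incr s t w = b w t - b w s"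

lemma measurable_incr_F: "0 \<le> s \<Longrightarrow> s \<le> t \<Longrightarrow> t \<le> r \<Longrightarrow> r \<le> 1 \<Longrightarrow> incr s t \<in> borel_measurable (F r)"
  unfolding incr_def by (intro borel_measurable_diff b_measurable_F) auto

lemma measurable_incr [measurable]: "incr s t \<in> borel_measurable M"
  unfolding incr_def by (intro borel_measurable_diff measurable_path_val_M measurable_beta)

lemma distr_incr:
  assumes "0 \<le> s" "s < t" "t \<le> 1"
  shows "distr M borel (incr s t) = density lborel (\<lambda>x. ennreal (gauss_density (t - s) x))"
proof -
  have "distributed M lborel (incr s t) (\<lambda>x. ennreal (gauss_density (t - s) x))"
    using bm assms unfolding brownian_motion_def incr_def[abs_def] gauss_density_def[abs_def] by auto
  then show ?thesis
    unfolding distributed_def by (simp cong: distr_cong)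
qed

lemma indep_incr:
  assumes "0 \<le> s" "s < t" "t \<le> 1" and "A \<in> sets (F s)" "B \<in> sets borel"
  shows "prob (A \<inter> incr s t -` B) = prob A * prob (incr s t -` B)"
proof -
  have ind: "indep_set (sets (filtr \<nu> \<beta> s)) (sets (vimage_algebra UNIV (incr s t) borel))"
    using bm assms unfolding brownian_motion_def incr_def[abs_def] by auto
  have "incr s t -` B \<in> sets (vimage_algebra UNIV (incr s t) borel)"
    using in_vimage_algebra[of B borel "incr s t" UNIV] assms by simp
  moreover have "sets (filtr \<nu> \<beta> s) = sets (F s)" using filtr_eq[of s] assms by simp
  ultimately show ?thesis
    using indep_setD[OF ind] assms by simp
qed

lemma freezing:
  assumes st: "0 \<le> s" "s < t" "t \<le> 1"
    and h [measurable]: "case_prod h \<in> borel_measurable (F s \<Otimes>\<^sub>M borel)"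
  shows "(\<integral>\<^sup>+w. h w (incr s t w) \<partial>M) = (\<integral>\<^sup>+w. (\<integral>\<^sup>+x. h w x * ennreal (gauss_density (t - s) x) \<partial>lborel) \<partial>M)"
proof -
  have "(\<integral>\<^sup>+w. h w (incr s t w) \<partial>M) = (\<integral>\<^sup>+w. (\<integral>\<^sup>+w'. h w (incr s t w') \<partial>M) \<partial>M)"
    by (rule nn_integral_freezing[OF subalgebra_F _ _ h]) (use indep_incr[OF st] in auto)
  also have "\<dots> = (\<integral>\<^sup>+w. (\<integral>\<^sup>+x. h w x \<partial>distr M borel (incr s t)) \<partial>M)"
    using measurable_Pair2[OF h] by (intro nn_integral_cong) (simp add: nn_integral_distr)
  also have "\<dots> = (\<integral>\<^sup>+w. (\<integral>\<^sup>+x. h w x * ennreal (gauss_density (t - s) x) \<partial>lborel) \<partial>M)"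
    unfolding distr_incr[OF st] using measurable_Pair2[OF h]
    by (intro nn_integral_cong, subst nn_integral_density) (auto simp: mult.commute)
  finally show ?thesis .
qed

end

section \<open>Construction of left inverses on path space\<close>

lemma path_eqI:
  fixes p q :: "('n::finite) path"
  assumes "\<And>t. t \<in> {0..1} \<Longrightarrow> path_val p t = path_val q t"
  shows "p = q"
proof -
  have "path_val p t = path_val q t" for t
    using assms[of t] path_val[of p] path_val[of q] by (cases "t \<in> {0..1}") auto
  then show ?thesis by (simp add: path_val_inject[symmetric] fun_eq_iff)
qed

text \<open>Rational approximation of \<open>t\<close> from below, so that it does not leave the
  unit interval; \<open>Suc n\<close> keeps the denominator positive.\<close>

definition grid_floor :: "nat \<Rightarrow> real \<Rightarrow> real" where
  "grid_floor n t = of_int \<lfloor>t * real (Suc n)\<rfloor> / real (Suc n)"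

lemma grid_floor:
  assumes "t \<in> {0..1}"
  shows "grid_floor n t \<in> \<rat> \<inter> {0..1}" and "(\<lambda>n. grid_floor n t) \<longlonglongrightarrow> t"
proof -
  have le: "of_int \<lfloor>t * real (Suc n)\<rfloor> \<le> t * real (Suc n)" for n by simp
  have ge: "t * real (Suc n) - 1 \<le> of_int \<lfloor>t * real (Suc n)\<rfloor>" for n by linarith
  have up: "grid_floor n t \<le> t" for n
    using le[of n] by (simp add: grid_floor_def field_simps del: of_nat_Suc)
  have lo: "t - 1 / real (Suc n) \<le> grid_floor n t" for n
    using divide_right_mono[OF ge[of n], of "real (Suc n)"]
    by (simp add: grid_floor_def diff_divide_distrib del: of_nat_Suc)
  have "0 \<le> \<lfloor>t * real (Suc n)\<rfloor>" using assms by simp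
  then have "0 \<le> grid_floor n t" unfolding grid_floor_def by (intro divide_nonneg_pos) auto
  moreover have "grid_floor n t \<le> 1" using up[of n] assms by simp
  moreover have "grid_floor n t \<in> \<rat>" unfolding grid_floor_def by (intro Rats_divide Rats_of_int Rats_of_nat)
  ultimately show "grid_floor n t \<in> \<rat> \<inter> {0..1}" by simp
  have "(\<lambda>n. t - 1 / real (Suc n)) \<longlonglongrightarrow> t - 0"
    by (intro tendsto_diff tendsto_const LIMSEQ_Suc[OF lim_1_over_n])
  then have l: "(\<lambda>n. t - 1 / real (Suc n)) \<longlonglongrightarrow> t" by simp
  show "(\<lambda>n. grid_floor n t) \<longlonglongrightarrow> t"
    by (rule tendsto_sandwich[OF _ _ l tendsto_const]) (use up lo in auto)
qed

lemma closure_rat_unit: "closure (\<rat> \<inter> {0..1}) = {0..1::real}"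
proof
  show "closure (\<rat> \<inter> {0..1}) \<subseteq> {0..1::real}" by (rule closure_minimal) auto
  show "{0..1::real} \<subseteq> closure (\<rat> \<inter> {0..1})"
  proof
    fix t :: real assume "t \<in> {0..1}"
    from grid_floor[OF this] show "t \<in> closure (\<rat> \<inter> {0..1})"
      unfolding closure_sequential by (intro exI[of _ "\<lambda>n. grid_floor n t"]) blast
  qed
qed

lemma path_val_uniformly_continuous:
  "uniformly_continuous_on (\<rat> \<inter> {0..1}) (path_val (p :: ('n::finite) path))"
proof -
  have "uniformly_continuous_on {0..1} (path_val p)"
    using path_val[of p] by (intro compact_uniformly_continuous) auto
  then show ?thesis unfolding uniformly_continuous_on_def by (meson IntD2)
qed

text \<open>The events that a coordinate at a rational time lies below a rational bound are
  countably many and determine the path. Each of them can be read off from \<open>U w\<close> up to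
  a null set. The work lies in making the reconstruction measurable and path-valued at every point,
  not just at almost every one.\<close>

lemma left_inverse_exists:
  fixes U :: "('n::finite) path \<Rightarrow> 'n path"
  assumes sep: "\<And>A. A \<in> sets path_borel \<Longrightarrow> \<exists>B \<in> sets path_borel. AE w in M. w \<in> A \<longleftrightarrow> U w \<in> B"
  shows "\<exists>V \<in> path_borel \<rightarrow>\<^sub>M path_borel. AE w in M. V (U w) = w"
proof -
  let ?Q = "\<rat> \<inter> {0..1::real}"
  have Q: "countable ?Q" using countable_rat by blast
  have "\<exists>B \<in> sets path_borel. AE w in M. path_val w r $ i < real_of_rat q \<longleftrightarrow> U w \<in> B" for r i and q :: rat
  proof -
    have "{w :: 'n path. path_val w r $ i < real_of_rat q} = (\<lambda>w. path_val w r) -` {x. x $ i < real_of_rat q} \<inter> space path_borel"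
      by auto
    also have "\<dots> \<in> sets path_borel"
      by (rule measurable_sets[OF measurable_path_val]) (auto intro!: borel_open open_Collect_less continuous_intros)
    finally show ?thesis using sep[of "{w. path_val w r $ i < real_of_rat q}"] by simp
  qed
  note ex = this
  define B where "B = (\<lambda>r i (q::rat). SOME B. B \<in> sets path_borel \<and> (AE w in M. path_val w r $ i < real_of_rat q \<longleftrightarrow> U w \<in> B))"
  have B: "B r i q \<in> sets path_borel" and eq: "AE w in M. path_val w r $ i < real_of_rat q \<longleftrightarrow> U w \<in> B r i q" for r i q
    using someI_ex[OF ex[of r i q, unfolded Bex_def]] unfolding B_def by blast+
  \<comment> \<open>A real number is the infimum of the rationals above it; membership in
    \<open>B r i q\<close> replaces the test against \<open>q\<close>. If the infimum is infinite,
    \<open>real_of_ereal\<close> returns \<open>0\<close>, so \<open>X\<close> is total.\<close>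
  define X where "X = (\<lambda>r w'. \<chi> i. real_of_ereal (INF q. if w' \<in> B r i q then ereal (real_of_rat q) else \<infinity>))"
  have X [measurable]: "X r \<in> borel_measurable path_borel" for r
  proof -
    have [measurable]: "B r i q \<in> sets path_borel" for i q by (rule B)
    have "(\<lambda>w'. X r w' $ i) \<in> borel_measurable path_borel" for i
      unfolding X_def vec_lambda_beta by measurable
    then show ?thesis by (subst borel_measurable_euclidean_space) (auto simp: Basis_vec_def inner_axis)
  qed
  have XU: "AE w in M. \<forall>r\<in>?Q. X r (U w) = path_val w r"
  proof -
    have "AE w in M. \<forall>r\<in>?Q. \<forall>i\<in>UNIV. \<forall>q. path_val w r $ i < real_of_rat q \<longleftrightarrow> U w \<in> B r i q"
      using eq by (simp add: AE_ball_countable[OF Q] AE_finite_all AE_all_countable)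
    then show ?thesis
    proof eventually_elim
      case (elim w)
      show ?case
      proof
        fix r assume r: "r \<in> ?Q"
        have "(INF q. if U w \<in> B r i q then ereal (real_of_rat q) else \<infinity>) = ereal (path_val w r $ i)" for i
        proof -
          let ?x = "path_val w r $ i"
          have "(if U w \<in> B r i q then ereal (real_of_rat q) else \<infinity>) = (if ?x < real_of_rat q then ereal (real_of_rat q) else \<infinity>)" for q
            using elim r by auto
          moreover have "(INF q. if ?x < real_of_rat q then ereal (real_of_rat q) else \<infinity>) = ereal ?x"
          proof (rule antisym)
            show "ereal ?x \<le> (INF q. if ?x < real_of_rat q then ereal (real_of_rat q) else \<infinity>)"
              by (rule INF_greatest) (auto intro: less_imp_le)
            show "(INF q. if ?x < real_of_rat q then ereal (real_of_rat q) else \<infinity>) \<le> ereal ?x"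
            proof (rule ereal_le_epsilon2)
              fix e :: real assume "0 < e"
              then obtain q where q: "?x < real_of_rat q" "real_of_rat q < ?x + e" using of_rat_dense[of ?x "?x + e"] by auto
              have "(INF q. if ?x < real_of_rat q then ereal (real_of_rat q) else \<infinity>) \<le> ereal (real_of_rat q)"
                by (rule INF_lower2[of q]) (use q in auto)
              also have "\<dots> \<le> ereal ?x + ereal e" using q by simp
              finally show "(INF q. if ?x < real_of_rat q then ereal (real_of_rat q) else \<infinity>) \<le> ereal ?x + ereal e" .
            qed
          qed
          ultimately show ?thesis by simp
        qed
        then show "X r (U w) = path_val w r" by (simp add: X_def vec_eq_iff)
      qed
    qed
  qed
  \<comment> \<open>The points whose reconstructed values extend to a continuous path. Uniform
    continuity is written with countable quantifiers, which makes this set measurable.\<close>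
  define G where "G = {w'. \<forall>k::nat. \<exists>m::nat. \<forall>r\<in>?Q. \<forall>r'\<in>?Q. dist r r' < 1 / real (Suc m) \<longrightarrow> dist (X r w') (X r' w') \<le> 1 / real (Suc k)}"
  have Gm: "G \<in> sets path_borel"
  proof -
    have "Measurable.pred path_borel (\<lambda>w'. \<forall>k::nat. \<exists>m::nat. \<forall>r\<in>?Q. \<forall>r'\<in>?Q. dist r r' < 1 / real (Suc m) \<longrightarrow> dist (X r w') (X r' w') \<le> 1 / real (Suc k))"
    proof -
      \<comment> \<open>Quantification over the countable type \<open>rat\<close> instead of a set
        of reals lets the measurability of countable quantifiers apply.\<close>
      have ball: "(\<forall>r\<in>?Q. P r) \<longleftrightarrow> (\<forall>a::rat. real_of_rat a \<in> {0..1} \<longrightarrow> P (real_of_rat a))" for P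
        by (auto simp: Rats_def)
      show ?thesis unfolding ball by measurable
    qed
    then show ?thesis by (simp add: G_def pred_def)
  qed
  have G_iff: "w' \<in> G \<longleftrightarrow> uniformly_continuous_on ?Q (\<lambda>r. X r w')" for w'
  proof
    assume "w' \<in> G"
    then have G: "\<And>k. \<exists>m. \<forall>r\<in>?Q. \<forall>r'\<in>?Q. dist r r' < 1 / real (Suc m) \<longrightarrow> dist (X r w') (X r' w') \<le> 1 / real (Suc k)"
      by (simp add: G_def)
    show "uniformly_continuous_on ?Q (\<lambda>r. X r w')"
      unfolding uniformly_continuous_on_def
    proof (intro allI impI)
      fix e :: real assume "0 < e"
      then obtain k where k: "1 / real (Suc k) < e" using nat_approx_posE by metis
      obtain m where m: "\<And>r r'. r \<in> ?Q \<Longrightarrow> r' \<in> ?Q \<Longrightarrow> dist r r' < 1 / real (Suc m) \<Longrightarrow> dist (X r w') (X r' w') \<le> 1 / real (Suc k)"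
        using G[of k] by blast
      show "\<exists>d>0. \<forall>x\<in>?Q. \<forall>x'\<in>?Q. dist x' x < d \<longrightarrow> dist (X x' w') (X x w') < e"
      proof (intro exI[of _ "1 / real (Suc m)"] conjI ballI impI)
        fix x x' assume "x \<in> ?Q" "x' \<in> ?Q" "dist x' x < 1 / real (Suc m)"
        then have "dist (X x' w') (X x w') \<le> 1 / real (Suc k)" by (intro m)
        then show "dist (X x' w') (X x w') < e" using k by (rule le_less_trans)
      qed simp
    qed
  next
    assume u: "uniformly_continuous_on ?Q (\<lambda>r. X r w')"
    have "\<exists>m::nat. \<forall>r\<in>?Q. \<forall>r'\<in>?Q. dist r r' < 1 / real (Suc m) \<longrightarrow> dist (X r w') (X r' w') \<le> 1 / real (Suc k)" for k :: nat
    proof -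
      obtain d where d: "d > 0" "\<And>r r'. r \<in> ?Q \<Longrightarrow> r' \<in> ?Q \<Longrightarrow> dist r r' < d \<Longrightarrow> dist (X r w') (X r' w') < 1 / real (Suc k)"
      proof -
        have "\<exists>d>0. \<forall>x\<in>?Q. \<forall>x'\<in>?Q. dist x' x < d \<longrightarrow> dist (X x' w') (X x w') < 1 / real (Suc k)"
          by (rule u[unfolded uniformly_continuous_on_def, THEN spec[of _ "1 / real (Suc k)"], THEN mp]) simp
        then show ?thesis using that by blast
      qed
      obtain m where "1 / real (Suc m) < d" using d(1) nat_approx_posE by metis
      then show ?thesis using d(2) by (intro exI[of _ m] ballI impI less_imp_le) (blast intro: less_trans)
    qed
    then show "w' \<in> G" by (simp add: G_def)
  qed
  \<comment> \<open>Zero outside \<open>G\<close> and outside the unit interval, so that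
    \<open>Path (p w')\<close> is legitimate for every \<open>w'\<close>.\<close>
  define p where "p = (\<lambda>w' t. if w' \<in> G \<and> t \<in> {0..1} then lim (\<lambda>n. X (grid_floor n t) w') else 0)"
  have p_path: "continuous_on {0..1} (p w') \<and> (\<forall>t. t \<notin> {0..1} \<longrightarrow> p w' t = 0)" for w'
  proof (cases "w' \<in> G")
    case True
    then obtain g where g: "uniformly_continuous_on {0..1} g" "\<And>r. r \<in> ?Q \<Longrightarrow> X r w' = g r"
      using uniformly_continuous_on_extension_on_closure[of ?Q "\<lambda>r. X r w'"] unfolding G_iff closure_rat_unit by metis
    have gc: "continuous_on {0..1} g" by (rule uniformly_continuous_imp_continuous[OF g(1)])
    have "p w' t = g t" if t: "t \<in> {0..1}" for t
    proof -
      have "(\<lambda>n. g (grid_floor n t)) \<longlonglongrightarrow> g t"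
        by (rule continuous_on_tendsto_compose[OF gc grid_floor(2)[OF t] t]) (use grid_floor(1)[OF t] in auto)
      then have "(\<lambda>n. X (grid_floor n t) w') \<longlonglongrightarrow> g t" using g(2)[OF grid_floor(1)[OF t]] by simp
      then show ?thesis using True t by (simp add: p_def limI)
    qed
    then have "continuous_on {0..1} (p w')" using gc continuous_on_cong[of "{0..1}" "{0..1}" "p w'" g] by blast
    then show ?thesis by (auto simp: p_def)
  qed (simp add: p_def)
  define V where "V = (\<lambda>w'. Path (p w'))"
  have pV: "path_val (V w') = p w'" for w' unfolding V_def using p_path[of w'] by (subst Path_inverse) auto
  have "V \<in> path_borel \<rightarrow>\<^sub>M path_borel"
  proof (rule measurable_path_borelI)
    fix t
    show "(\<lambda>w'. path_val (V w') t) \<in> borel_measurable path_borel"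
    proof (cases "t \<in> {0..1}")
      case True
      have "(\<lambda>w'. lim (\<lambda>n. X (grid_floor n t) w')) \<in> borel_measurable path_borel"
        by (intro borel_measurable_lim_metric X)
      then have "(\<lambda>w'. if w' \<in> G then lim (\<lambda>n. X (grid_floor n t) w') else 0) \<in> borel_measurable path_borel"
        using Gm by (intro measurable_If_set) auto
      then show ?thesis using True by (simp add: pV p_def)
    next
      case False
      then have "path_val (V w') t = 0" for w' using p_path pV by simp
      then show ?thesis by simp
    qed
  qed
  moreover have "AE w in M. V (U w) = w"
    using XU
  proof eventually_elim
    case (elim w)
    have "uniformly_continuous_on ?Q (\<lambda>r. X r (U w)) \<longleftrightarrow> uniformly_continuous_on ?Q (path_val w)"
      unfolding uniformly_continuous_on_def using elim by simp
    then have G: "U w \<in> G" unfolding G_iff using path_val_uniformly_continuous by blast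
    show ?case
    proof (rule path_eqI)
      fix t :: real assume t: "t \<in> {0..1}"
      have "continuous_on {0..1} (path_val w)" using path_val[of w] by simp
      then have "(\<lambda>n. path_val w (grid_floor n t)) \<longlonglongrightarrow> path_val w t"
        by (rule continuous_on_tendsto_compose[OF _ grid_floor(2)[OF t] t]) (use grid_floor(1)[OF t] in auto)
      then have "(\<lambda>n. X (grid_floor n t) (U w)) \<longlonglongrightarrow> path_val w t"
        using elim grid_floor(1)[OF t] by simp
      then show "path_val (V (U w)) t = path_val w t" using G t by (simp add: pV p_def limI)
    qed
  qed
  ultimately show ?thesis by blast
qed

section \<open>Simple integrands\<close>

text \<open>The endpoints of the coarse interval are grid points, so a cell lies in it exactly when
  its right endpoint does; what is left telescopes.\<close>

lemma sum_telescope_indicator: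
  fixes T :: "nat \<Rightarrow> real" and G :: "real \<Rightarrow> 'v::real_vector"
  assumes mono: "\<And>i j. i < j \<Longrightarrow> j \<le> m \<Longrightarrow> T i < T j" and ab: "a \<le> c" "c \<le> m"
  shows "(\<Sum>j<m. indicator {T a<..T c} (T (Suc j)) *\<^sub>R (G (T (Suc j)) - G (T j))) = G (T c) - G (T a)"
proof -
  have le: "i \<le> j \<Longrightarrow> j \<le> m \<Longrightarrow> T i \<le> T j" for i j using mono[of i j] by (cases "i = j") auto
  have ind: "T (Suc j) \<in> {T a<..T c} \<longleftrightarrow> j \<in> {a..<c}" if "j < m" for j
  proof -
    consider "j < a" | "a \<le> j" "j < c" | "c \<le> j" by linarith
    then show ?thesis
      using le[of "Suc j" a] mono[of a "Suc j"] le[of "Suc j" c] mono[of c "Suc j"] that ab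
      by cases auto
  qed
  have "(\<Sum>j<m. indicator {T a<..T c} (T (Suc j)) *\<^sub>R (G (T (Suc j)) - G (T j)))
      = (\<Sum>j\<in>{a..<c}. G (T (Suc j)) - G (T j))"
  proof (rule sum.mono_neutral_cong_right)
    have "T (Suc j) \<notin> {T a<..T c}" if "j \<in> {..<m} - {a..<c}" for j using that ind[of j] by blast
    then show "\<forall>j\<in>{..<m} - {a..<c}. indicator {T a<..T c} (T (Suc j)) *\<^sub>R (G (T (Suc j)) - G (T j)) = 0"
      by (simp add: indicator_def)
  next
    fix j assume "j \<in> {a..<c}"
    then have "T (Suc j) \<in> {T a<..T c}" using ind[of j] ab by auto
    then show "indicator {T a<..T c} (T (Suc j)) *\<^sub>R (G (T (Suc j)) - G (T j)) = G (T (Suc j)) - G (T j)"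
      by (simp add: indicator_def)
  qed (use ab in auto)
  also have "\<dots> = G (T c) - G (T a)" using sum_Suc_diff'[of a c "\<lambda>j. G (T j)"] ab by simp
  finally show ?thesis .
qed

text \<open>The squared norm of the simple process in L2 of the time line, see
  \<open>nn_integral_simple_process_sq\<close>. As a finite sum over cells, its value through cell
  \<open>i\<close> is visibly known at time \<open>t i\<close>.\<close>

definition simple_energy ::
    "nat \<Rightarrow> (nat \<Rightarrow> real) \<Rightarrow> (nat \<Rightarrow> ('n::finite) path \<Rightarrow> real ^ 'n) \<Rightarrow> 'n path \<Rightarrow> real" where
  "simple_energy m t \<xi> w = (\<Sum>i<m. (t (Suc i) - t i) * (norm (\<xi> i w))\<^sup>2)"

lemma simple_integrand_mono:
  assumes "simple_integrand \<nu> m t \<xi>"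
  shows "i < j \<Longrightarrow> j \<le> m \<Longrightarrow> t i < t j"
proof (induction j)
  case (Suc j)
  then have "t j < t (Suc j)" using assms by (simp add: simple_integrand_def)
  then show ?case using Suc by (cases "i = j") auto
qed simp

lemma simple_integrand_mono_le:
  "simple_integrand \<nu> m t \<xi> \<Longrightarrow> i \<le> j \<Longrightarrow> j \<le> m \<Longrightarrow> t i \<le> t j"
  using simple_integrand_mono[of \<nu> m t \<xi> i j] by (cases "i = j") auto

lemma simple_integrand_bounds:
  assumes "simple_integrand \<nu> m t \<xi>" "i \<le> m"
  shows "0 \<le> t i" "t i \<le> 1"
  using simple_integrand_mono_le[OF assms(1), of 0 i] simple_integrand_mono_le[OF assms(1), of i m] assms
  by (auto simp: simple_integrand_def)

lemma simple_integrand_restrict: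
  assumes "simple_integrand \<nu> m t \<xi>" "k \<le> m"
  shows "simple_integrand \<nu> k t \<xi>"
  using assms simple_integrand_bounds(2)[OF assms] unfolding simple_integrand_def by auto

lemma simple_process_cases:
  assumes si: "simple_integrand \<nu> m t \<xi>"
  obtains (outside) "s \<notin> {t 0<..t m}" "\<And>i. i < m \<Longrightarrow> s \<notin> {t i<..t (Suc i)}"
  | (inside) i where "i < m" "\<And>j. j < m \<Longrightarrow> s \<in> {t j<..t (Suc j)} \<longleftrightarrow> j = i"
proof (cases "\<exists>i<m. s \<in> {t i<..t (Suc i)}")
  case True
  then obtain i where i: "i < m" "s \<in> {t i<..t (Suc i)}" by auto
  have "j = i" if "j < m" "s \<in> {t j<..t (Suc j)}" for j
  proof (rule ccontr)
    assume "j \<noteq> i"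
    then consider "Suc j \<le> i" | "Suc i \<le> j" by linarith
    then show False
      using i that simple_integrand_mono_le[OF si, of "Suc j" i] simple_integrand_mono_le[OF si, of "Suc i" j]
      by cases auto
  qed
  then show ?thesis using i inside by blast
next
  case False
  have "s \<notin> {t 0<..t k}" if "k \<le> m" for k
    using that
  proof (induction k)
    case (Suc k)
    then have "s \<notin> {t k<..t (Suc k)}" "s \<notin> {t 0<..t k}" using False by auto
    then show ?case by auto
  qed simp
  then show ?thesis using False outside by blast
qed

text \<open>The cells are disjoint, so at any time at most one summand is nonzero, and a function
  that vanishes at \<open>0\<close> may be applied to the summands separately.\<close>

lemma simple_process_comp:
  fixes \<phi> :: "real ^ ('n::finite) \<Rightarrow> 'v::real_vector"
  assumes si: "simple_integrand \<nu> m t \<xi>" and "\<phi> 0 = 0"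
  shows "\<phi> (simple_process m t \<xi> w s) = (\<Sum>i<m. indicator {t i<..t (Suc i)} s *\<^sub>R \<phi> (\<xi> i w))"
  using si
proof (cases rule: simple_process_cases[where s = s])
  case outside
  have "(\<Sum>j<m. indicator {t j<..t (Suc j)} s *\<^sub>R \<xi> j w) = 0" "(\<Sum>j<m. indicator {t j<..t (Suc j)} s *\<^sub>R \<phi> (\<xi> j w)) = 0"
    using outside by (auto intro!: sum.neutral simp: indicator_def)
  then show ?thesis using assms(2) unfolding simple_process_def by simp
next
  case (inside i)
  have "(\<Sum>j<m. indicator {t j<..t (Suc j)} s *\<^sub>R \<xi> j w) = \<xi> i w"
  proof -
    have "(\<Sum>j<m. indicator {t j<..t (Suc j)} s *\<^sub>R \<xi> j w) = (\<Sum>j\<in>{i}. \<xi> j w)"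
      using inside by (intro sum.mono_neutral_cong_right) (auto simp: indicator_def)
    then show ?thesis by simp
  qed
  moreover have "(\<Sum>j<m. indicator {t j<..t (Suc j)} s *\<^sub>R \<phi> (\<xi> j w)) = \<phi> (\<xi> i w)"
  proof -
    have "(\<Sum>j<m. indicator {t j<..t (Suc j)} s *\<^sub>R \<phi> (\<xi> j w)) = (\<Sum>j\<in>{i}. \<phi> (\<xi> j w))"
      using inside by (intro sum.mono_neutral_cong_right) (auto simp: indicator_def)
    then show ?thesis by simp
  qed
  ultimately show ?thesis unfolding simple_process_def by simp
qed

lemma has_bochner_integral_indicator_Ioc:
  "a \<le> c \<Longrightarrow> has_bochner_integral lborel (\<lambda>s. indicator {a<..c} s *\<^sub>R x) ((c - a) *\<^sub>R (x::'v::{banach,second_countable_topology}))"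
  using has_bochner_integral_scaleR_left[OF has_bochner_integral_real_indicator[of "{a<..c}" lborel]]
  by simp

lemma has_bochner_integral_simple_comp:
  fixes \<phi> :: "real ^ ('n::finite) \<Rightarrow> 'v::{banach,second_countable_topology}"
  assumes si: "simple_integrand \<nu> m t \<xi>" and "\<phi> 0 = 0"
  shows "has_bochner_integral lborel (\<lambda>s. \<phi> (simple_process m t \<xi> w s)) (\<Sum>i<m. (t (Suc i) - t i) *\<^sub>R \<phi> (\<xi> i w))"
  by (subst simple_process_comp[where \<phi> = \<phi>, OF assms], intro has_bochner_integral_sum has_bochner_integral_indicator_Ioc)
    (use si in \<open>auto simp: simple_integrand_def less_imp_le\<close>)

lemma simple_process_outside:
  assumes si: "simple_integrand \<nu> m t \<xi>" and "s \<notin> {0<..1}"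
  shows "simple_process m t \<xi> w s = 0"
proof -
  have "s \<notin> {t i<..t (Suc i)}" if "i < m" for i
    using that assms simple_integrand_bounds[OF si, of i] simple_integrand_bounds[OF si, of "Suc i"] by auto
  then show ?thesis unfolding simple_process_def by (auto intro!: sum.neutral simp: indicator_def)
qed

lemma simple_energy_nonneg: "simple_integrand \<nu> m t \<xi> \<Longrightarrow> 0 \<le> simple_energy m t \<xi> w"
  unfolding simple_energy_def
  by (intro sum_nonneg mult_nonneg_nonneg) (auto simp: simple_integrand_def less_imp_le)

lemma nn_integral_simple_process_sq:
  assumes si: "simple_integrand \<nu> m t \<xi>"
  shows "(\<integral>\<^sup>+s. ennreal ((norm (simple_process m t \<xi> w s))\<^sup>2) \<partial>lborel) = ennreal (simple_energy m t \<xi> w)"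
proof -
  have "has_bochner_integral lborel (\<lambda>s. (norm (simple_process m t \<xi> w s))\<^sup>2) (simple_energy m t \<xi> w)"
    using has_bochner_integral_simple_comp[OF si, of "\<lambda>x. (norm x)\<^sup>2" w] by (simp add: simple_energy_def)
  then show ?thesis
    by (subst nn_integral_eq_integral) (auto simp: has_bochner_integral_iff)
qed

text \<open>Subtracting two simple integrands, or inserting a time into a grid, requires a common
  finer grid. The new value on a cell is the old process at the right endpoint of the cell, because
  the cells are closed on the right.\<close>

lemma simple_integrand_refine:
  fixes \<beta> :: "('n::finite) path \<Rightarrow> 'n path"
  assumes si: "simple_integrand \<nu> m t \<xi>" and S: "finite S" "S \<subseteq> {0..1}" "t ` {..m} \<subseteq> S"
  defines "T \<equiv> \<lambda>j. sorted_list_of_set S ! j" and "\<xi>' \<equiv> \<lambda>j w. simple_process m t \<xi> w (sorted_list_of_set S ! Suc j)"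
  shows "simple_integrand \<nu> (card S - 1) T \<xi>'"
    and "simple_process (card S - 1) T \<xi>' w s = simple_process m t \<xi> w s"
    and "simple_integral \<beta> (card S - 1) T \<xi>' w = simple_integral \<beta> m t \<xi> w"
    and "T ` {..card S - 1} = S"
proof -
  define L where "L = sorted_list_of_set S"
  define k where "k = card S - 1"
  have ne: "S \<noteq> {}" using S(3) by auto
  have lenL: "length L = Suc k" using ne S(1) by (simp add: L_def k_def card_gt_0_iff)
  have setL: "set L = S" and srt: "sorted_wrt (<) L" using S(1) by (auto simp: L_def strict_sorted_iff)
  have T: "T j = L ! j" for j by (simp add: T_def L_def)
  have mono: "i < j \<Longrightarrow> j \<le> k \<Longrightarrow> T i < T j" for i j
    using sorted_wrt_nth_less[OF srt] lenL by (auto simp: T)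
  have img: "T ` {..k} = S"
    using setL lenL by (force simp: T set_conv_nth image_def less_Suc_eq_le)
  then show "T ` {..card S - 1} = S" by (simp add: k_def)
  have inS: "j \<le> k \<Longrightarrow> T j \<in> S" for j using img by auto
  have idx: "\<exists>a\<le>k. t i = T a" if "i \<le> m" for i
  proof -
    have "t i \<in> T ` {..k}" unfolding img using S(3) that by auto
    then show ?thesis by auto
  qed
  have \<xi>': "\<xi>' j w = (\<Sum>i<m. indicator {t i<..t (Suc i)} (T (Suc j)) *\<^sub>R \<xi> i w)" for j w
    unfolding \<xi>'_def T_def simple_process_def ..
  have tele: "(\<Sum>j<k. indicator {t i<..t (Suc i)} (T (Suc j)) *\<^sub>R (G (T (Suc j)) - G (T j))) = G (t (Suc i)) - G (t i)"
    if "i < m" for i and G :: "real \<Rightarrow> 'v::real_vector"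
  proof -
    obtain a c where ac: "a \<le> k" "t i = T a" "c \<le> k" "t (Suc i) = T c"
      using idx[of i] idx[of "Suc i"] \<open>i < m\<close> by auto
    have "t i < t (Suc i)" using si that by (simp add: simple_integrand_def)
    then have "a \<le> c" using mono[of c a] ac by (cases "a \<le> c") auto
    then show ?thesis unfolding ac using sum_telescope_indicator[of k T a c G] mono ac by auto
  qed
  show "simple_integral \<beta> (card S - 1) T \<xi>' w = simple_integral \<beta> m t \<xi> w"
  proof -
    let ?G = "\<lambda>x. path_val (\<beta> w) x"
    have "simple_integral \<beta> k T \<xi>' w
        = (\<Sum>j<k. \<Sum>i<m. \<xi> i w \<bullet> (indicator {t i<..t (Suc i)} (T (Suc j)) *\<^sub>R (?G (T (Suc j)) - ?G (T j))))"
      unfolding simple_integral_def \<xi>' by (simp add: inner_sum_left)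
    also have "\<dots> = (\<Sum>i<m. \<xi> i w \<bullet> (\<Sum>j<k. indicator {t i<..t (Suc i)} (T (Suc j)) *\<^sub>R (?G (T (Suc j)) - ?G (T j))))"
      by (subst sum.swap) (simp only: inner_sum_right)
    also have "\<dots> = simple_integral \<beta> m t \<xi> w"
      unfolding simple_integral_def by (intro sum.cong refl) (simp only: tele lessThan_iff)
    finally show ?thesis by (simp add: k_def)
  qed
  show "simple_process (card S - 1) T \<xi>' w s = simple_process m t \<xi> w s"
  proof -
    \<comment> \<open>The indicator of a half-open interval at \<open>s\<close> is an increment of
      this step function, so the telescoping identity serves the process as well as the
      integral.\<close>
    let ?G = "\<lambda>x. - indicator {..<s} x :: real"
    have ind: "indicator {x<..y} s = ?G y - ?G x" if "x \<le> y" for x y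
      using that by (auto simp: indicator_def)
    have 1: "indicator {T j<..T (Suc j)} s = ?G (T (Suc j)) - ?G (T j)" if "j < k" for j
      using mono[of j "Suc j"] that by (intro ind) auto
    have 2: "indicator {t i<..t (Suc i)} s = ?G (t (Suc i)) - ?G (t i)" if "i < m" for i
      using si that by (intro ind) (auto simp: simple_integrand_def less_imp_le)
    have "simple_process k T \<xi>' w s
        = (\<Sum>j<k. \<Sum>i<m. (indicator {t i<..t (Suc i)} (T (Suc j)) *\<^sub>R (?G (T (Suc j)) - ?G (T j))) *\<^sub>R \<xi> i w)"
      unfolding simple_process_def \<xi>' scaleR_sum_right
      by (intro sum.cong refl) (simp add: 1 mult.commute)
    also have "\<dots> = (\<Sum>i<m. (\<Sum>j<k. indicator {t i<..t (Suc i)} (T (Suc j)) *\<^sub>R (?G (T (Suc j)) - ?G (T j))) *\<^sub>R \<xi> i w)"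
      by (subst sum.swap) (simp only: scaleR_sum_left)
    also have "\<dots> = simple_process m t \<xi> w s"
      unfolding simple_process_def using tele[of _ ?G] 2 by (intro sum.cong refl) (simp only: lessThan_iff)
    finally show ?thesis by (simp add: k_def)
  qed
  show "simple_integrand \<nu> (card S - 1) T \<xi>'"
    unfolding simple_integrand_def k_def[symmetric]
  proof (intro conjI allI impI)
    show "0 \<le> T 0" "T k \<le> 1" using inS[of 0] inS[of k] S(2) by auto
    show "T i < T (Suc i)" if "i < k" for i using mono that by simp
    fix j assume j: "j < k"
    \<comment> \<open>A fine cell whose right endpoint lies beyond \<open>t i\<close> starts at or
      after \<open>t i\<close>, since \<open>t i\<close> is itself a grid point; so
      \<open>\<xi> i\<close> is already known when the cell begins.\<close>
    have "(\<lambda>w. indicator {t i<..t (Suc i)} (T (Suc j)) *\<^sub>R \<xi> i w) \<in> borel_measurable (filtr \<nu> id (T j))" if "i < m" for i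
    proof (cases "T (Suc j) \<in> {t i<..t (Suc i)}")
      case True
      obtain a where a: "a \<le> k" "t i = T a" using idx[of i] less_imp_le[OF \<open>i < m\<close>] by auto
      have "a \<le> j"
      proof (rule ccontr)
        assume "\<not> a \<le> j"
        then have "T (Suc j) \<le> T a" using mono[of "Suc j" a] a by (cases "Suc j = a") auto
        then show False using True a by auto
      qed
      then have "t i \<le> T j" using mono[of a j] a j by (cases "a = j") auto
      then have "\<xi> i \<in> borel_measurable (filtr \<nu> id (T j))"
        using si that sets_filtr_mono[of "t i" "T j" \<nu> id] by (auto simp: simple_integrand_def measurable_def)
      then show ?thesis using True by simp
    qed simp
    then show "\<xi>' j \<in> borel_measurable (filtr \<nu> id (T j))"
      unfolding \<xi>'[abs_def] by (intro borel_measurable_sum) auto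
    have "\<exists>C. \<forall>w. norm (\<xi> i w) \<le> C" if "i < m" for i
      using si that by (auto simp: simple_integrand_def bounded_iff)
    then obtain C where C: "\<And>i w. i < m \<Longrightarrow> norm (\<xi> i w) \<le> C i" by metis
    have "norm (\<xi>' j w) \<le> (\<Sum>i<m. C i)" for w
      unfolding \<xi>'
    proof (rule sum_norm_le)
      fix i assume "i \<in> {..<m}"
      then show "norm (indicator {t i<..t (Suc i)} (T (Suc j)) *\<^sub>R \<xi> i w) \<le> C i"
        using C[of i w] order_trans[OF norm_ge_zero C[of i w]] by (auto simp: indicator_def)
    qed
    then show "bounded (range (\<xi>' j))" by (auto simp: bounded_iff)
  qed
qed

lemma simple_integrand_diff:
  fixes \<beta> :: "('n::finite) path \<Rightarrow> 'n path"
  assumes si: "simple_integrand \<nu> m t \<xi>" and si': "simple_integrand \<nu> m' t' \<xi>'"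
  obtains k T \<zeta> where "simple_integrand \<nu> k T \<zeta>"
    "\<And>w s. simple_process k T \<zeta> w s = simple_process m t \<xi> w s - simple_process m' t' \<xi>' w s"
    "\<And>w. simple_integral \<beta> k T \<zeta> w = simple_integral \<beta> m t \<xi> w - simple_integral \<beta> m' t' \<xi>' w"
proof -
  define S where "S = t ` {..m} \<union> t' ` {..m'}"
  have S: "finite S" "S \<subseteq> {0..1}" "t ` {..m} \<subseteq> S" "t' ` {..m'} \<subseteq> S"
    using simple_integrand_bounds[OF si] simple_integrand_bounds[OF si'] by (auto simp: S_def)
  define T where "T = (\<lambda>j. sorted_list_of_set S ! j)"
  define k where "k = card S - 1"
  define z where "z = (\<lambda>j w. simple_process m t \<xi> w (sorted_list_of_set S ! Suc j))"
  define z' where "z' = (\<lambda>j w. simple_process m' t' \<xi>' w (sorted_list_of_set S ! Suc j))"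
  note r = simple_integrand_refine[OF si S(1,2,3), folded T_def k_def z_def]
  note r' = simple_integrand_refine[OF si' S(1,2,4), folded T_def k_def z'_def]
  let ?\<zeta> = "\<lambda>j w. z j w - z' j w"
  have 1: "simple_integrand \<nu> k T ?\<zeta>"
    using r(1) r'(1) unfolding simple_integrand_def
    by (auto intro!: bounded_minus_comp borel_measurable_diff)
  have 2: "simple_process k T ?\<zeta> w s = simple_process m t \<xi> w s - simple_process m' t' \<xi>' w s" for w s
    unfolding r(2)[symmetric] r'(2)[symmetric] unfolding simple_process_def
    by (simp add: sum_subtractf scaleR_diff_right)
  have 3: "simple_integral \<beta> k T ?\<zeta> w = simple_integral \<beta> m t \<xi> w - simple_integral \<beta> m' t' \<xi>' w" for w
    unfolding r(3)[symmetric] r'(3)[symmetric] unfolding simple_integral_def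
    by (simp add: sum_subtractf inner_diff_left)
  show ?thesis using that[OF 1 2 3] .
qed

lemma lborel_nn_integral_reflect:
  fixes f :: "'a::euclidean_space \<Rightarrow> ennreal"
  assumes [measurable]: "f \<in> borel_measurable borel"
  shows "(\<integral>\<^sup>+x. f (- x) \<partial>lborel) = (\<integral>\<^sup>+x. f x \<partial>lborel)"
proof -
  have "(lborel :: 'a measure) = distr lborel borel uminus"
    using lborel_affine[of "-1" "0::'a"] by (simp add: density_1 uminus_add_conv_diff[symmetric] cong: distr_cong)
  then have "(\<integral>\<^sup>+x. f x \<partial>lborel) = (\<integral>\<^sup>+x. f x \<partial>distr lborel borel uminus)" by simp
  also have "\<dots> = (\<integral>\<^sup>+x. f (- x) \<partial>lborel)" by (rule nn_integral_distr) auto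
  finally show ?thesis ..
qed

section \<open>Moments and tails of simple stochastic integrals\<close>

context path_brownian
begin

lemma prob_UNIV [simp]: "prob UNIV = 1"
  using prob_space by simp

lemma UNIV_events [simp]: "UNIV \<in> events"
  using sets.top[of M] by simp

text \<open>With \<open>Z\<close> frozen, Cauchy--Schwarz reduces the claim to the second moment of
  the Gaussian norm. That moment is \<open>CARD('n) * (t - s)\<close>, whence the dimension in the
  bound.\<close>

lemma incr_second_moment:
  fixes s t :: real
  assumes st: "0 \<le> s" "s < t" "t \<le> 1" and Z: "Z \<in> borel_measurable (F s)"
    and int: "integrable M (\<lambda>w. (norm (Z w))\<^sup>2)"
  shows "integrable M (\<lambda>w. (Z w \<bullet> incr s t w)\<^sup>2)"
    and "expectation (\<lambda>w. (Z w \<bullet> incr s t w)\<^sup>2) \<le> CARD('n) * (t - s) * expectation (\<lambda>w. (norm (Z w))\<^sup>2)"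
proof -
  have ZM [measurable]: "Z \<in> borel_measurable M" using Z by (rule F_measurable_M)
  note Z [measurable]
  let ?n = "real CARD('n)"
  have "(\<integral>\<^sup>+w. ennreal ((Z w \<bullet> incr s t w)\<^sup>2) \<partial>M) \<le> (\<integral>\<^sup>+w. ennreal ((norm (Z w))\<^sup>2 * (norm (incr s t w))\<^sup>2) \<partial>M)"
    by (intro nn_integral_mono ennreal_leI)
      (metis Cauchy_Schwarz_ineq2 abs_ge_zero power2_abs power_mono power_mult_distrib)
  also have "\<dots> = (\<integral>\<^sup>+w. (\<integral>\<^sup>+(x::real^'n). ennreal ((norm (Z w))\<^sup>2 * (norm x)\<^sup>2) * ennreal (gauss_density (t - s) x) \<partial>lborel) \<partial>M)"
    by (rule freezing[OF st, of "\<lambda>w x. ennreal ((norm (Z w))\<^sup>2 * (norm x)\<^sup>2)"]) measurable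
  also have "\<dots> = (\<integral>\<^sup>+w. ennreal ((norm (Z w))\<^sup>2) * ennreal (?n * (t - s)) \<partial>M)"
    using st by (intro nn_integral_cong)
      (simp add: ennreal_mult mult.assoc nn_integral_cmult nn_integral_gauss_density_norm_sq)
  also have "\<dots> = ennreal (expectation (\<lambda>w. (norm (Z w))\<^sup>2)) * ennreal (?n * (t - s))"
    by (simp add: nn_integral_multc nn_integral_eq_integral[OF int])
  also have "\<dots> = ennreal (?n * (t - s) * expectation (\<lambda>w. (norm (Z w))\<^sup>2))"
    using st by (simp add: ennreal_mult[symmetric] mult.commute)
  finally have le: "(\<integral>\<^sup>+w. ennreal ((Z w \<bullet> incr s t w)\<^sup>2) \<partial>M) \<le> \<dots>" .
  show i: "integrable M (\<lambda>w. (Z w \<bullet> incr s t w)\<^sup>2)"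
    using le_less_trans[OF le ennreal_less_top] by (intro integrableI_bounded) auto
  show "expectation (\<lambda>w. (Z w \<bullet> incr s t w)\<^sup>2) \<le> ?n * (t - s) * expectation (\<lambda>w. (norm (Z w))\<^sup>2)"
    using le st by (simp add: nn_integral_eq_integral[OF i] ennreal_le_iff)
qed

text \<open>The Gaussian density is even, so with \<open>Z\<close> frozen the positive and the
  negative part of the product have the same integral.\<close>

lemma incr_mean_zero:
  fixes s t :: real
  assumes st: "0 \<le> s" "s < t" "t \<le> 1" and Z: "Z \<in> borel_measurable (F s)"
    and int: "integrable M (\<lambda>w. (norm (Z w))\<^sup>2)"
  shows "integrable M (\<lambda>w. Z w \<bullet> incr s t w)" and "expectation (\<lambda>w. Z w \<bullet> incr s t w) = 0"
proof -
  have ZM [measurable]: "Z \<in> borel_measurable M" using Z by (rule F_measurable_M)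
  note Z [measurable]
  show i: "integrable M (\<lambda>w. Z w \<bullet> incr s t w)"
    by (rule square_integrable_imp_integrable) (use incr_second_moment[OF assms] in auto)
  have "(\<integral>\<^sup>+w. ennreal (Z w \<bullet> incr s t w) \<partial>M) = (\<integral>\<^sup>+w. (\<integral>\<^sup>+x. ennreal (Z w \<bullet> x) * ennreal (gauss_density (t - s) x) \<partial>lborel) \<partial>M)"
    by (rule freezing[OF st, of "\<lambda>w x. ennreal (Z w \<bullet> x)"]) measurable
  also have "\<dots> = (\<integral>\<^sup>+w. (\<integral>\<^sup>+x. ennreal (- (Z w \<bullet> x)) * ennreal (gauss_density (t - s) x) \<partial>lborel) \<partial>M)"
  proof (rule nn_integral_cong)
    fix w
    have "(\<integral>\<^sup>+x. ennreal (Z w \<bullet> x) * ennreal (gauss_density (t - s) x) \<partial>lborel)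
        = (\<integral>\<^sup>+x. ennreal (Z w \<bullet> (- x)) * ennreal (gauss_density (t - s) (- x)) \<partial>lborel)"
      by (rule lborel_nn_integral_reflect[symmetric]) measurable
    then show "(\<integral>\<^sup>+x. ennreal (Z w \<bullet> x) * ennreal (gauss_density (t - s) x) \<partial>lborel)
        = (\<integral>\<^sup>+x. ennreal (- (Z w \<bullet> x)) * ennreal (gauss_density (t - s) x) \<partial>lborel)"
      by (simp add: gauss_density_minus)
  qed
  also have "\<dots> = (\<integral>\<^sup>+w. ennreal (- (Z w \<bullet> incr s t w)) \<partial>M)"
    by (rule freezing[OF st, of "\<lambda>w x. ennreal (- (Z w \<bullet> x))", symmetric]) measurable
  finally show "expectation (\<lambda>w. Z w \<bullet> incr s t w) = 0"
    unfolding real_lebesgue_integral_def[OF i] by simp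
qed

abbreviation "simple \<equiv> simple_integrand \<nu>"
abbreviation "sint \<equiv> simple_integral \<beta>"

lemma simple_integral_Suc:
  "sint (Suc k) t \<xi> w = sint k t \<xi> w + \<xi> k w \<bullet> incr (t k) (t (Suc k)) w"
  by (simp add: simple_integral_def incr_def)

lemma simple_bounded:
  assumes "simple m t \<xi>"
  obtains C where "C \<ge> 0" "\<And>i w. i < m \<Longrightarrow> norm (\<xi> i w) \<le> C"
proof -
  have "\<exists>C. \<forall>w. norm (\<xi> i w) \<le> C" if "i < m" for i
    using assms that by (auto simp: simple_integrand_def bounded_iff)
  then obtain C where C: "\<And>i w. i < m \<Longrightarrow> norm (\<xi> i w) \<le> C i" by metis
  have "C i \<le> (\<Sum>j<m. \<bar>C j\<bar>)" if "i < m" for i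
  proof -
    have "\<bar>C i\<bar> \<le> (\<Sum>j<m. \<bar>C j\<bar>)" using that by (intro member_le_sum) auto
    then show ?thesis by simp
  qed
  then show ?thesis using that[of "\<Sum>j<m. \<bar>C j\<bar>"] C by (meson abs_ge_zero order_trans sum_nonneg)
qed

lemma simple_measurable:
  assumes "simple m t \<xi>" "i < m" "t i \<le> r"
  shows "\<xi> i \<in> borel_measurable (F r)"
  using assms F_mono[of "t i" r] by (auto simp: simple_integrand_def)

lemma simple_measurable_M: "simple m t \<xi> \<Longrightarrow> i < m \<Longrightarrow> \<xi> i \<in> borel_measurable M"
  using simple_measurable[of m t \<xi> i "t i"] by (auto intro: F_measurable_M)

lemma simple_integral_measurable_F:
  assumes si: "simple m t \<xi>"
  shows "sint m t \<xi> \<in> borel_measurable (F (t m))"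
  unfolding simple_integral_def[abs_def] incr_def[symmetric]
  using simple_integrand_bounds[OF si] simple_integrand_mono_le[OF si]
  by (intro borel_measurable_sum borel_measurable_inner simple_measurable[OF si] measurable_incr_F) auto

lemma simple_integral_measurable: "simple m t \<xi> \<Longrightarrow> sint m t \<xi> \<in> borel_measurable M"
  by (rule F_measurable_M[OF simple_integral_measurable_F])

lemma simple_energy_measurable: "simple m t \<xi> \<Longrightarrow> simple_energy m t \<xi> \<in> borel_measurable M"
  unfolding simple_energy_def[abs_def]
  by (intro borel_measurable_sum borel_measurable_times borel_measurable_const borel_measurable_power measurable_compose[OF _ borel_measurable_norm])
    (auto intro: simple_measurable_M)

lemma simple_norm_sq_integrable:
  assumes si: "simple m t \<xi>" and i: "i < m"
  shows "integrable M (\<lambda>w. (norm (\<xi> i w))\<^sup>2)"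
proof -
  obtain C where C: "C \<ge> 0" "\<And>i w. i < m \<Longrightarrow> norm (\<xi> i w) \<le> C" using simple_bounded[OF si] by blast
  have [measurable]: "\<xi> i \<in> borel_measurable M" using si i by (rule simple_measurable_M)
  show ?thesis
    by (rule integrable_const_bound[where B = "C\<^sup>2"]) (use C i in \<open>auto intro!: power_mono\<close>)
qed

lemma simple_energy_integrable: "simple m t \<xi> \<Longrightarrow> integrable M (simple_energy m t \<xi>)"
  unfolding simple_energy_def[abs_def]
  by (rule Bochner_Integration.integrable_sum) (auto intro: simple_norm_sq_integrable)

text \<open>Each new term is orthogonal to the partial sum before it, because the partial sum times
  \<open>\<xi> k\<close> is known at time \<open>t k\<close>; boundedness of \<open>\<xi> k\<close>
  keeps that product square integrable. The last claim is the Ito isometry as an inequality.\<close>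

lemma simple_integral_moments:
  assumes si: "simple m t \<xi>"
  shows "integrable M (\<lambda>w. (sint m t \<xi> w)\<^sup>2)" (is "?A m")
    and "integrable M (sint m t \<xi>)" (is "?B m")
    and "expectation (sint m t \<xi>) = 0" (is "?C m")
    and "expectation (\<lambda>w. (sint m t \<xi> w)\<^sup>2) \<le> CARD('n) * expectation (simple_energy m t \<xi>)" (is "?D m")
proof -
  have "?A k \<and> ?B k \<and> ?C k \<and> ?D k" if "k \<le> m" for k
    using that
  proof (induction k)
    case 0
    then show ?case by (simp add: simple_integral_def simple_energy_def)
  next
    case (Suc k)
    then have IH: "?A k" "?B k" "?C k" "?D k" and k: "k < m" by auto
    have sk: "simple k t \<xi>" using simple_integrand_restrict[OF si] k by simp
    let ?d = "\<lambda>w. \<xi> k w \<bullet> incr (t k) (t (Suc k)) w"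
    have st: "0 \<le> t k" "t k < t (Suc k)" "t (Suc k) \<le> 1"
      using simple_integrand_bounds[OF si] k si by (auto simp: simple_integrand_def)
    have \<xi>: "\<xi> k \<in> borel_measurable (F (t k))" using simple_measurable[OF si k] by simp
    note \<xi>M [measurable] = simple_measurable_M[OF si k]
    note IM [measurable] = simple_integral_measurable[OF sk]
    note sq = simple_norm_sq_integrable[OF si k]
    note d2 = incr_second_moment[OF st \<xi> sq] and d1 = incr_mean_zero[OF st \<xi> sq]
    obtain C where C: "C \<ge> 0" "\<And>i w. i < m \<Longrightarrow> norm (\<xi> i w) \<le> C" using simple_bounded[OF si] by blast
    have "integrable M (\<lambda>w. (norm (sint k t \<xi> w *\<^sub>R \<xi> k w))\<^sup>2)"
    proof (rule Bochner_Integration.integrable_bound)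
      show "integrable M (\<lambda>w. C\<^sup>2 * (sint k t \<xi> w)\<^sup>2)" using IH(1) by simp
      show "AE w in M. norm ((norm (sint k t \<xi> w *\<^sub>R \<xi> k w))\<^sup>2) \<le> norm (C\<^sup>2 * (sint k t \<xi> w)\<^sup>2)"
        using C k by (auto simp: power_mult_distrib mult.commute intro!: mult_right_mono power_mono)
    qed measurable
    then have cross: "integrable M (\<lambda>w. sint k t \<xi> w * ?d w)" "expectation (\<lambda>w. sint k t \<xi> w * ?d w) = 0"
      using incr_mean_zero[OF st borel_measurable_scaleR[OF simple_integral_measurable_F[OF sk] \<xi>]] by simp_all
    have sq_eq: "(sint (Suc k) t \<xi> w)\<^sup>2 = (sint k t \<xi> w)\<^sup>2 + 2 * (sint k t \<xi> w * ?d w) + (?d w)\<^sup>2" for w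
      unfolding simple_integral_Suc by (simp add: power2_sum)
    have A: "?A (Suc k)" unfolding sq_eq using IH(1) cross(1) d2(1) by simp
    have E: "simple_energy (Suc k) t \<xi> w = simple_energy k t \<xi> w + (t (Suc k) - t k) * (norm (\<xi> k w))\<^sup>2" for w
      by (simp add: simple_energy_def)
    have "expectation (\<lambda>w. (sint (Suc k) t \<xi> w)\<^sup>2) = expectation (\<lambda>w. (sint k t \<xi> w)\<^sup>2) + expectation (\<lambda>w. (?d w)\<^sup>2)"
      unfolding sq_eq using IH(1) cross d2(1) by simp
    also have "\<dots> \<le> CARD('n) * expectation (simple_energy (Suc k) t \<xi>)"
      unfolding E using IH(4) d2(2) simple_energy_integrable[OF sk] sq by (simp add: algebra_simps)
    finally have "?D (Suc k)" .
    moreover have "?B (Suc k)" "?C (Suc k)"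
      unfolding simple_integral_Suc[abs_def] using IH(2,3) d1 by simp_all
    ultimately show ?case using A by blast
  qed
  then show "?A m" "?B m" "?C m" "?D m" by auto
qed

text \<open>Chebyshev's inequality for an integrand whose energy is capped at \<open>d\<close>;
  where the cap is inactive both integrals agree. Smallness of the energy in probability is thereby
  passed to the integral, and \<open>has_stoch_integral\<close> speaks of nothing stronger.\<close>

lemma simple_integral_tail:
  fixes d \<epsilon> :: real
  assumes si: "simple m t \<xi>" and pos: "0 < \<epsilon>" "0 < d"
  shows "prob {w. \<bar>sint m t \<xi> w\<bar> > \<epsilon>} \<le> prob {w. simple_energy m t \<xi> w > d} + CARD('n) * d / \<epsilon>\<^sup>2"
proof -
  \<comment> \<open>switch the integrand off as soon as its energy exceeds \<open>d\<close>\<close>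
  define \<zeta> where "\<zeta> = (\<lambda>i w. indicator {w. simple_energy (Suc i) t \<xi> w \<le> d} w *\<^sub>R \<xi> i w)"
  have delta: "0 \<le> t (Suc i) - t i" if "i < m" for i using si that by (auto simp: simple_integrand_def less_imp_le)
  have enF: "simple_energy (Suc i) t \<xi> \<in> borel_measurable (F (t i))" if "i < m" for i
    unfolding simple_energy_def[abs_def] using that simple_integrand_mono_le[OF si]
    by (intro borel_measurable_sum borel_measurable_times borel_measurable_const borel_measurable_power
        measurable_compose[OF _ borel_measurable_norm] simple_measurable[OF si]) auto
  have s\<zeta>: "simple m t \<zeta>"
    unfolding simple_integrand_def
  proof (intro conjI allI impI)
    fix i assume i: "i < m"
    have [measurable]: "simple_energy (Suc i) t \<xi> \<in> borel_measurable (F (t i))" "\<xi> i \<in> borel_measurable (F (t i))"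
      using enF[OF i] simple_measurable[OF si i] by auto
    show "\<zeta> i \<in> borel_measurable (F (t i))" unfolding \<zeta>_def by measurable
    show "bounded (range (\<zeta> i))"
    proof -
      obtain C where "\<And>w. norm (\<xi> i w) \<le> C"
        using simple_bounded[OF si] i by metis
      moreover have "norm (\<zeta> i w) \<le> norm (\<xi> i w)" for w by (auto simp: \<zeta>_def indicator_def)
      ultimately show ?thesis unfolding bounded_iff by (intro exI[of _ C]) (auto intro: order_trans)
    qed
  qed (use si in \<open>auto simp: simple_integrand_def\<close>)
  \<comment> \<open>The comparison with the energy of \<open>\<xi>\<close> is carried along for the
    induction: in a step where the cell is kept, it is what yields the bound
    \<open>d\<close>.\<close>
  have en: "simple_energy k t \<zeta> w \<le> d \<and> simple_energy k t \<zeta> w \<le> simple_energy k t \<xi> w" if "k \<le> m" for k w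
    using that
  proof (induction k)
    case 0
    then show ?case using pos by (simp add: simple_energy_def)
  next
    case (Suc k)
    have S: "simple_energy (Suc k) t \<eta> w = simple_energy k t \<eta> w + (t (Suc k) - t k) * (norm (\<eta> k w))\<^sup>2" for \<eta>
      by (simp add: simple_energy_def)
    have "0 \<le> (t (Suc k) - t k) * (norm (\<xi> k w))\<^sup>2" using delta[of k] Suc.prems by simp
    then show ?case
      using Suc by (cases "simple_energy (Suc k) t \<xi> w \<le> d") (auto simp: S \<zeta>_def)
  qed
  have same: "sint m t \<zeta> w = sint m t \<xi> w" if "simple_energy m t \<xi> w \<le> d" for w
    unfolding simple_integral_def
  proof (rule sum.cong)
    fix i assume i: "i \<in> {..<m}"
    have "simple_energy (Suc i) t \<xi> w \<le> simple_energy m t \<xi> w"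
      unfolding simple_energy_def using i delta by (intro sum_mono2) auto
    then show "\<zeta> i w \<bullet> (path_val (\<beta> w) (t (Suc i)) - path_val (\<beta> w) (t i)) = \<xi> i w \<bullet> (path_val (\<beta> w) (t (Suc i)) - path_val (\<beta> w) (t i))"
      using that by (simp add: \<zeta>_def)
  qed simp
  note [measurable] = simple_integral_measurable[OF si] simple_integral_measurable[OF s\<zeta>] simple_energy_measurable[OF si]
  have "prob {w \<in> space M. \<epsilon>\<^sup>2 \<le> (sint m t \<zeta> w)\<^sup>2} \<le> expectation (\<lambda>w. (sint m t \<zeta> w)\<^sup>2) / \<epsilon>\<^sup>2"
    by (rule integral_Markov_inequality_measure[where A = "space M"])
      (use simple_integral_moments[OF s\<zeta>] pos in auto)
  also have "\<dots> \<le> CARD('n) * d / \<epsilon>\<^sup>2"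
  proof (rule divide_right_mono)
    have "expectation (simple_energy m t \<zeta>) \<le> expectation (\<lambda>_. d)"
      using en by (intro integral_mono simple_energy_integrable[OF s\<zeta>]) auto
    then have "expectation (simple_energy m t \<zeta>) \<le> d" by simp
    then show "expectation (\<lambda>w. (sint m t \<zeta> w)\<^sup>2) \<le> CARD('n) * d"
      using simple_integral_moments(4)[OF s\<zeta>] by (meson mult_left_mono of_nat_0_le_iff order_trans)
  qed simp
  finally have 1: "prob {w \<in> space M. \<epsilon>\<^sup>2 \<le> (sint m t \<zeta> w)\<^sup>2} \<le> CARD('n) * d / \<epsilon>\<^sup>2" .
  have "{w. \<bar>sint m t \<xi> w\<bar> > \<epsilon>} \<subseteq> {w \<in> space M. simple_energy m t \<xi> w > d} \<union> {w \<in> space M. \<epsilon>\<^sup>2 \<le> (sint m t \<zeta> w)\<^sup>2}"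
  proof
    fix w assume w: "w \<in> {w. \<bar>sint m t \<xi> w\<bar> > \<epsilon>}"
    have "\<epsilon>\<^sup>2 \<le> \<bar>sint m t \<xi> w\<bar>\<^sup>2" using w pos by (intro power_mono) auto
    then show "w \<in> {w \<in> space M. simple_energy m t \<xi> w > d} \<union> {w \<in> space M. \<epsilon>\<^sup>2 \<le> (sint m t \<zeta> w)\<^sup>2}"
      using same[of w] by (cases "simple_energy m t \<xi> w \<le> d") auto
  qed
  then have "prob {w. \<bar>sint m t \<xi> w\<bar> > \<epsilon>} \<le> prob ({w \<in> space M. simple_energy m t \<xi> w > d} \<union> {w \<in> space M. \<epsilon>\<^sup>2 \<le> (sint m t \<zeta> w)\<^sup>2})"
    by (intro finite_measure_mono) measurable
  also have "\<dots> \<le> prob {w \<in> space M. simple_energy m t \<xi> w > d} + prob {w \<in> space M. \<epsilon>\<^sup>2 \<le> (sint m t \<zeta> w)\<^sup>2}"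
    by (rule measure_Un_le) measurable
  finally show ?thesis using 1 by simp
qed

end

section \<open>Continuity of translations in mean\<close>

text \<open>By outer regularity \<open>A\<close> lies in an open \<open>U\<close> with small excess.
  A point of \<open>A\<close> stays in \<open>U\<close> under small translations, so the mass
  leaving \<open>U\<close> vanishes by dominated convergence; the mass landing in
  \<open>U - A\<close> is at most the excess, whatever the translation.\<close>

lemma indicator_translation_tendsto_zero:
  fixes A :: "real set" and q :: "nat \<Rightarrow> real"
  assumes A: "A \<in> sets lborel" "emeasure lborel A < \<infinity>" and q: "q \<longlonglongrightarrow> 0"
  shows "(\<lambda>k. \<integral>\<^sup>+x. indicator A x * indicator (- A) (x + q k) \<partial>lborel) \<longlonglongrightarrow> (0::ennreal)"
proof (rule tendsto_0_if_Limsup_eq_0_ennreal)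
  have [measurable]: "A \<in> sets borel" using A by simp
  have "limsup (\<lambda>k. \<integral>\<^sup>+x. indicator A x * indicator (- A) (x + q k) \<partial>lborel) \<le> 0 + ennreal \<epsilon>" if \<epsilon>: "\<epsilon> > 0" for \<epsilon>
  proof -
    obtain U where U: "open U" "A \<subseteq> U" "emeasure lborel (U - A) < \<epsilon>"
      using outer_regular_lborel[of A \<epsilon>] \<epsilon> by auto
    have [measurable]: "U \<in> sets borel" using U by simp
    have lim: "(\<lambda>k. \<integral>\<^sup>+x. indicator A x * indicator (- U) (x + q k) \<partial>lborel) \<longlonglongrightarrow> (\<integral>\<^sup>+(x::real). 0 \<partial>lborel)"
    proof (rule nn_integral_dominated_convergence[where w = "indicator A"])
      show "AE x in lborel. (\<lambda>k. indicator A x * indicator (- U) (x + q k)) \<longlonglongrightarrow> (0::ennreal)"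
      proof (rule AE_I2)
        fix x
        show "(\<lambda>k. indicator A x * indicator (- U) (x + q k)) \<longlonglongrightarrow> (0::ennreal)"
        proof (cases "x \<in> A")
          case True
          have "(\<lambda>k. x + q k) \<longlonglongrightarrow> x" using tendsto_add[OF tendsto_const q, of x] by simp
          then have "\<forall>\<^sub>F k in sequentially. x + q k \<in> U"
            using True U by (auto dest: topological_tendstoD)
          then have "\<forall>\<^sub>F k in sequentially. indicator A x * indicator (- U) (x + q k) = (0::ennreal)"
            by (rule eventually_mono) (simp add: indicator_def)
          then show ?thesis by (rule tendsto_eventually)
        qed simp
      qed
      show "(\<integral>\<^sup>+x. indicator A x \<partial>lborel) < \<infinity>" using A by simp
      show "AE x in lborel. indicator A x * indicator (- U) (x + q k) \<le> (indicator A x :: ennreal)" for k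
        by (auto simp: indicator_def)
    qed measurable
    have le: "(\<integral>\<^sup>+x. indicator A x * indicator (- A) (x + q k) \<partial>lborel)
        \<le> (\<integral>\<^sup>+x. indicator A x * indicator (- U) (x + q k) \<partial>lborel) + ennreal \<epsilon>" for k
    proof -
      have "(\<integral>\<^sup>+x. indicator A x * indicator (- A) (x + q k) \<partial>lborel)
          \<le> (\<integral>\<^sup>+x. indicator A x * indicator (- U) (x + q k) + indicator (U - A) (x + q k) \<partial>lborel)"
        by (intro nn_integral_mono) (auto simp: indicator_def)
      also have "\<dots> = (\<integral>\<^sup>+x. indicator A x * indicator (- U) (x + q k) \<partial>lborel) + (\<integral>\<^sup>+x. indicator (U - A) (x + q k) \<partial>lborel)"
        by (rule nn_integral_add) measurable
      also have "(\<integral>\<^sup>+x. indicator (U - A) (x + q k) \<partial>lborel) = emeasure lborel (U - A)"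
        by (subst lborel_nn_integral_translation) auto
      finally show ?thesis using U(3) by (meson add_left_mono less_imp_le order_trans)
    qed
    have "limsup (\<lambda>k. \<integral>\<^sup>+x. indicator A x * indicator (- A) (x + q k) \<partial>lborel)
        \<le> limsup (\<lambda>k. (\<integral>\<^sup>+x. indicator A x * indicator (- U) (x + q k) \<partial>lborel) + ennreal \<epsilon>)"
      by (intro Limsup_mono always_eventually allI le)
    also have "\<dots> = 0 + ennreal \<epsilon>"
      by (rule lim_imp_Limsup) (use tendsto_add[OF lim tendsto_const] in auto)
    finally show ?thesis .
  qed
  then have "limsup (\<lambda>k. \<integral>\<^sup>+x. indicator A x * indicator (- A) (x + q k) \<partial>lborel) \<le> 0"
    by (rule ennreal_le_epsilon)
  then show "limsup (\<lambda>k. \<integral>\<^sup>+x. indicator A x * indicator (- A) (x + q k) \<partial>lborel) = 0" by simp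
qed

lemma translation_tendsto_zero:
  fixes g :: "real \<Rightarrow> 'b::{banach, second_countable_topology}" and q :: "nat \<Rightarrow> real"
  assumes g: "integrable lborel g" and q: "q \<longlonglongrightarrow> 0"
  shows "(\<lambda>k. \<integral>\<^sup>+x. ennreal (norm (g (x + q k) - g x)) \<partial>lborel) \<longlonglongrightarrow> 0"
  using g
proof (induction rule: integrable_induct)
  case (base A c)
  have [measurable]: "A \<in> sets borel" using base by simp
  have q': "(\<lambda>k. - q k) \<longlonglongrightarrow> 0" using tendsto_minus[OF q] by simp
  \<comment> \<open>The symmetric difference of \<open>A\<close> and its translate splits into the
    mass that leaves and the mass that enters; the latter leaves under the opposite
    translation.\<close>
  have eq: "(\<integral>\<^sup>+x. ennreal (norm (indicator A (x + q k) *\<^sub>R c - indicator A x *\<^sub>R c)) \<partial>lborel)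
      = ((\<integral>\<^sup>+x. indicator A x * indicator (- A) (x + q k) \<partial>lborel)
        + (\<integral>\<^sup>+x. indicator A x * indicator (- A) (x + - q k) \<partial>lborel)) * ennreal (norm c)" for k
  proof -
    have "(\<integral>\<^sup>+x. indicator A x * indicator (- A) (x + - q k) \<partial>lborel)
        = (\<integral>\<^sup>+x. indicator A (x + q k) * indicator (- A) x \<partial>lborel)"
      by (subst lborel_nn_integral_translation[symmetric, of _ "q k"]) (auto simp: add.assoc)
    then have "((\<integral>\<^sup>+x. indicator A x * indicator (- A) (x + q k) \<partial>lborel)
        + (\<integral>\<^sup>+x. indicator A x * indicator (- A) (x + - q k) \<partial>lborel)) * ennreal (norm c)
        = (\<integral>\<^sup>+x. (indicator A x * indicator (- A) (x + q k) + indicator A (x + q k) * indicator (- A) x) * ennreal (norm c) \<partial>lborel)"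
      by (simp add: nn_integral_add nn_integral_multc)
    also have "\<dots> = (\<integral>\<^sup>+x. ennreal (norm (indicator A (x + q k) *\<^sub>R c - indicator A x *\<^sub>R c)) \<partial>lborel)"
      by (intro nn_integral_cong) (auto simp: indicator_def)
    finally show ?thesis ..
  qed
  have "(\<lambda>k. ((\<integral>\<^sup>+x. indicator A x * indicator (- A) (x + q k) \<partial>lborel)
        + (\<integral>\<^sup>+x. indicator A x * indicator (- A) (x + - q k) \<partial>lborel)) * ennreal (norm c)) \<longlonglongrightarrow> (0 + 0) * ennreal (norm c)"
    unfolding mult.commute[of _ "ennreal (norm c)"]
    using base q q' by (intro ennreal_tendsto_cmult tendsto_add indicator_translation_tendsto_zero) auto
  then show ?case unfolding eq by simp
next
  case (add f g)
  have [measurable]: "f \<in> borel_measurable borel" "g \<in> borel_measurable borel" using add(1,2) by auto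
  show ?case
  proof (rule tendsto_sandwich[OF _ _ tendsto_const])
    show "\<forall>\<^sub>F k in sequentially. (\<integral>\<^sup>+x. ennreal (norm (f (x + q k) + g (x + q k) - (f x + g x))) \<partial>lborel)
      \<le> (\<integral>\<^sup>+x. ennreal (norm (f (x + q k) - f x)) \<partial>lborel) + (\<integral>\<^sup>+x. ennreal (norm (g (x + q k) - g x)) \<partial>lborel)"
    proof (intro always_eventually allI)
      fix k
      have "(\<integral>\<^sup>+x. ennreal (norm (f (x + q k) + g (x + q k) - (f x + g x))) \<partial>lborel)
        \<le> (\<integral>\<^sup>+x. ennreal (norm (f (x + q k) - f x)) + ennreal (norm (g (x + q k) - g x)) \<partial>lborel)"
        by (intro nn_integral_mono) (simp add: ennreal_plus[symmetric] add_diff_add norm_triangle_ineq del: ennreal_plus)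
      also have "\<dots> = (\<integral>\<^sup>+x. ennreal (norm (f (x + q k) - f x)) \<partial>lborel) + (\<integral>\<^sup>+x. ennreal (norm (g (x + q k) - g x)) \<partial>lborel)"
        by (rule nn_integral_add) measurable
      finally show "(\<integral>\<^sup>+x. ennreal (norm (f (x + q k) + g (x + q k) - (f x + g x))) \<partial>lborel) \<le> \<dots>" .
    qed
    show "(\<lambda>k. (\<integral>\<^sup>+x. ennreal (norm (f (x + q k) - f x)) \<partial>lborel) + (\<integral>\<^sup>+x. ennreal (norm (g (x + q k) - g x)) \<partial>lborel)) \<longlonglongrightarrow> 0"
      using tendsto_add[OF add(3,4)] by simp
  qed simp
next
  case (lim g s)
  have [measurable]: "g \<in> borel_measurable borel" "s i \<in> borel_measurable borel" for i using lim(1,4) by auto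
  show ?case
  proof (rule tendsto_0_if_Limsup_eq_0_ennreal)
    have "limsup (\<lambda>k. \<integral>\<^sup>+x. ennreal (norm (g (x + q k) - g x)) \<partial>lborel) \<le> 0 + ennreal \<epsilon>" if "\<epsilon> > 0" for \<epsilon>
    proof -
      have "(\<lambda>i. \<integral>\<^sup>+x. ennreal (norm (g x - s i x)) \<partial>lborel) \<longlonglongrightarrow> 0"
      proof (rule nn_integral_dominated_convergence_norm[where w = "\<lambda>x. 2 * norm (g x)"])
        show "(\<integral>\<^sup>+x. ennreal (2 * norm (g x)) \<partial>lborel) < \<infinity>"
          using lim(4) by (simp add: integrable_iff_bounded ennreal_mult nn_integral_cmult ennreal_mult_less_top)
      qed (use lim in auto)
      then have "\<forall>\<^sub>F i in sequentially. (\<integral>\<^sup>+x. ennreal (norm (g x - s i x)) \<partial>lborel) < ennreal (\<epsilon> / 2)"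
        using that by (intro order_tendstoD) auto
      then obtain i where i: "(\<integral>\<^sup>+x. ennreal (norm (g x - s i x)) \<partial>lborel) < ennreal (\<epsilon> / 2)"
        by (auto simp: eventually_sequentially)
      have le: "(\<integral>\<^sup>+x. ennreal (norm (g (x + q k) - g x)) \<partial>lborel) \<le> (\<integral>\<^sup>+x. ennreal (norm (s i (x + q k) - s i x)) \<partial>lborel) + ennreal \<epsilon>" for k
      proof -
        have "(\<integral>\<^sup>+x. ennreal (norm (g (x + q k) - g x)) \<partial>lborel)
          \<le> (\<integral>\<^sup>+x. ennreal (norm (s i (x + q k) - s i x)) + (ennreal (norm (g (x + q k) - s i (x + q k))) + ennreal (norm (g x - s i x))) \<partial>lborel)"
        proof (rule nn_integral_mono)
          fix x
          have "norm (g (x + q k) - g x) = norm ((s i (x + q k) - s i x) + ((g (x + q k) - s i (x + q k)) - (g x - s i x)))"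
            by simp
          also have "\<dots> \<le> norm (s i (x + q k) - s i x) + (norm (g (x + q k) - s i (x + q k)) + norm (g x - s i x))"
            using norm_triangle_ineq norm_triangle_ineq4 by (meson add_left_mono order_trans)
          finally show "ennreal (norm (g (x + q k) - g x)) \<le> ennreal (norm (s i (x + q k) - s i x)) + (ennreal (norm (g (x + q k) - s i (x + q k))) + ennreal (norm (g x - s i x)))"
            by (simp add: ennreal_plus[symmetric] del: ennreal_plus)
        qed
        also have "\<dots> = (\<integral>\<^sup>+x. ennreal (norm (s i (x + q k) - s i x)) \<partial>lborel)
            + ((\<integral>\<^sup>+x. ennreal (norm (g (x + q k) - s i (x + q k))) \<partial>lborel) + (\<integral>\<^sup>+x. ennreal (norm (g x - s i x)) \<partial>lborel))"
          by (simp add: nn_integral_add)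
        also have "(\<integral>\<^sup>+x. ennreal (norm (g (x + q k) - s i (x + q k))) \<partial>lborel) = (\<integral>\<^sup>+x. ennreal (norm (g x - s i x)) \<partial>lborel)"
          by (rule lborel_nn_integral_translation[where f = "\<lambda>x. ennreal (norm (g x - s i x))"]) measurable
        also have "(\<integral>\<^sup>+x. ennreal (norm (g x - s i x)) \<partial>lborel) + (\<integral>\<^sup>+x. ennreal (norm (g x - s i x)) \<partial>lborel) \<le> ennreal (\<epsilon> / 2) + ennreal (\<epsilon> / 2)"
          using i by (intro add_mono) auto
        also have "ennreal (\<epsilon> / 2) + ennreal (\<epsilon> / 2) = ennreal \<epsilon>"
          using that by (subst ennreal_plus[symmetric]) auto
        finally show ?thesis by (simp add: add_left_mono)
      qed
      have "limsup (\<lambda>k. \<integral>\<^sup>+x. ennreal (norm (g (x + q k) - g x)) \<partial>lborel)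
        \<le> limsup (\<lambda>k. (\<integral>\<^sup>+x. ennreal (norm (s i (x + q k) - s i x)) \<partial>lborel) + ennreal \<epsilon>)"
        by (intro Limsup_mono always_eventually allI le)
      also have "\<dots> = 0 + ennreal \<epsilon>"
        by (rule lim_imp_Limsup) (use tendsto_add[OF lim(5)[of i] tendsto_const] in auto)
      finally show ?thesis .
    qed
    then have "limsup (\<lambda>k. \<integral>\<^sup>+x. ennreal (norm (g (x + q k) - g x)) \<partial>lborel) \<le> 0"
      by (rule ennreal_le_epsilon)
    then show "limsup (\<lambda>k. \<integral>\<^sup>+x. ennreal (norm (g (x + q k) - g x)) \<partial>lborel) = 0" by simp
  qed
qed

section \<open>Approximation of adapted densities by simple integrands\<close>

lemma simple_process_inside:
  assumes si: "simple_integrand \<nu> m t \<xi>" and i: "i < m" "s \<in> {t i<..t (Suc i)}"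
  shows "simple_process m t \<xi> w s = \<xi> i w"
  using si
proof (cases rule: simple_process_cases[where s = s])
  case outside
  then show ?thesis using i by blast
next
  case (inside k)
  then have [simp]: "k = i" using i by blast
  have "simple_process m t \<xi> w s = (\<Sum>j\<in>{i}. \<xi> j w)"
    unfolding simple_process_def using inside by (intro sum.mono_neutral_cong_right) (auto simp: indicator_def)
  then show ?thesis by simp
qed

lemma simple_process_zero:
  assumes si: "simple_integrand \<nu> m t \<xi>" and s: "s \<notin> {t 0<..t m}"
  shows "simple_process m t \<xi> w s = 0"
proof -
  have "s \<notin> {t i<..t (Suc i)}" if "i < m" for i
    using that s simple_integrand_mono_le[OF si, of 0 i] simple_integrand_mono_le[OF si, of "Suc i" m] by auto
  then show ?thesis unfolding simple_process_def by (auto intro!: sum.neutral simp: indicator_def)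
qed

text \<open>The windows of length \<open>h\<close> are pairwise disjoint, so at most one of them
  contains a given \<open>y\<close>. The tiling starts at \<open>- h\<close> because with offset
  \<open>r\<close> the grid is continued to the left by the point \<open>r - h\<close>.\<close>

lemma nn_integral_tiling_le:
  fixes \<psi> :: "real \<Rightarrow> ennreal"
  assumes [measurable]: "\<psi> \<in> borel_measurable borel" and h: "0 < h"
  shows "(\<integral>\<^sup>+r. indicator {0<..<h} r * (\<Sum>j\<le>N::nat. \<psi> (r + (real j * h - h))) \<partial>lborel) \<le> (\<integral>\<^sup>+y. \<psi> y \<partial>lborel)"
proof -
  have "(\<integral>\<^sup>+r. indicator {0<..<h} r * (\<Sum>j\<le>N. \<psi> (r + (real j * h - h))) \<partial>lborel)
      = (\<Sum>j\<le>N. \<integral>\<^sup>+r. indicator {0<..<h} r * \<psi> (r + (real j * h - h)) \<partial>lborel)"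
    unfolding sum_distrib_left by (rule nn_integral_sum) measurable
  also have "\<dots> = (\<Sum>j\<le>N. \<integral>\<^sup>+y. indicator {real j * h - h<..<real j * h} y * \<psi> y \<partial>lborel)"
  proof (rule sum.cong)
    fix j
    have "(\<integral>\<^sup>+r. indicator {0<..<h} r * \<psi> (r + (real j * h - h)) \<partial>lborel)
        = (\<integral>\<^sup>+r. indicator {real j * h - h<..<real j * h} (r + (real j * h - h)) * \<psi> (r + (real j * h - h)) \<partial>lborel)"
      by (intro nn_integral_cong) (auto simp: indicator_def)
    also have "\<dots> = (\<integral>\<^sup>+y. indicator {real j * h - h<..<real j * h} y * \<psi> y \<partial>lborel)"
      by (rule lborel_nn_integral_translation[where f = "\<lambda>y. indicator {real j * h - h<..<real j * h} y * \<psi> y"]) measurable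
    finally show "(\<integral>\<^sup>+r. indicator {0<..<h} r * \<psi> (r + (real j * h - h)) \<partial>lborel) = \<dots>" .
  qed simp
  also have "\<dots> = (\<integral>\<^sup>+y. (\<Sum>j\<le>N. indicator {real j * h - h<..<real j * h} y) * \<psi> y \<partial>lborel)"
    unfolding sum_distrib_right by (rule nn_integral_sum[symmetric]) measurable
  also have "\<dots> \<le> (\<integral>\<^sup>+y. 1 * \<psi> y \<partial>lborel)"
  proof (intro nn_integral_mono mult_right_mono)
    fix y
    show "(\<Sum>j\<le>N. indicator {real j * h - h<..<real j * h} y :: ennreal) \<le> 1"
    proof (cases "\<exists>j\<le>N. y \<in> {real j * h - h<..<real j * h}")
      case True
      then obtain j where j: "j \<le> N" "y \<in> {real j * h - h<..<real j * h}" by auto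
      have uniq: "i = j" if "y \<in> {real i * h - h<..<real i * h}" for i
      proof (rule ccontr)
        assume "i \<noteq> j"
        then consider "real i + 1 \<le> real j" | "real j + 1 \<le> real i" by linarith
        then show False
        proof cases
          case 1
          then have "(real i + 1) * h \<le> real j * h" using h by (intro mult_right_mono) auto
          then show False using that j by (simp add: algebra_simps)
        next
          case 2
          then have "(real j + 1) * h \<le> real i * h" using h by (intro mult_right_mono) auto
          then show False using that j by (simp add: algebra_simps)
        qed
      qed
      have "indicator {real i * h - h<..<real i * h} y = (if i = j then 1 else 0 :: ennreal)" for i
      proof (cases "i = j")
        case False
        then have "y \<notin> {real i * h - h<..<real i * h}" using uniq[of i] by blast
        then show ?thesis using False by (simp add: indicator_def)
      qed (use j(2) in \<open>simp add: indicator_def\<close>)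
      then have "(\<Sum>i\<le>N. indicator {real i * h - h<..<real i * h} y :: ennreal) = 1"
        using j(1) by simp
      then show ?thesis by simp
    next
      case False
      then have "(\<Sum>j\<le>N. indicator {real j * h - h<..<real j * h} y :: ennreal) = 0"
        by (intro sum.neutral) (auto simp: indicator_def)
      then show ?thesis by simp
    qed
  qed simp
  finally show ?thesis by simp
qed

section \<open>Sampling an adapted process on a shifted grid\<close>

context path_brownian
begin

sublocale pair_sigma_finite M lborel ..

text \<open>Sampling at the left endpoints of the cells respects adaptedness. Without regularity in
  time a single grid says little about \<open>v\<close>, since its points form a null set; so the
  error is written as a sum of translation errors started at the grid points, a form that can be
  averaged over the offset \<open>r\<close>.\<close>

lemma shift_grid:
  assumes adapted: "\<And>s. s \<in> {0..1} \<Longrightarrow> (\<lambda>w. v w s) \<in> borel_measurable (F s)"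
    and out: "\<And>w s. s \<notin> {0..1} \<Longrightarrow> v w s = (0 :: real ^ 'n)"
    and bd: "\<And>w s. norm (v w s) \<le> C"
    and N: "N \<ge> 1" "h = 1 / real N" and r: "0 < r" "r < h"
    and v: "\<And>w. v w \<in> borel_measurable borel"
  obtains t where "simple N t (\<lambda>i w. v w (t i))"
    "\<And>w. (\<integral>\<^sup>+s. ennreal ((norm (simple_process N t (\<lambda>i w. v w (t i)) w s - v w s))\<^sup>2) \<partial>lborel)
      \<le> (\<Sum>j\<le>N. \<integral>\<^sup>+q. indicator {0<..h} q * ennreal ((norm (v w (r + (real j * h - h) + q) - v w (r + (real j * h - h))))\<^sup>2) \<partial>lborel)"
proof -
  \<comment> \<open>The cells start at \<open>r + real i * h\<close>; the last point is moved to
    \<open>1\<close>, which shortens the last cell.\<close>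
  define t where "t = (\<lambda>i. if i < N then r + real i * h else 1)"
  have hN: "real N * h = 1" and h0: "h > 0" using N by auto
  have ih: "real i * h \<le> 1 - h" if "i < N" for i
  proof -
    have "(real i + 1) * h \<le> real N * h" using that h0 by (intro mult_right_mono) auto
    then show ?thesis using hN by (simp add: algebra_simps)
  qed
  have t01: "t i \<in> {0..1}" for i using ih[of i] r h0 by (auto simp: t_def)
  let ?\<xi> = "\<lambda>i w. v w (t i)"
  have si: "simple N t ?\<xi>"
    unfolding simple_integrand_def
  proof (intro conjI allI impI)
    show "0 \<le> t 0" "t N \<le> 1" using t01 by auto
    show "t i < t (Suc i)" if "i < N" for i
      using that ih[of i] r h0 by (auto simp: t_def algebra_simps)
    show "?\<xi> i \<in> borel_measurable (F (t i))" for i using adapted[OF t01] .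
    show "bounded (range (?\<xi> i))" for i using bd by (auto simp: bounded_iff)
  qed
  let ?y = "\<lambda>j. r + (real j * h - h)"
  have "(\<integral>\<^sup>+s. ennreal ((norm (simple_process N t ?\<xi> w s - v w s))\<^sup>2) \<partial>lborel)
      \<le> (\<Sum>j\<le>N. \<integral>\<^sup>+q. indicator {0<..h} q * ennreal ((norm (v w (?y j + q) - v w (?y j)))\<^sup>2) \<partial>lborel)" for w
  proof -
    have [measurable]: "v w \<in> borel_measurable borel" by (rule v)
    have pt: "ennreal ((norm (simple_process N t ?\<xi> w s - v w s))\<^sup>2)
        \<le> (\<Sum>j\<le>N. indicator {0<..h} (s - ?y j) * ennreal ((norm (v w s - v w (?y j)))\<^sup>2))" if "s \<noteq> 0" for s
    proof -
      have *: "?thesis" if "j \<le> N" "s - ?y j \<in> {0<..h}" "simple_process N t ?\<xi> w s = v w (?y j)" for j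
      proof -
        have "ennreal ((norm (simple_process N t ?\<xi> w s - v w s))\<^sup>2)
            = indicator {0<..h} (s - ?y j) * ennreal ((norm (v w s - v w (?y j)))\<^sup>2)"
          using that by (simp add: norm_minus_commute)
        also have "\<dots> \<le> (\<Sum>j\<le>N. indicator {0<..h} (s - ?y j) * ennreal ((norm (v w s - v w (?y j)))\<^sup>2))"
          using that by (intro member_le_sum) auto
        finally show ?thesis .
      qed
      consider "s \<notin> {0..1}" | "0 < s" "s \<le> r" | "r < s" "s \<le> 1" using \<open>s \<noteq> 0\<close> by force
      then show ?thesis
      proof cases
        case 1
        then have "simple_process N t ?\<xi> w s = 0" by (intro simple_process_outside[OF si]) auto
        then show ?thesis using out[OF 1] by simp
      next
        case 2
        have "s \<notin> {t 0<..t N}" using 2 N by (auto simp: t_def)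
        then have "simple_process N t ?\<xi> w s = 0" by (rule simple_process_zero[OF si])
        \<comment> \<open>Up to the first sampling time the simple process is zero, and so is
          \<open>v\<close> at the negative time \<open>r - h\<close>; hence the stretch before
          \<open>r\<close> fits the pattern as cell \<open>0\<close>.\<close>
        moreover have "v w (?y 0) = 0" using r by (intro out) auto
        ultimately show ?thesis using 2 r by (intro *[of 0]) auto
      next
        case 3
        have "\<exists>i<k. s \<in> {t i<..t (Suc i)}" if "k \<le> N" "s \<le> t k" for k
          using that
        proof (induction k)
          case 0
          then show ?case using 3 N by (auto simp: t_def)
        next
          case (Suc k)
          show ?case
          proof (cases "s \<le> t k")
            case True
            then show ?thesis using Suc by (auto intro: less_SucI)
          next
            case False
            then show ?thesis using Suc by (intro exI[of _ k]) auto
          qed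
        qed
        from this[of N] obtain i where i: "i < N" "s \<in> {t i<..t (Suc i)}"
          using 3 by (auto simp: t_def)
        have ti: "t i = ?y (Suc i)" using i by (simp add: t_def algebra_simps)
        have "t (Suc i) \<le> t i + h"
        proof (cases "Suc i < N")
          case True
          then show ?thesis by (simp add: t_def algebra_simps)
        next
          case False
          then have "N = Suc i" using i by simp
          then show ?thesis using hN r by (simp add: t_def algebra_simps)
        qed
        then show ?thesis
          using i simple_process_inside[OF si i] unfolding ti by (intro *[of "Suc i"]) auto
      qed
    qed
    have "AE s in lborel. s \<noteq> (0::real)" by (rule AE_lborel_singleton)
    then have "(\<integral>\<^sup>+s. ennreal ((norm (simple_process N t ?\<xi> w s - v w s))\<^sup>2) \<partial>lborel)
      \<le> (\<integral>\<^sup>+s. (\<Sum>j\<le>N. indicator {0<..h} (s - ?y j) * ennreal ((norm (v w s - v w (?y j)))\<^sup>2)) \<partial>lborel)"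
      by (intro nn_integral_mono_AE) (auto elim!: eventually_mono dest: pt)
    also have "\<dots> = (\<Sum>j\<le>N. \<integral>\<^sup>+s. indicator {0<..h} (s - ?y j) * ennreal ((norm (v w s - v w (?y j)))\<^sup>2) \<partial>lborel)"
      by (rule nn_integral_sum) measurable
    also have "\<dots> = (\<Sum>j\<le>N. \<integral>\<^sup>+q. indicator {0<..h} q * ennreal ((norm (v w (?y j + q) - v w (?y j)))\<^sup>2) \<partial>lborel)"
    proof (rule sum.cong)
      fix j
      let ?g = "\<lambda>s. indicator {0<..h} (s - ?y j) * ennreal ((norm (v w s - v w (?y j)))\<^sup>2)"
      have "(\<integral>\<^sup>+s. ?g s \<partial>lborel) = (\<integral>\<^sup>+q. ?g (q + ?y j) \<partial>lborel)"
        by (rule lborel_nn_integral_translation[symmetric]) measurable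
      then show "(\<integral>\<^sup>+s. ?g s \<partial>lborel)
          = (\<integral>\<^sup>+q. indicator {0<..h} q * ennreal ((norm (v w (?y j + q) - v w (?y j)))\<^sup>2) \<partial>lborel)"
        by (simp only: add_diff_cancel_right' add.commute[of _ "?y j"] add_diff_cancel_left')
    qed simp
    finally show ?thesis .
  qed
  then show ?thesis using si that by blast
qed

lemma measurable_time_comp:
  fixes v :: "'n path \<Rightarrow> real \<Rightarrow> 'b::topological_space"
  assumes v: "(\<lambda>(w, s). v w s) \<in> borel_measurable (M \<Otimes>\<^sub>M lborel)"
    and f: "f \<in> N \<rightarrow>\<^sub>M M" and g: "g \<in> borel_measurable N"
  shows "(\<lambda>p. v (f p) (g p)) \<in> borel_measurable N"
proof -
  have "(\<lambda>p. (f p, g p)) \<in> N \<rightarrow>\<^sub>M M \<Otimes>\<^sub>M lborel"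
    using f g by (intro measurable_Pair) simp_all
  from measurable_compose[OF this v] show ?thesis by simp
qed

text \<open>Boundedness estimates the squared error by \<open>2 * C\<close> times the error in L1,
  to which \<open>translation_tendsto_zero\<close> applies path by path; dominated convergence does
  the rest.\<close>

lemma translation_error_small:
  fixes v :: "'n path \<Rightarrow> real \<Rightarrow> real ^ 'n"
  assumes v: "(\<lambda>(w, s). v w s) \<in> borel_measurable (M \<Otimes>\<^sub>M lborel)"
    and out: "\<And>w s. s \<notin> {0..1} \<Longrightarrow> v w s = (0 :: real ^ 'n)"
    and bd: "\<And>w s. norm (v w s) \<le> C"
    and q: "q \<longlonglongrightarrow> 0"
  shows "(\<lambda>k. \<integral>\<^sup>+w. (\<integral>\<^sup>+y. ennreal ((norm (v w (y + q k) - v w y))\<^sup>2) \<partial>lborel) \<partial>M) \<longlonglongrightarrow> 0"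
proof -
  have C: "0 \<le> C" using bd[of undefined undefined] norm_ge_zero order_trans by blast
  note vm [measurable (raw)] = measurable_time_comp[OF v]
  have vw [measurable]: "v w \<in> borel_measurable borel" for w
    by measurable
  have bound: "norm (v w s) \<le> C * indicator {0..1} s" for w s
    using bd[of w s] out[of s w] by (auto simp: indicator_def)
  have int: "integrable lborel (v w)" for w
    by (rule Bochner_Integration.integrable_bound[where f = "\<lambda>s::real. C * indicator {0..1} s"]) (use bound C in \<open>auto intro!: integrable_mult_right integrable_real_indicator\<close>)
  have L1: "(\<integral>\<^sup>+s. ennreal (norm (v w s)) \<partial>lborel) \<le> ennreal C" for w
  proof -
    have "(\<integral>\<^sup>+s. ennreal (norm (v w s)) \<partial>lborel) \<le> (\<integral>\<^sup>+s. ennreal C * indicator {0..1::real} s \<partial>lborel)"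
    proof (rule nn_integral_mono)
      fix s
      show "ennreal (norm (v w s)) \<le> ennreal C * indicator {0..1} s"
        using bd[of w s] out[of s w] by (cases "s \<in> {0..1}") (auto intro: ennreal_leI)
    qed
    also have "\<dots> = ennreal C" by (simp add: nn_integral_cmult)
    finally show ?thesis .
  qed
  have J: "(\<lambda>k. \<integral>\<^sup>+w. (\<integral>\<^sup>+y. ennreal (norm (v w (y + q k) - v w y)) \<partial>lborel) \<partial>M) \<longlonglongrightarrow> (\<integral>\<^sup>+w. 0 \<partial>M)"
  proof (rule nn_integral_dominated_convergence[where w = "\<lambda>_. ennreal C + ennreal C"])
    show "(\<lambda>w. \<integral>\<^sup>+y. ennreal (norm (v w (y + q k) - v w y)) \<partial>lborel) \<in> borel_measurable M" for k
      by measurable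
    show "AE w in M. (\<integral>\<^sup>+y. ennreal (norm (v w (y + q k) - v w y)) \<partial>lborel) \<le> ennreal C + ennreal C" for k
    proof (rule AE_I2)
      fix w
      have "(\<integral>\<^sup>+y. ennreal (norm (v w (y + q k) - v w y)) \<partial>lborel)
          \<le> (\<integral>\<^sup>+y. ennreal (norm (v w (y + q k))) + ennreal (norm (v w y)) \<partial>lborel)"
        by (intro nn_integral_mono) (simp add: ennreal_plus[symmetric] norm_triangle_ineq4 del: ennreal_plus)
      also have "\<dots> = (\<integral>\<^sup>+y. ennreal (norm (v w (y + q k))) \<partial>lborel) + (\<integral>\<^sup>+y. ennreal (norm (v w y)) \<partial>lborel)"
        by (rule nn_integral_add) measurable
      also have "(\<integral>\<^sup>+y. ennreal (norm (v w (y + q k))) \<partial>lborel) = (\<integral>\<^sup>+y. ennreal (norm (v w y)) \<partial>lborel)"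
        by (rule lborel_nn_integral_translation[where f = "\<lambda>y. ennreal (norm (v w y))"]) measurable
      finally show "(\<integral>\<^sup>+y. ennreal (norm (v w (y + q k) - v w y)) \<partial>lborel) \<le> ennreal C + ennreal C"
        using add_mono[OF L1[of w] L1[of w]] by (rule order_trans)
    qed
    show "(\<integral>\<^sup>+w. ennreal C + ennreal C \<partial>M) < \<infinity>"
      by (simp add: emeasure_eq_measure)
    show "AE w in M. (\<lambda>k. \<integral>\<^sup>+y. ennreal (norm (v w (y + q k) - v w y)) \<partial>lborel) \<longlonglongrightarrow> 0"
      using translation_tendsto_zero[OF int q] by simp
  qed auto
  show ?thesis
  proof (rule tendsto_sandwich[OF _ _ tendsto_const])
    show "\<forall>\<^sub>F k in sequentially. (\<integral>\<^sup>+w. (\<integral>\<^sup>+y. ennreal ((norm (v w (y + q k) - v w y))\<^sup>2) \<partial>lborel) \<partial>M)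
      \<le> ennreal (2 * C) * (\<integral>\<^sup>+w. (\<integral>\<^sup>+y. ennreal (norm (v w (y + q k) - v w y)) \<partial>lborel) \<partial>M)"
    proof (intro always_eventually allI)
      fix k
      have "(norm (v w (y + q k) - v w y))\<^sup>2 \<le> 2 * C * norm (v w (y + q k) - v w y)" for w y
        unfolding power2_eq_square
        using norm_triangle_ineq4[of "v w (y + q k)" "v w y"] bd[of w "y + q k"] bd[of w y]
        by (intro mult_right_mono) auto
      then have "(\<integral>\<^sup>+w. (\<integral>\<^sup>+y. ennreal ((norm (v w (y + q k) - v w y))\<^sup>2) \<partial>lborel) \<partial>M)
        \<le> (\<integral>\<^sup>+w. (\<integral>\<^sup>+y. ennreal (2 * C) * ennreal (norm (v w (y + q k) - v w y)) \<partial>lborel) \<partial>M)"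
        using C by (intro nn_integral_mono) (simp add: ennreal_mult[symmetric] ennreal_leI)
      also have "\<dots> = ennreal (2 * C) * (\<integral>\<^sup>+w. (\<integral>\<^sup>+y. ennreal (norm (v w (y + q k) - v w y)) \<partial>lborel) \<partial>M)"
        by (simp add: nn_integral_cmult)
      finally show "(\<integral>\<^sup>+w. (\<integral>\<^sup>+y. ennreal ((norm (v w (y + q k) - v w y))\<^sup>2) \<partial>lborel) \<partial>M) \<le> \<dots>" .
    qed
    show "(\<lambda>k. ennreal (2 * C) * (\<integral>\<^sup>+w. (\<integral>\<^sup>+y. ennreal (norm (v w (y + q k) - v w y)) \<partial>lborel) \<partial>M)) \<longlonglongrightarrow> 0"
      using ennreal_tendsto_cmult[OF _ J, of "ennreal (2 * C)"] by simp
  qed simp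
qed

text \<open>Averaged over the offset, the sampling error is controlled by the average of the mean
  translation error \<open>G\<close> over shifts up to the mesh size. Since \<open>G\<close> is
  small for small shifts, some offset must have a small error.\<close>

lemma simple_approx_bounded:
  assumes v: "(\<lambda>(w, s). v w s) \<in> borel_measurable (M \<Otimes>\<^sub>M lborel)"
    and adapted: "\<And>s. s \<in> {0..1} \<Longrightarrow> (\<lambda>w. v w s) \<in> borel_measurable (F s)"
    and out: "\<And>w s. s \<notin> {0..1} \<Longrightarrow> v w s = (0 :: real ^ 'n)"
    and bd: "\<And>w s. norm (v w s) \<le> C" and \<epsilon>: "\<epsilon> > 0"
  shows "\<exists>m t \<xi>. simple m t \<xi> \<and>
    (\<integral>\<^sup>+w. (\<integral>\<^sup>+s. ennreal ((norm (simple_process m t \<xi> w s - v w s))\<^sup>2) \<partial>lborel) \<partial>M) \<le> ennreal \<epsilon>"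
proof -
  define G where "G = (\<lambda>q. \<integral>\<^sup>+w. (\<integral>\<^sup>+y. ennreal ((norm (v w (y + q) - v w y))\<^sup>2) \<partial>lborel) \<partial>M)"
  note vm [measurable (raw)] = measurable_time_comp[OF v]
  have vw [measurable]: "v w \<in> borel_measurable borel" for w
    by measurable
  \<comment> \<open>Otherwise there would be shifts tending to zero along which \<open>G\<close>
    stays above \<open>\<epsilon> / 2\<close>.\<close>
  have "\<exists>N\<ge>1. \<forall>q\<in>{0<..1 / real N}. G q \<le> ennreal (\<epsilon> / 2)"
  proof (rule ccontr)
    assume "\<not> ?thesis"
    then have "\<forall>k. \<exists>q\<in>{0<..1 / real (Suc k)}. \<not> G q \<le> ennreal (\<epsilon> / 2)"
      by (metis One_nat_def Suc_le_mono le0)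
    then obtain q where q: "\<And>k. q k \<in> {0<..1 / real (Suc k)}" "\<And>k. \<not> G (q k) \<le> ennreal (\<epsilon> / 2)" by metis
    have "q \<longlonglongrightarrow> 0"
      by (rule tendsto_sandwich[OF _ _ tendsto_const LIMSEQ_Suc[OF lim_1_over_n]])
        (use q(1) in \<open>auto intro!: always_eventually less_imp_le\<close>)
    then have "(\<lambda>k. G (q k)) \<longlonglongrightarrow> 0"
      unfolding G_def by (intro translation_error_small[where v = v and C = C] v out bd)
    then have "\<forall>\<^sub>F k in sequentially. G (q k) < ennreal (\<epsilon> / 2)"
      using \<epsilon> by (intro order_tendstoD) auto
    then obtain k where "G (q k) < ennreal (\<epsilon> / 2)" by (auto simp: eventually_sequentially)
    then show False using q(2)[of k] less_imp_le by blast
  qed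
  then obtain N :: nat where N: "N \<ge> 1" and G: "\<And>q. q \<in> {0<..1 / real N} \<Longrightarrow> G q \<le> ennreal (\<epsilon> / 2)" by auto
  define h where "h = 1 / real N"
  have h: "0 < h" using N by (simp add: h_def)
  let ?D = "\<lambda>w y q. indicator {0<..h} q * ennreal ((norm (v w (y + q) - v w y))\<^sup>2)"
  define Err where "Err = (\<lambda>r. \<integral>\<^sup>+w. (\<Sum>j\<le>N. \<integral>\<^sup>+q. ?D w (r + (real j * h - h)) q \<partial>lborel) \<partial>M)"
  have "(\<integral>\<^sup>+r. indicator {0<..<h} r * Err r \<partial>lborel)
      = (\<integral>\<^sup>+r. (\<integral>\<^sup>+w. indicator {0<..<h} r * (\<Sum>j\<le>N. \<integral>\<^sup>+q. ?D w (r + (real j * h - h)) q \<partial>lborel) \<partial>M) \<partial>lborel)"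
    unfolding Err_def by (intro nn_integral_cong nn_integral_cmult[symmetric]) measurable
  also have "\<dots> = (\<integral>\<^sup>+w. (\<integral>\<^sup>+r. indicator {0<..<h} r * (\<Sum>j\<le>N. \<integral>\<^sup>+q. ?D w (r + (real j * h - h)) q \<partial>lborel) \<partial>lborel) \<partial>M)"
    by (rule Fubini') measurable
  \<comment> \<open>Letting the offset run through one cell and summing over all cells covers the
    time line at most once.\<close>
  also have "\<dots> \<le> (\<integral>\<^sup>+w. (\<integral>\<^sup>+y. (\<integral>\<^sup>+q. ?D w y q \<partial>lborel) \<partial>lborel) \<partial>M)"
    by (intro nn_integral_mono nn_integral_tiling_le h) measurable
  also have "\<dots> = (\<integral>\<^sup>+w. (\<integral>\<^sup>+q. (\<integral>\<^sup>+y. ?D w y q \<partial>lborel) \<partial>lborel) \<partial>M)"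
    by (intro nn_integral_cong lborel_pair.Fubini') measurable
  also have "\<dots> = (\<integral>\<^sup>+q. (\<integral>\<^sup>+w. (\<integral>\<^sup>+y. ?D w y q \<partial>lborel) \<partial>M) \<partial>lborel)"
    by (rule Fubini'[symmetric]) measurable
  also have "\<dots> = (\<integral>\<^sup>+q. indicator {0<..h} q * G q \<partial>lborel)"
    unfolding G_def by (simp add: nn_integral_cmult)
  also have "\<dots> \<le> (\<integral>\<^sup>+q. ennreal (\<epsilon> / 2) * indicator {0<..h} q \<partial>lborel)"
    using G by (intro nn_integral_mono) (auto simp: indicator_def h_def)
  also have "\<dots> = ennreal (\<epsilon> / 2 * h)"
    using h \<epsilon> by (simp add: nn_integral_cmult ennreal_mult[symmetric])
  finally have le: "(\<integral>\<^sup>+r. indicator {0<..<h} r * Err r \<partial>lborel) \<le> ennreal (\<epsilon> / 2 * h)" .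
  \<comment> \<open>If every offset had an error above \<open>\<epsilon>\<close>, the integral over
    the offsets would be at least \<open>\<epsilon> * h\<close>, twice the bound just shown.\<close>
  have "\<exists>r. 0 < r \<and> r < h \<and> Err r \<le> ennreal \<epsilon>"
  proof (rule ccontr)
    assume "\<not> ?thesis"
    then have "ennreal \<epsilon> * indicator {0<..<h} r \<le> indicator {0<..<h} r * Err r" for r
      by (auto simp: indicator_def not_le less_imp_le)
    then have "(\<integral>\<^sup>+r. ennreal \<epsilon> * indicator {0<..<h} r \<partial>lborel) \<le> (\<integral>\<^sup>+r. indicator {0<..<h} r * Err r \<partial>lborel)"
      by (rule nn_integral_mono)
    then have "(\<integral>\<^sup>+r. ennreal \<epsilon> * indicator {0<..<h} r \<partial>lborel) \<le> ennreal (\<epsilon> / 2 * h)"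
      using le by (rule order_trans)
    then have "ennreal (\<epsilon> * h) \<le> ennreal (\<epsilon> / 2 * h)"
      using h \<epsilon> by (simp add: nn_integral_cmult ennreal_mult[symmetric])
    then show False using h \<epsilon> by (simp add: ennreal_le_iff)
  qed
  then obtain r where r: "0 < r" "r < h" "Err r \<le> ennreal \<epsilon>" by blast
  obtain t where t: "simple N t (\<lambda>i w. v w (t i))"
    "\<And>w. (\<integral>\<^sup>+s. ennreal ((norm (simple_process N t (\<lambda>i w. v w (t i)) w s - v w s))\<^sup>2) \<partial>lborel)
      \<le> (\<Sum>j\<le>N. \<integral>\<^sup>+q. ?D w (r + (real j * h - h)) q \<partial>lborel)"
    using shift_grid[OF adapted out bd N h_def r(1,2) vw] by blast
  have "(\<integral>\<^sup>+w. (\<integral>\<^sup>+s. ennreal ((norm (simple_process N t (\<lambda>i w. v w (t i)) w s - v w s))\<^sup>2) \<partial>lborel) \<partial>M) \<le> Err r"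
    unfolding Err_def by (intro nn_integral_mono t(2))
  then show ?thesis using t(1) r(3) by (meson order_trans)
qed

end

section \<open>Almost sure statements in complete probability spaces\<close>

lemma (in complete_measure) measurable_cong_AE:
  assumes f: "f \<in> M \<rightarrow>\<^sub>M N" and eq: "AE x in M. f x = g x" and g: "g \<in> space M \<rightarrow> space N"
  shows "g \<in> M \<rightarrow>\<^sub>M N"
proof (rule measurableI)
  fix A assume A: "A \<in> sets N"
  obtain Z where Z: "{x \<in> space M. f x \<noteq> g x} \<subseteq> Z" "Z \<in> null_sets M"
    using eq by (auto elim!: AE_E2 simp: eventually_ae_filter)
  have fA: "f -` A \<inter> space M \<in> sets M" using measurable_sets[OF f A] .
  have "g -` A \<inter> space M \<inter> Z \<in> sets M" by (rule complete[OF _ Z(2)]) auto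
  moreover have "(f -` A \<inter> space M - Z) \<union> (g -` A \<inter> space M \<inter> Z) = g -` A \<inter> space M"
    using Z(1) by auto
  moreover have "f -` A \<inter> space M - Z \<in> sets M" using fA Z(2) by auto
  ultimately show "g -` A \<inter> space M \<in> sets M" by (metis sets.Un)
qed (use g in auto)

lemma (in prob_space) prob_tendsto_zero:
  assumes A: "\<And>k. A k \<in> events" and ev: "AE w in M. \<forall>\<^sub>F k in sequentially. w \<notin> A k"
  shows "(\<lambda>k. prob (A k)) \<longlonglongrightarrow> 0"
proof -
  have "(\<lambda>k. \<integral>w. indicator (A k) w \<partial>M) \<longlonglongrightarrow> (\<integral>w. (0::real) \<partial>M)"
  proof (rule integral_dominated_convergence[where w = "\<lambda>_. 1"])
    show "AE w in M. (\<lambda>k. indicator (A k) w) \<longlonglongrightarrow> (0::real)"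
      using ev by eventually_elim (auto intro!: tendsto_eventually elim!: eventually_mono simp: indicator_def)
    show "AE w in M. norm (indicator (A k) w :: real) \<le> 1" for k by (simp add: indicator_def)
  qed (use A in auto)
  then show ?thesis using A by simp
qed

text \<open>The sum has finite expectation, so it is finite almost surely, and the terms of a
  convergent series tend to zero.\<close>

lemma AE_tendsto_zero_of_summable:
  fixes f :: "nat \<Rightarrow> 'a \<Rightarrow> ennreal"
  assumes [measurable]: "\<And>k. f k \<in> borel_measurable M"
    and le: "\<And>k. (\<integral>\<^sup>+w. f k w \<partial>M) \<le> ennreal (c k)" and c: "summable c" "\<And>k. 0 \<le> c k"
  shows "AE w in M. (\<Sum>k. f k w) \<noteq> \<infinity>" "AE w in M. (\<lambda>k. f k w) \<longlonglongrightarrow> 0"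
proof -
  have "(\<integral>\<^sup>+w. (\<Sum>k. f k w) \<partial>M) = (\<Sum>k. \<integral>\<^sup>+w. f k w \<partial>M)" by (rule nn_integral_suminf) simp
  also have "\<dots> \<le> (\<Sum>k. ennreal (c k))" by (intro suminf_le le) auto
  also have "\<dots> < \<infinity>" using suminf_ennreal2[OF c(2,1)] by simp
  finally show fin: "AE w in M. (\<Sum>k. f k w) \<noteq> \<infinity>"
    by (intro nn_integral_noteq_infinite) auto
  show "AE w in M. (\<lambda>k. f k w) \<longlonglongrightarrow> 0"
    using fin
  proof eventually_elim
    case (elim w)
    have top: "f k w \<noteq> \<infinity>" for k
    proof
      assume "f k w = \<infinity>"
      then have "\<infinity> \<le> (\<Sum>k. f k w)" using sum_le_suminf[of "\<lambda>k. f k w" "{k}"] by simp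
      then show False using elim by (simp add: top.extremum_unique)
    qed
    define g where "g = (\<lambda>k. enn2real (f k w))"
    have fg: "f k w = ennreal (g k)" for k using top[of k] by (simp add: g_def less_top)
    have "summable g" using elim unfolding fg by (intro summable_suminf_not_top) (auto simp: g_def)
    then have "(\<lambda>k. ennreal (g k)) \<longlonglongrightarrow> ennreal 0" by (intro tendsto_ennrealI summable_LIMSEQ_zero)
    then show ?case unfolding fg by simp
  qed
qed

section \<open>Cameron--Martin densities\<close>

lemma set_integrable_of_square:
  fixes g :: "real \<Rightarrow> real ^ 'n"
  assumes "g \<in> borel_measurable lborel" "set_integrable lborel {0..1} (\<lambda>s. (norm (g s))\<^sup>2)"
  shows "set_integrable lborel {0..1} g"
  unfolding set_integrable_def
proof (rule Bochner_Integration.integrable_bound)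
  show "integrable lborel (\<lambda>s. indicator {0..1::real} s + indicator {0..1} s * (norm (g s))\<^sup>2)"
    using assms(2) by (intro Bochner_Integration.integrable_add integrable_real_indicator) (auto simp: set_integrable_def)
  have "norm (g s) \<le> 1 + (norm (g s))\<^sup>2" for s
    using zero_le_power2[of "norm (g s) - 1"] norm_ge_zero[of "g s"] unfolding power2_diff power_one by linarith
  then show "AE s in lborel. norm (indicat_real {0..1} s *\<^sub>R g s) \<le> norm (indicator {0..1::real} s + indicator {0..1} s * (norm (g s))\<^sup>2)"
    by (auto simp: indicator_def)
qed (use assms(1) in measurable)

text \<open>The difference of the densities integrates to zero over half-lines, hence over every
  Borel set by a Dynkin argument. Cutting it off outside the unit interval is what extends the
  hypothesis from the intervals \<open>{0..t}\<close> to all half-lines.\<close>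

lemma is_cm_density_unique:
  fixes g g' :: "real \<Rightarrow> real ^ ('n::finite)"
  assumes g: "is_cm_density h g" and g': "is_cm_density h g'"
  shows "AE s in lborel. s \<in> {0..1} \<longrightarrow> g s = g' s"
proof -
  define d where "d = (\<lambda>s. indicator {0..1} s *\<^sub>R (g s - g' s))"
  have gi: "set_integrable lborel {0..1} g" "set_integrable lborel {0..1} g'"
    using g g' by (auto intro: set_integrable_of_square simp: is_cm_density_def)
  have d: "integrable lborel d"
    using set_integral_diff(1)[OF gi] by (simp add: d_def set_integrable_def)
  have di: "set_integrable lborel A d" if "A \<in> sets borel" for A
    using integrable_mult_indicator[OF _ d, of A] that by (simp add: set_integrable_def)
  have zero: "(LINT s:{0..t}|lborel. d s) = 0" if "t \<in> {0..1}" for t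
  proof -
    have gt: "set_integrable lborel {0..t} g" "set_integrable lborel {0..t} g'"
      using gi that by (auto intro: set_integrable_subset)
    have "(LINT s:{0..t}|lborel. d s) = (LINT s:{0..t}|lborel. g s - g' s)"
      using that unfolding set_lebesgue_integral_def d_def
      by (intro Bochner_Integration.integral_cong) (auto simp: indicator_def)
    also have "\<dots> = 0" using g g' that by (simp add: set_integral_diff(2)[OF gt] is_cm_density_def)
    finally show ?thesis .
  qed
  have Iic: "(LINT s:{..t}|lborel. d s) = 0" for t
  proof -
    have "(LINT s:{..t}|lborel. d s) = (LINT s:{0..min t 1}|lborel. d s)"
      unfolding set_lebesgue_integral_def d_def
      by (intro Bochner_Integration.integral_cong) (auto simp: indicator_def)
    then show ?thesis
      using zero[of "min t 1"] by (cases "0 \<le> t") (auto simp: min_def set_lebesgue_integral_def split: if_splits)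
  qed
  have all: "(LINT s|lborel. d s) = 0"
  proof -
    have "(LINT s|lborel. d s) = (LINT s:{0..1}|lborel. d s)"
      unfolding set_lebesgue_integral_def d_def
      by (intro Bochner_Integration.integral_cong) (auto simp: indicator_def)
    then show ?thesis using zero[of 1] by simp
  qed
  have "(LINT s:A|lborel. d s) = 0" if "A \<in> sets borel" for A
  proof -
    have A: "A \<in> sigma_sets UNIV (range (atMost :: real \<Rightarrow> real set))"
      using that by (subst (asm) borel_eq_atMost) simp
    show ?thesis
    proof (rule sigma_sets_induct_disjoint[OF _ _ A])
      show "Int_stable (range (atMost :: real \<Rightarrow> real set))" by (auto simp: Int_stable_def)
    next
      fix A assume "A \<in> range (atMost :: real \<Rightarrow> real set)"
      then show "(LINT s:A|lborel. d s) = 0" using Iic by auto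
    next
      fix A assume A: "A \<in> sigma_sets UNIV (range (atMost :: real \<Rightarrow> real set))" "(LINT s:A|lborel. d s) = 0"
      have Ab: "A \<in> sets borel" using A(1) by (subst borel_eq_atMost) simp
      have "(LINT s:A \<union> (UNIV - A)|lborel. d s) = (LINT s:A|lborel. d s) + (LINT s:UNIV - A|lborel. d s)"
        using Ab by (intro set_integral_Un di) auto
      then show "(LINT s:UNIV - A|lborel. d s) = 0"
        using A(2) all by (simp add: set_lebesgue_integral_def)
    next
      fix A :: "nat \<Rightarrow> real set"
      assume A: "disjoint_family A" "range A \<subseteq> sigma_sets UNIV (range (atMost :: real \<Rightarrow> real set))"
        "\<And>i. (LINT s:A i|lborel. d s) = 0"
      have Ab: "A i \<in> sets borel" for i using A(2) by (subst borel_eq_atMost) auto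
      have "(LINT s:(\<Union>i. A i)|lborel. d s) = (\<Sum>i. (LINT s:A i|lborel. d s))"
        using A(1) Ab by (intro lebesgue_integral_countable_add di) (auto simp: disjoint_family_on_def)
      then show "(LINT s:(\<Union>i. A i)|lborel. d s) = 0" using A(3) by simp
    qed (auto simp: set_lebesgue_integral_def)
  qed
  then have "AE s in lborel. d s = 0" by (intro sigma_finite_measure.density_zero[OF lborel.sigma_finite_measure_axioms d]) auto
  then show ?thesis by eventually_elim (auto simp: d_def)
qed

lemma cm_density_is_density: "h \<in> cameron_martin \<Longrightarrow> is_cm_density h (cm_density h)"
  unfolding cameron_martin_def cm_density_def mem_Collect_eq by (rule someI_ex[of "is_cm_density h"])

text \<open>Densities agree almost everywhere, so the choice in \<open>cm_density\<close> does not
  affect the norm and any density may be used to compute it.\<close>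

lemma cm_norm_sq:
  assumes "is_cm_density h g"
  shows "(\<integral>\<^sup>+s. ennreal ((norm (indicator {0..1} s *\<^sub>R g s))\<^sup>2) \<partial>lborel) = ennreal ((cm_norm h)\<^sup>2)"
proof -
  have h: "h \<in> cameron_martin" using assms by (auto simp: cameron_martin_def)
  note c = cm_density_is_density[OF h]
  have meas: "(\<lambda>s. indicator {0..1} s *\<^sub>R (norm (g s))\<^sup>2) \<in> borel_measurable lborel"
    "(\<lambda>s. indicator {0..1} s *\<^sub>R (norm (cm_density h s))\<^sup>2) \<in> borel_measurable lborel"
    using assms c by (auto simp: is_cm_density_def)
  have "(LINT s:{0..1}|lborel. (norm (cm_density h s))\<^sup>2) = (LINT s:{0..1}|lborel. (norm (g s))\<^sup>2)"
    unfolding set_lebesgue_integral_def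
    by (intro integral_cong_AE meas) (use is_cm_density_unique[OF c assms] in \<open>auto elim!: eventually_mono simp: indicator_def\<close>)
  moreover have "0 \<le> (LINT s:{0..1}|lborel. (norm (g s))\<^sup>2)"
    unfolding set_lebesgue_integral_def by (intro Bochner_Integration.integral_nonneg) auto
  ultimately have "(cm_norm h)\<^sup>2 = (LINT s:{0..1}|lborel. (norm (g s))\<^sup>2)" by (simp add: cm_norm_def)
  moreover have "(\<integral>\<^sup>+s. ennreal ((norm (indicator {0..1} s *\<^sub>R g s))\<^sup>2) \<partial>lborel)
      = (\<integral>\<^sup>+s. ennreal (indicator {0..1} s *\<^sub>R (norm (g s))\<^sup>2) \<partial>lborel)"
    by (intro nn_integral_cong) (auto simp: indicator_def)
  moreover have "\<dots> = ennreal (LINT s:{0..1}|lborel. (norm (g s))\<^sup>2)"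
    unfolding set_lebesgue_integral_def using assms
    by (intro nn_integral_eq_integral) (auto simp: is_cm_density_def set_integrable_def)
  ultimately show ?thesis by simp
qed

lemma cm_norm_nonneg: "0 \<le> cm_norm h"
  unfolding cm_norm_def by (auto simp: set_lebesgue_integral_def intro!: Bochner_Integration.integral_nonneg)

text \<open>The version is made to vanish outside the unit interval, so that time integrals run over
  the whole line, where translations act.\<close>

definition (in path_brownian) L2_density :: "('n path \<Rightarrow> 'n path) \<Rightarrow> ('n path \<Rightarrow> real \<Rightarrow> real ^ 'n) \<Rightarrow> bool" where
  "L2_density u v \<longleftrightarrow>
     (\<lambda>(w, s). v w s) \<in> borel_measurable (M \<Otimes>\<^sub>M lborel) \<and>
     (\<forall>s\<in>{0..1}. (\<lambda>w. v w s) \<in> borel_measurable (F s)) \<and>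
     (\<forall>w s. s \<notin> {0..1} \<longrightarrow> v w s = 0) \<and>
     (AE w in M. is_cm_density (u w) (v w)) \<and>
     (\<integral>\<^sup>+w. (\<integral>\<^sup>+s. ennreal ((norm (v w s))\<^sup>2) \<partial>lborel) \<partial>M) < \<infinity>"

context path_brownian
begin

lemma Lpa2_integrable: "u \<in> Lpa 2 \<nu> \<Longrightarrow> integrable M (\<lambda>w. (cm_norm (u w))\<^sup>2)"
  by (simp add: Lpa_def cm_norm_nonneg powr_numeral[OF cm_norm_nonneg])

lemma L2_density_cm_norm:
  assumes "L2_density u v"
  shows "AE w in M. (\<integral>\<^sup>+s. ennreal ((norm (v w s))\<^sup>2) \<partial>lborel) = ennreal ((cm_norm (u w))\<^sup>2)"
proof -
  have "indicator {0..1} s *\<^sub>R v w s = v w s" for w s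
    using assms by (auto simp: L2_density_def indicator_def)
  moreover have "AE w in M. is_cm_density (u w) (v w)" using assms by (simp add: L2_density_def)
  ultimately show ?thesis by (auto elim!: eventually_mono dest!: cm_norm_sq)
qed

lemma Lpa2_density:
  assumes u: "u \<in> Lpa 2 \<nu>"
  obtains v where "L2_density u v"
proof -
  obtain v0 where v0: "adapted_density \<nu> u v0" using u by (auto simp: Lpa_def)
  define v where "v = (\<lambda>w s. indicator {0..1} s *\<^sub>R v0 w s)"
  have 0: "(\<lambda>(w, s). v0 w s) \<in> borel_measurable (M \<Otimes>\<^sub>M lborel)" using v0 by (simp add: adapted_density_def)
  have 1: "(\<lambda>(w, s). v w s) \<in> borel_measurable (M \<Otimes>\<^sub>M lborel)"
    unfolding v_def using 0 by (simp add: case_prod_beta)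
  have 2: "\<forall>s\<in>{0..1}. (\<lambda>w. v w s) \<in> borel_measurable (F s)"
    using v0 by (auto simp: adapted_density_def v_def)
  have cm: "is_cm_density h (\<lambda>s. indicator {0..1} s *\<^sub>R g s)" if "is_cm_density h g" for h and g :: "real \<Rightarrow> real ^ 'n"
  proof -
    have "set_integrable lborel {0..1} (\<lambda>s. (norm (indicat_real {0..1} s *\<^sub>R g s))\<^sup>2) = set_integrable lborel {0..1} (\<lambda>s. (norm (g s))\<^sup>2)"
      unfolding set_integrable_def by (intro Bochner_Integration.integrable_cong) (auto simp: indicator_def)
    moreover have "(LINT s:{0..t}|lborel. indicator {0..1} s *\<^sub>R g s) = (LINT s:{0..t}|lborel. g s)" if "t \<in> {0..1}" for t
      using that unfolding set_lebesgue_integral_def by (intro Bochner_Integration.integral_cong) (auto simp: indicator_def)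
    moreover have "(\<lambda>s. indicator {0..1} s *\<^sub>R g s) \<in> borel_measurable lborel"
      using that by (intro borel_measurable_scaleR) (auto simp: is_cm_density_def)
    ultimately show ?thesis using that by (simp add: is_cm_density_def)
  qed
  have "AE w in \<nu>. is_cm_density (u w) (v0 w)" using v0 by (simp add: adapted_density_def)
  then have 3: "AE w in M. is_cm_density (u w) (v w)"
    unfolding AE_completion_iff v_def by eventually_elim (rule cm)
  then have "AE w in M. (\<integral>\<^sup>+s. ennreal ((norm (v w s))\<^sup>2) \<partial>lborel) = ennreal ((cm_norm (u w))\<^sup>2)"
  proof eventually_elim
    case (elim w)
    have "indicator {0..1} s *\<^sub>R v w s = v w s" for s by (simp add: v_def indicator_def)
    then show ?case using cm_norm_sq[OF elim] by simp
  qed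
  then have "(\<integral>\<^sup>+w. (\<integral>\<^sup>+s. ennreal ((norm (v w s))\<^sup>2) \<partial>lborel) \<partial>M) = (\<integral>\<^sup>+w. ennreal ((cm_norm (u w))\<^sup>2) \<partial>M)"
    by (rule nn_integral_cong_AE)
  also have "\<dots> < \<infinity>" using Lpa2_integrable[OF u] by (simp add: nn_integral_eq_integral)
  finally have "L2_density u v" unfolding L2_density_def using 1 2 3 by (simp add: v_def)
  then show ?thesis using that by blast
qed

end

section \<open>The stochastic integral\<close>

text \<open>The parallelogram identity with one square dropped.\<close>

lemma norm_diff_sq_le:
  fixes a b c :: "'a::real_inner"
  shows "(norm (a - c))\<^sup>2 \<le> 2 * (norm (a - b))\<^sup>2 + 2 * (norm (b - c))\<^sup>2"
proof -
  have "(norm (a - c))\<^sup>2 + (norm ((a - b) - (b - c)))\<^sup>2 = 2 * (norm (a - b))\<^sup>2 + 2 * (norm (b - c))\<^sup>2"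
    unfolding power2_norm_eq_inner by (simp add: inner_diff_left inner_diff_right inner_commute algebra_simps)
  then show ?thesis using zero_le_power2[of "norm ((a - b) - (b - c))"] by linarith
qed

lemma ennreal_norm_diff_sq_le:
  fixes a b c :: "'a::real_inner"
  shows "ennreal ((norm (a - c))\<^sup>2) \<le> 2 * ennreal ((norm (a - b))\<^sup>2) + 2 * ennreal ((norm (b - c))\<^sup>2)"
proof -
  have "ennreal ((norm (a - c))\<^sup>2) \<le> ennreal (2 * (norm (a - b))\<^sup>2 + 2 * (norm (b - c))\<^sup>2)"
    by (intro ennreal_leI norm_diff_sq_le)
  also have "\<dots> = 2 * ennreal ((norm (a - b))\<^sup>2) + 2 * ennreal ((norm (b - c))\<^sup>2)"
    by (simp add: ennreal_plus ennreal_mult')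
  finally show ?thesis .
qed

context path_brownian
begin

abbreviation sq_dist :: "('n path \<Rightarrow> real \<Rightarrow> real ^ 'n) \<Rightarrow> ('n path \<Rightarrow> real \<Rightarrow> real ^ 'n) \<Rightarrow> 'n path \<Rightarrow> ennreal" where
  "sq_dist x y w \<equiv> (\<integral>\<^sup>+s. ennreal ((norm (x w s - y w s))\<^sup>2) \<partial>lborel)"

lemma simple_process_measurable:
  assumes "simple m t \<xi>"
  shows "(\<lambda>(w, s). simple_process m t \<xi> w s) \<in> borel_measurable (M \<Otimes>\<^sub>M lborel)"
proof -
  have [measurable]: "\<xi> i \<in> borel_measurable M" if "i < m" for i using simple_measurable_M[OF assms that] .
  have "(\<lambda>p. \<Sum>i<m. indicator {t i<..t (Suc i)} (snd p) *\<^sub>R \<xi> i (fst p)) \<in> borel_measurable (M \<Otimes>\<^sub>M lborel)"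
  proof (rule borel_measurable_sum)
    fix i assume i: "i \<in> {..<m}"
    then have [measurable]: "\<xi> i \<in> borel_measurable M" using simple_measurable_M[OF assms] by simp
    show "(\<lambda>p. indicator {t i<..t (Suc i)} (snd p) *\<^sub>R \<xi> i (fst p)) \<in> borel_measurable (M \<Otimes>\<^sub>M lborel)"
      by measurable
  qed
  then show ?thesis by (simp add: simple_process_def case_prod_beta)
qed

lemma sq_dist_measurable:
  assumes "(\<lambda>(w, s). x w s) \<in> borel_measurable (M \<Otimes>\<^sub>M lborel)" "(\<lambda>(w, s). y w s) \<in> borel_measurable (M \<Otimes>\<^sub>M lborel)"
  shows "sq_dist x y \<in> borel_measurable M"
proof -
  note [measurable (raw)] = measurable_time_comp[OF assms(1)] measurable_time_comp[OF assms(2)]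
  show ?thesis by measurable
qed

lemma sq_dist_triangle:
  assumes "(\<lambda>(w, s). x w s) \<in> borel_measurable (M \<Otimes>\<^sub>M lborel)" "(\<lambda>(w, s). y w s) \<in> borel_measurable (M \<Otimes>\<^sub>M lborel)"
    "(\<lambda>(w, s). z w s) \<in> borel_measurable (M \<Otimes>\<^sub>M lborel)"
  shows "sq_dist x z w \<le> 2 * sq_dist x y w + 2 * sq_dist y z w"
proof -
  note [measurable (raw)] = measurable_time_comp[OF assms(1)] measurable_time_comp[OF assms(2)] measurable_time_comp[OF assms(3)]
  have "sq_dist x z w \<le> (\<integral>\<^sup>+s. 2 * ennreal ((norm (x w s - y w s))\<^sup>2) + 2 * ennreal ((norm (y w s - z w s))\<^sup>2) \<partial>lborel)"
    by (intro nn_integral_mono ennreal_norm_diff_sq_le)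
  also have "\<dots> = 2 * sq_dist x y w + 2 * sq_dist y z w"
    by (subst nn_integral_add) (simp_all add: nn_integral_cmult)
  finally show ?thesis .
qed

lemma simple_approx:
  assumes d: "L2_density u v" and \<epsilon>: "\<epsilon> > 0"
  shows "\<exists>m t \<xi>. simple m t \<xi> \<and> (\<integral>\<^sup>+w. sq_dist (simple_process m t \<xi>) v w \<partial>M) \<le> ennreal \<epsilon>"
proof -
  have v: "(\<lambda>(w, s). v w s) \<in> borel_measurable (M \<Otimes>\<^sub>M lborel)"
    and ad: "\<And>s. s \<in> {0..1} \<Longrightarrow> (\<lambda>w. v w s) \<in> borel_measurable (F s)"
    and out: "\<And>w s. s \<notin> {0..1} \<Longrightarrow> v w s = 0"
    and fin: "(\<integral>\<^sup>+w. (\<integral>\<^sup>+s. ennreal ((norm (v w s))\<^sup>2) \<partial>lborel) \<partial>M) < \<infinity>"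
    using d by (auto simp: L2_density_def)
  note vm [measurable (raw)] = measurable_time_comp[OF v]
  \<comment> \<open>Large values are replaced by zero: this keeps adaptedness, and the squared norm
    of \<open>v\<close> dominates the squared error.\<close>
  define vk where "vk = (\<lambda>(k::nat) w s. if norm (v w s) \<le> real k then v w s else 0)"
  have vk: "(\<lambda>(w, s). vk k w s) \<in> borel_measurable (M \<Otimes>\<^sub>M lborel)" for k
    unfolding vk_def case_prod_beta by measurable
  note [measurable (raw)] = measurable_time_comp[OF vk]
  have "(\<lambda>k. \<integral>\<^sup>+p. ennreal ((norm (vk k (fst p) (snd p) - v (fst p) (snd p)))\<^sup>2) \<partial>(M \<Otimes>\<^sub>M lborel))
      \<longlonglongrightarrow> (\<integral>\<^sup>+(p::'n path \<times> real). 0 \<partial>(M \<Otimes>\<^sub>M lborel))"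
  proof (rule nn_integral_dominated_convergence[where w = "\<lambda>p. ennreal ((norm (v (fst p) (snd p)))\<^sup>2)"])
    show "(\<integral>\<^sup>+p. ennreal ((norm (v (fst p) (snd p)))\<^sup>2) \<partial>(M \<Otimes>\<^sub>M lborel)) < \<infinity>"
      using fin by (subst M2.nn_integral_fst[symmetric]) auto
    show "AE p in M \<Otimes>\<^sub>M lborel. ennreal ((norm (vk k (fst p) (snd p) - v (fst p) (snd p)))\<^sup>2) \<le> ennreal ((norm (v (fst p) (snd p)))\<^sup>2)" for k
      by (auto simp: vk_def)
    show "AE p in M \<Otimes>\<^sub>M lborel. (\<lambda>k. ennreal ((norm (vk k (fst p) (snd p) - v (fst p) (snd p)))\<^sup>2)) \<longlonglongrightarrow> 0"
    proof (intro AE_I2 tendsto_eventually)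
      fix p
      obtain K :: nat where K: "norm (v (fst p) (snd p)) \<le> real K" using real_arch_simple by blast
      have "ennreal ((norm (vk k (fst p) (snd p) - v (fst p) (snd p)))\<^sup>2) = 0" if "k \<ge> K" for k
      proof -
        have "norm (v (fst p) (snd p)) \<le> real k" using K that by (meson of_nat_le_iff order_trans)
        then show ?thesis by (simp add: vk_def)
      qed
      then show "\<forall>\<^sub>F k in sequentially. ennreal ((norm (vk k (fst p) (snd p) - v (fst p) (snd p)))\<^sup>2) = 0"
        by (auto simp: eventually_sequentially)
    qed
  qed measurable
  \<comment> \<open>Truncation and sampling each get \<open>\<epsilon> / 4\<close>, since the
    squared triangle inequality doubles both.\<close>
  then have "\<forall>\<^sub>F k in sequentially. (\<integral>\<^sup>+p. ennreal ((norm (vk k (fst p) (snd p) - v (fst p) (snd p)))\<^sup>2) \<partial>(M \<Otimes>\<^sub>M lborel)) < ennreal (\<epsilon> / 4)"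
    using \<epsilon> by (intro order_tendstoD) auto
  then obtain k where "(\<integral>\<^sup>+p. ennreal ((norm (vk k (fst p) (snd p) - v (fst p) (snd p)))\<^sup>2) \<partial>(M \<Otimes>\<^sub>M lborel)) < ennreal (\<epsilon> / 4)"
    by (auto simp: eventually_sequentially)
  then have k: "(\<integral>\<^sup>+w. sq_dist (vk k) v w \<partial>M) \<le> ennreal (\<epsilon> / 4)"
    by (subst (asm) M2.nn_integral_fst[symmetric]) (auto intro: less_imp_le)
  have "\<exists>m t \<xi>. simple m t \<xi> \<and> (\<integral>\<^sup>+w. (\<integral>\<^sup>+s. ennreal ((norm (simple_process m t \<xi> w s - vk k w s))\<^sup>2) \<partial>lborel) \<partial>M) \<le> ennreal (\<epsilon> / 4)"
  proof (rule simple_approx_bounded)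
    show "(\<lambda>w. vk k w s) \<in> borel_measurable (F s)" if "s \<in> {0..1}" for s
      unfolding vk_def using ad[OF that] by measurable
    show "norm (vk k w s) \<le> real k" for w s by (simp add: vk_def)
  qed (use vk out \<epsilon> in \<open>auto simp: vk_def\<close>)
  then obtain m t \<xi> where s: "simple m t \<xi>" and se: "(\<integral>\<^sup>+w. sq_dist (simple_process m t \<xi>) (vk k) w \<partial>M) \<le> ennreal (\<epsilon> / 4)"
    by blast
  note sp = simple_process_measurable[OF s]
  have "(\<integral>\<^sup>+w. sq_dist (simple_process m t \<xi>) v w \<partial>M) \<le> (\<integral>\<^sup>+w. 2 * sq_dist (simple_process m t \<xi>) (vk k) w + 2 * sq_dist (vk k) v w \<partial>M)"
    by (intro nn_integral_mono sq_dist_triangle sp vk v)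
  also have "\<dots> = 2 * (\<integral>\<^sup>+w. sq_dist (simple_process m t \<xi>) (vk k) w \<partial>M) + 2 * (\<integral>\<^sup>+w. sq_dist (vk k) v w \<partial>M)"
    using sq_dist_measurable[OF sp vk] sq_dist_measurable[OF vk v] by (subst nn_integral_add) (simp_all add: nn_integral_cmult)
  also have "\<dots> \<le> 2 * ennreal (\<epsilon> / 4) + 2 * ennreal (\<epsilon> / 4)"
    by (intro add_mono mult_left_mono se k) auto
  also have "\<dots> = ennreal \<epsilon>"
  proof -
    have "2 * ennreal (\<epsilon> / 4) = ennreal (\<epsilon> / 2)" using \<epsilon> by (simp add: ennreal_numeral[symmetric] ennreal_mult[symmetric] del: ennreal_numeral)
    then show ?thesis using \<epsilon> by (simp add: ennreal_plus[symmetric] del: ennreal_plus)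
  qed
  finally show ?thesis using s by blast
qed

text \<open>On a common grid the difference is itself a simple integral, so the isometry bound
  applies to it; \<open>4 * a\<close> arises from the squared triangle inequality through
  \<open>v\<close>.\<close>

lemma simple_integral_diff_moment:
  fixes a :: real
  assumes v: "(\<lambda>(w, s). v w s) \<in> borel_measurable (M \<Otimes>\<^sub>M lborel)"
    and s: "simple m t \<xi>" and s': "simple m' t' \<xi>'" and pos: "0 \<le> a"
    and le: "(\<integral>\<^sup>+w. sq_dist (simple_process m t \<xi>) v w \<partial>M) \<le> ennreal a"
    and le': "(\<integral>\<^sup>+w. sq_dist (simple_process m' t' \<xi>') v w \<partial>M) \<le> ennreal a"
  shows "integrable M (\<lambda>w. (sint m t \<xi> w - sint m' t' \<xi>' w)\<^sup>2)"
    "expectation (\<lambda>w. (sint m t \<xi> w - sint m' t' \<xi>' w)\<^sup>2) \<le> CARD('n) * (4 * a)"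
proof -
  obtain k T \<zeta> where z: "simple k T \<zeta>"
    "\<And>w s. simple_process k T \<zeta> w s = simple_process m t \<xi> w s - simple_process m' t' \<xi>' w s"
    "\<And>w. sint k T \<zeta> w = sint m t \<xi> w - sint m' t' \<xi>' w"
    using simple_integrand_diff[OF s s', where \<beta> = \<beta>] by blast
  note sp = simple_process_measurable[OF s] and sp' = simple_process_measurable[OF s']
  have comm: "sq_dist x y w = sq_dist y x w" for x y w by (simp add: norm_minus_commute)
  have "ennreal (expectation (simple_energy k T \<zeta>)) = (\<integral>\<^sup>+w. ennreal (simple_energy k T \<zeta> w) \<partial>M)"
    using simple_energy_nonneg[OF z(1)] by (intro nn_integral_eq_integral[symmetric] simple_energy_integrable[OF z(1)]) auto
  also have "\<dots> = (\<integral>\<^sup>+w. sq_dist (simple_process m t \<xi>) (simple_process m' t' \<xi>') w \<partial>M)"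
    by (simp add: nn_integral_simple_process_sq[OF z(1), symmetric] z(2))
  also have "\<dots> \<le> (\<integral>\<^sup>+w. 2 * sq_dist (simple_process m t \<xi>) v w + 2 * sq_dist v (simple_process m' t' \<xi>') w \<partial>M)"
    by (intro nn_integral_mono sq_dist_triangle sp sp' v)
  also have "\<dots> = 2 * (\<integral>\<^sup>+w. sq_dist (simple_process m t \<xi>) v w \<partial>M) + 2 * (\<integral>\<^sup>+w. sq_dist v (simple_process m' t' \<xi>') w \<partial>M)"
    using sq_dist_measurable[OF sp v] sq_dist_measurable[OF v sp'] by (subst nn_integral_add) (simp_all add: nn_integral_cmult)
  also have "\<dots> \<le> 2 * ennreal a + 2 * ennreal a"
    using le le' unfolding comm[of v] by (intro add_mono mult_left_mono) auto
  also have "\<dots> = ennreal (4 * a)"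
    using pos by (simp add: ennreal_numeral[symmetric] ennreal_mult[symmetric] ennreal_plus[symmetric] del: ennreal_numeral ennreal_plus)
  finally have "expectation (simple_energy k T \<zeta>) \<le> 4 * a" using pos by (simp add: ennreal_le_iff)
  then show "integrable M (\<lambda>w. (sint m t \<xi> w - sint m' t' \<xi>' w)\<^sup>2)"
    "expectation (\<lambda>w. (sint m t \<xi> w - sint m' t' \<xi>' w)\<^sup>2) \<le> CARD('n) * (4 * a)"
    using simple_integral_moments[OF z(1)] unfolding z(3) by (auto intro: order_trans mult_left_mono)
qed

text \<open>Approximations with squared errors at most \<open>(1 / 4) ^ k\<close> have integrals
  whose successive differences are of order \<open>(1 / 2) ^ k\<close> in mean. The telescoping
  series therefore converges absolutely, almost surely and in L1, and the limit inherits mean zero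
  from the simple integrals.\<close>

lemma ito_limit:
  assumes d: "L2_density u v"
  obtains m t \<xi> X where "\<And>k. simple (m k) (t k) (\<xi> k)"
    "AE w in M. (\<lambda>k. sq_dist (simple_process (m k) (t k) (\<xi> k)) v w) \<longlonglongrightarrow> 0"
    "AE w in M. (\<lambda>k. sint (m k) (t k) (\<xi> k) w) \<longlonglongrightarrow> X w"
    "integrable M X" "expectation X = 0"
proof -
  have v: "(\<lambda>(w, s). v w s) \<in> borel_measurable (M \<Otimes>\<^sub>M lborel)" using d by (simp add: L2_density_def)
  have "\<forall>k. \<exists>q. simple (fst q) (fst (snd q)) (snd (snd q)) \<and>
      (\<integral>\<^sup>+w. sq_dist (simple_process (fst q) (fst (snd q)) (snd (snd q))) v w \<partial>M) \<le> ennreal ((1 / 4) ^ k)"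
  proof
    fix k :: nat
    obtain m t \<xi> where "simple m t \<xi>" "(\<integral>\<^sup>+w. sq_dist (simple_process m t \<xi>) v w \<partial>M) \<le> ennreal ((1 / 4) ^ k)"
      using simple_approx[OF d, of "(1 / 4) ^ k"] by auto
    then show "\<exists>q. simple (fst q) (fst (snd q)) (snd (snd q)) \<and>
      (\<integral>\<^sup>+w. sq_dist (simple_process (fst q) (fst (snd q)) (snd (snd q))) v w \<partial>M) \<le> ennreal ((1 / 4) ^ k)"
      by (intro exI[of _ "(m, t, \<xi>)"]) simp
  qed
  then obtain q where q: "\<forall>k. simple (fst (q k)) (fst (snd (q k))) (snd (snd (q k))) \<and>
      (\<integral>\<^sup>+w. sq_dist (simple_process (fst (q k)) (fst (snd (q k))) (snd (snd (q k)))) v w \<partial>M) \<le> ennreal ((1 / 4) ^ k)"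
    by (rule choice[THEN exE])
  define m t \<xi> where "m = (\<lambda>k. fst (q k))" and "t = (\<lambda>k. fst (snd (q k)))" and "\<xi> = (\<lambda>k. snd (snd (q k)))"
  have s: "simple (m k) (t k) (\<xi> k)"
    and e: "(\<integral>\<^sup>+w. sq_dist (simple_process (m k) (t k) (\<xi> k)) v w \<partial>M) \<le> ennreal ((1 / 4) ^ k)" for k :: nat
    using q by (auto simp: m_def t_def \<xi>_def)
  note meas = sq_dist_measurable[OF simple_process_measurable[OF s] v]
  have lim: "AE w in M. (\<lambda>k. sq_dist (simple_process (m k) (t k) (\<xi> k)) v w) \<longlonglongrightarrow> 0"
    by (rule AE_tendsto_zero_of_summable(2)[OF meas e]) (auto intro: summable_geometric)
  define I where "I = (\<lambda>k. sint (m k) (t k) (\<xi> k))"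
  have Im [measurable]: "I k \<in> borel_measurable M" for k unfolding I_def by (rule simple_integral_measurable[OF s])
  have I: "integrable M (I k)" "expectation (I k) = 0" for k
    using simple_integral_moments[OF s] by (auto simp: I_def)
  define D where "D = (\<lambda>k w. I (Suc k) w - I k w)"
  have D: "integrable M (D k)" "expectation (D k) = 0" for k using I by (auto simp: D_def)
  define C where "C = (1 + 4 * real CARD('n)) / 2"
  have D1: "expectation (\<lambda>w. norm (D k w)) \<le> C * (1 / 2) ^ k" for k
  proof -
    have e': "(\<integral>\<^sup>+w. sq_dist (simple_process (m (Suc k)) (t (Suc k)) (\<xi> (Suc k))) v w \<partial>M) \<le> ennreal ((1 / 4) ^ k)"
      using e[of "Suc k"] by (rule order_trans) (auto intro!: ennreal_leI power_decreasing)
    have D2: "integrable M (\<lambda>w. (D k w)\<^sup>2)" "expectation (\<lambda>w. (D k w)\<^sup>2) \<le> CARD('n) * (4 * (1 / 4) ^ k)"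
      using simple_integral_diff_moment[OF v s[of "Suc k"] s[of k] _ e' e] by (simp_all add: D_def I_def)
    \<comment> \<open>Young's inequality with weight \<open>2 ^ k\<close>, which brings a second
      moment of order \<open>(1 / 4) ^ k\<close> and the constant to the same order
      \<open>(1 / 2) ^ k\<close>.\<close>
    have "norm (D k w) \<le> ((1 / 2) ^ k + (D k w)\<^sup>2 * 2 ^ k) / 2" for w
    proof -
      have "0 \<le> (\<bar>D k w\<bar> * 2 ^ k - 1)\<^sup>2 / 2 ^ k" by simp
      also have "\<dots> = (D k w)\<^sup>2 * 2 ^ k - 2 * \<bar>D k w\<bar> + (1 / 2) ^ k"
        by (simp add: power2_diff power_mult_distrib field_simps power2_eq_square)
      finally show ?thesis by simp
    qed
    then have "expectation (\<lambda>w. norm (D k w)) \<le> expectation (\<lambda>w. ((1 / 2) ^ k + (D k w)\<^sup>2 * 2 ^ k) / 2)"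
      using D(1) D2(1) by (intro integral_mono) auto
    also have "\<dots> = ((1 / 2) ^ k + expectation (\<lambda>w. (D k w)\<^sup>2) * 2 ^ k) / 2"
      using D2(1) by simp
    also have "\<dots> \<le> ((1 / 2) ^ k + (CARD('n) * (4 * (1 / 4) ^ k)) * 2 ^ k) / 2"
      using D2(2) by (intro divide_right_mono add_left_mono mult_right_mono) auto
    also have "\<dots> = C * (1 / 2) ^ k"
    proof -
      have "(1 / 4 :: real) ^ k * 2 ^ k = (1 / 2) ^ k" by (simp add: power_mult_distrib[symmetric])
      then show ?thesis by (simp add: C_def field_simps)
    qed
    finally show ?thesis .
  qed
  have C: "C \<ge> 0" by (simp add: C_def)
  have sumC: "summable (\<lambda>k. C * (1 / 2) ^ k)" by (intro summable_mult summable_geometric) simp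
  have "AE w in M. (\<Sum>k. ennreal (norm (D k w))) \<noteq> \<infinity>"
  proof (rule AE_tendsto_zero_of_summable(1)[where c = "\<lambda>k. C * (1 / 2) ^ k"])
    show "(\<integral>\<^sup>+w. ennreal (norm (D k w)) \<partial>M) \<le> ennreal (C * (1 / 2) ^ k)" for k
      using D1[of k] D(1)[of k] by (subst nn_integral_eq_integral) (auto intro: ennreal_leI)
  qed (use C sumC D in auto)
  then have summ: "AE w in M. summable (\<lambda>k. norm (D k w))"
    by eventually_elim (auto intro: summable_suminf_not_top)
  have summ': "summable (\<lambda>k. expectation (\<lambda>w. norm (D k w)))"
    by (rule summable_comparison_test'[OF sumC, of 0]) (use D1 in \<open>auto intro: order_trans\<close>)
  define X where "X = (\<lambda>w. I 0 w + (\<Sum>k. D k w))"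
  have X: "integrable M X"
    unfolding X_def using I(1) integrable_suminf[OF D(1) summ summ'] by auto
  have EX: "expectation X = 0"
    unfolding X_def using I integrable_suminf[OF D(1) summ summ'] integral_suminf[OF D(1) summ summ'] D(2) by simp
  have IX: "AE w in M. (\<lambda>k. I k w) \<longlonglongrightarrow> X w"
    using summ
  proof eventually_elim
    case (elim w)
    have "(\<lambda>n. I 0 w + (\<Sum>k<n. D k w)) \<longlonglongrightarrow> X w"
      unfolding X_def by (intro tendsto_add tendsto_const summable_LIMSEQ summable_norm_cancel[OF elim])
    moreover have "I 0 w + (\<Sum>k<n. D k w) = I n w" for n
      unfolding D_def using sum_lessThan_telescope[of "\<lambda>k. I k w" n] by simp
    ultimately show ?case by simp
  qed
  show ?thesis by (rule that[OF s lim IX[unfolded I_def] X EX])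
qed

end

section \<open>Almost sure uniqueness of the stochastic integral\<close>

context path_brownian
begin

text \<open>The error term of \<open>has_stoch_integral\<close>. It is formed with
  \<open>cm_density\<close>, a choice made separately for each path, so its measurability is not
  evident; \<open>density_error_AE\<close> trades it for the jointly measurable
  \<open>v\<close>.\<close>

definition density_error :: "('n path \<Rightarrow> 'n path) \<Rightarrow> ('n path \<Rightarrow> real \<Rightarrow> real ^ 'n) \<Rightarrow> 'n path \<Rightarrow> ennreal" where
  "density_error u x w = (\<integral>\<^sup>+s\<in>{0..1}. ennreal ((norm (x w s - cm_density (u w) s))\<^sup>2) \<partial>lborel)"

lemma density_error_AE:
  assumes d: "L2_density u v" and s: "simple m t \<xi>"
  shows "AE w in M. density_error u (simple_process m t \<xi>) w = sq_dist (simple_process m t \<xi>) v w"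
proof -
  have "AE w in M. is_cm_density (u w) (v w)" using d by (simp add: L2_density_def)
  then show ?thesis
  proof eventually_elim
    case (elim w)
    then have "is_cm_density (u w) (cm_density (u w))"
      by (intro cm_density_is_density) (auto simp: cameron_martin_def)
    from is_cm_density_unique[OF this elim] show ?case
      unfolding density_error_def
    proof (intro nn_integral_cong_AE, eventually_elim)
      case (elim r)
      then show ?case
        using d simple_process_outside[OF s, of r w] by (cases "r \<in> {0..1}") (auto simp: L2_density_def)
    qed
  qed
qed

lemma density_error_measurable:
  assumes d: "L2_density u v" and s: "simple m t \<xi>"
  shows "density_error u (simple_process m t \<xi>) \<in> borel_measurable M"
proof (rule completion.measurable_cong_AE)
  show "sq_dist (simple_process m t \<xi>) v \<in> borel_measurable M"
    using d by (intro sq_dist_measurable simple_process_measurable s) (simp add: L2_density_def)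
  show "AE w in M. sq_dist (simple_process m t \<xi>) v w = density_error u (simple_process m t \<xi>) w"
    using density_error_AE[OF d s] by (auto elim: eventually_mono)
qed simp

lemma has_stoch_integral_iff:
  "has_stoch_integral \<nu> \<beta> u X \<longleftrightarrow> X \<in> borel_measurable M \<and>
     (\<exists>m t \<xi>. (\<forall>k. simple (m k) (t k) (\<xi> k)) \<and>
        (\<forall>\<epsilon>>0. (\<lambda>k. prob {w. density_error u (simple_process (m k) (t k) (\<xi> k)) w > ennreal \<epsilon>}) \<longlonglongrightarrow> 0) \<and>
        (\<forall>\<epsilon>>0. (\<lambda>k. prob {w. \<bar>sint (m k) (t k) (\<xi> k) w - X w\<bar> > \<epsilon>}) \<longlonglongrightarrow> 0))"
  unfolding has_stoch_integral_def density_error_def ..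

lemma measurable_Collect_gt:
  fixes f g :: "'n path \<Rightarrow> 'a::{second_countable_topology, linorder_topology}"
  shows "f \<in> borel_measurable M \<Longrightarrow> g \<in> borel_measurable M \<Longrightarrow> {w. f w > g w} \<in> events"
  using borel_measurable_less[of g M f] by (simp add: pred_def)

lemma has_stoch_integral_of_AE_limit:
  assumes d: "L2_density u v" and s: "\<And>k. simple (m k) (t k) (\<xi> k)"
    and lim: "AE w in M. (\<lambda>k. sq_dist (simple_process (m k) (t k) (\<xi> k)) v w) \<longlonglongrightarrow> 0"
    and X: "AE w in M. (\<lambda>k. sint (m k) (t k) (\<xi> k) w) \<longlonglongrightarrow> X w" "X \<in> borel_measurable M"
  shows "has_stoch_integral \<nu> \<beta> u X"
  unfolding has_stoch_integral_iff
proof (intro conjI exI allI impI)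
  show "simple (m k) (t k) (\<xi> k)" for k by (rule s)
  fix \<epsilon> :: real assume \<epsilon>: "\<epsilon> > 0"
  have all: "AE w in M. \<forall>k. density_error u (simple_process (m k) (t k) (\<xi> k)) w = sq_dist (simple_process (m k) (t k) (\<xi> k)) v w"
    unfolding AE_all_countable using density_error_AE[OF d s] by blast
  show "(\<lambda>k. prob {w. density_error u (simple_process (m k) (t k) (\<xi> k)) w > ennreal \<epsilon>}) \<longlonglongrightarrow> 0"
  proof (rule prob_tendsto_zero)
    show "{w. density_error u (simple_process (m k) (t k) (\<xi> k)) w > ennreal \<epsilon>} \<in> events" for k
      using density_error_measurable[OF d s] by (intro measurable_Collect_gt) auto
    show "AE w in M. \<forall>\<^sub>F k in sequentially. w \<notin> {w. density_error u (simple_process (m k) (t k) (\<xi> k)) w > ennreal \<epsilon>}"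
      using lim all
    proof eventually_elim
      case (elim w)
      have "\<forall>\<^sub>F k in sequentially. sq_dist (simple_process (m k) (t k) (\<xi> k)) v w < ennreal \<epsilon>"
        using \<epsilon> by (intro order_tendstoD(2)[OF elim(1)]) auto
      then show ?case by eventually_elim (use elim(2) in auto)
    qed
  qed
  have [measurable]: "sint (m k) (t k) (\<xi> k) \<in> borel_measurable M" for k by (rule simple_integral_measurable[OF s])
  show "(\<lambda>k. prob {w. \<bar>sint (m k) (t k) (\<xi> k) w - X w\<bar> > \<epsilon>}) \<longlonglongrightarrow> 0"
  proof (rule prob_tendsto_zero)
    show "{w. \<bar>sint (m k) (t k) (\<xi> k) w - X w\<bar> > \<epsilon>} \<in> events" for k
      using X(2) by (intro measurable_Collect_gt) auto
    show "AE w in M. \<forall>\<^sub>F k in sequentially. w \<notin> {w. \<bar>sint (m k) (t k) (\<xi> k) w - X w\<bar> > \<epsilon>}"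
      using X(1)
    proof eventually_elim
      case (elim w)
      then have "\<forall>\<^sub>F k in sequentially. dist (sint (m k) (t k) (\<xi> k) w) (X w) < \<epsilon>"
        using \<epsilon> by (rule tendstoD)
      then show ?case by eventually_elim (auto simp: dist_real_def)
    qed
  qed
qed (rule X(2))

text \<open>Two approximating sequences have differences whose energy tends to zero in probability,
  and \<open>simple_integral_tail\<close> passes this on to the integrals. Everything stays in
  probability, as the candidates \<open>X\<close> and \<open>X'\<close> come without
  moments.\<close>

lemma has_stoch_integral_unique:
  assumes d: "L2_density u v" and X: "has_stoch_integral \<nu> \<beta> u X" and X': "has_stoch_integral \<nu> \<beta> u X'"
  shows "AE w in M. X w = X' w"
proof -
  have v: "(\<lambda>(w, s). v w s) \<in> borel_measurable (M \<Otimes>\<^sub>M lborel)" using d by (simp add: L2_density_def)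
  obtain m t \<xi> where s: "\<And>k. simple (m k) (t k) (\<xi> k)"
    and E: "\<And>\<epsilon>. \<epsilon> > 0 \<Longrightarrow> (\<lambda>k. prob {w. density_error u (simple_process (m k) (t k) (\<xi> k)) w > ennreal \<epsilon>}) \<longlonglongrightarrow> 0"
    and I: "\<And>\<epsilon>. \<epsilon> > 0 \<Longrightarrow> (\<lambda>k. prob {w. \<bar>sint (m k) (t k) (\<xi> k) w - X w\<bar> > \<epsilon>}) \<longlonglongrightarrow> 0"
    using X unfolding has_stoch_integral_iff by blast
  obtain m' t' \<xi>' where s': "\<And>k. simple (m' k) (t' k) (\<xi>' k)"
    and E': "\<And>\<epsilon>. \<epsilon> > 0 \<Longrightarrow> (\<lambda>k. prob {w. density_error u (simple_process (m' k) (t' k) (\<xi>' k)) w > ennreal \<epsilon>}) \<longlonglongrightarrow> 0"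
    and I': "\<And>\<epsilon>. \<epsilon> > 0 \<Longrightarrow> (\<lambda>k. prob {w. \<bar>sint (m' k) (t' k) (\<xi>' k) w - X' w\<bar> > \<epsilon>}) \<longlonglongrightarrow> 0"
    using X' unfolding has_stoch_integral_iff by blast
  have Xm: "X \<in> borel_measurable M" "X' \<in> borel_measurable M" using X X' by (auto simp: has_stoch_integral_iff)
  note Im = simple_integral_measurable[OF s] simple_integral_measurable[OF s']
  note [measurable] = Xm Im
  let ?n = "real CARD('n)"
  \<comment> \<open>Three deviations of size \<open>\<epsilon>\<close>: of each integral from its
    limit, and of the integrals from each other. The energy of the difference exceeds
    \<open>e\<close> only if one of the two errors exceeds \<open>e / 4\<close>.\<close>
  have bound: "prob {w. \<bar>X w - X' w\<bar> > 3 * \<epsilon>} \<le> ?n * e / \<epsilon>\<^sup>2" if \<epsilon>: "\<epsilon> > 0" and e: "e > 0" for \<epsilon> e :: real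
  proof -
    define A where "A = (\<lambda>k. {w. \<bar>sint (m k) (t k) (\<xi> k) w - X w\<bar> > \<epsilon>})"
    define A' where "A' = (\<lambda>k. {w. \<bar>sint (m' k) (t' k) (\<xi>' k) w - X' w\<bar> > \<epsilon>})"
    define G where "G = (\<lambda>k. {w. density_error u (simple_process (m k) (t k) (\<xi> k)) w > ennreal (e / 4)})"
    define G' where "G' = (\<lambda>k. {w. density_error u (simple_process (m' k) (t' k) (\<xi>' k)) w > ennreal (e / 4)})"
    define Q where "Q = (\<lambda>k. {w. \<bar>sint (m k) (t k) (\<xi> k) w - sint (m' k) (t' k) (\<xi>' k) w\<bar> > \<epsilon>})"
    have ev: "A k \<in> events" "A' k \<in> events" "G k \<in> events" "G' k \<in> events" "Q k \<in> events" for k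
      unfolding A_def A'_def G_def G'_def Q_def
      using density_error_measurable[OF d s] density_error_measurable[OF d s'] by (auto intro!: measurable_Collect_gt)
    have Q: "prob (Q k) \<le> prob (G k) + prob (G' k) + ?n * e / \<epsilon>\<^sup>2" for k
    proof -
      obtain K T \<zeta> where z: "simple K T \<zeta>"
        "\<And>w r. simple_process K T \<zeta> w r = simple_process (m k) (t k) (\<xi> k) w r - simple_process (m' k) (t' k) (\<xi>' k) w r"
        "\<And>w. sint K T \<zeta> w = sint (m k) (t k) (\<xi> k) w - sint (m' k) (t' k) (\<xi>' k) w"
        using simple_integrand_diff[OF s[of k] s'[of k], where \<beta> = \<beta>] by blast
      have "AE w in M. w \<in> {w. simple_energy K T \<zeta> w > e} \<longrightarrow> w \<in> G k \<union> G' k"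
        using density_error_AE[OF d s[of k]] density_error_AE[OF d s'[of k]]
      proof eventually_elim
        case (elim w)
        have "ennreal (simple_energy K T \<zeta> w) = sq_dist (simple_process (m k) (t k) (\<xi> k)) (simple_process (m' k) (t' k) (\<xi>' k)) w"
          by (simp add: nn_integral_simple_process_sq[OF z(1), symmetric] z(2))
        also have "\<dots> \<le> 2 * sq_dist (simple_process (m k) (t k) (\<xi> k)) v w + 2 * sq_dist v (simple_process (m' k) (t' k) (\<xi>' k)) w"
          by (intro sq_dist_triangle simple_process_measurable s s' v)
        also have "sq_dist v (simple_process (m' k) (t' k) (\<xi>' k)) w = sq_dist (simple_process (m' k) (t' k) (\<xi>' k)) v w"
          by (simp add: norm_minus_commute)
        finally have le: "ennreal (simple_energy K T \<zeta> w) \<le> 2 * density_error u (simple_process (m k) (t k) (\<xi> k)) w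
            + 2 * density_error u (simple_process (m' k) (t' k) (\<xi>' k)) w" unfolding elim .
        show ?case
        proof (intro impI, rule ccontr)
          assume w: "w \<in> {w. simple_energy K T \<zeta> w > e}" and "w \<notin> G k \<union> G' k"
          then have "density_error u (simple_process (m k) (t k) (\<xi> k)) w \<le> ennreal (e / 4)"
            "density_error u (simple_process (m' k) (t' k) (\<xi>' k)) w \<le> ennreal (e / 4)"
            by (auto simp: G_def G'_def not_less)
          then have "ennreal (simple_energy K T \<zeta> w) \<le> 2 * ennreal (e / 4) + 2 * ennreal (e / 4)"
            by (intro order_trans[OF le] add_mono mult_left_mono) auto
          also have "\<dots> = ennreal e"
            using e by (simp add: ennreal_numeral[symmetric] ennreal_mult[symmetric] ennreal_plus[symmetric] del: ennreal_numeral ennreal_plus)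
          finally show False using w e by (simp add: ennreal_le_iff)
        qed
      qed
      then have "prob {w. simple_energy K T \<zeta> w > e} \<le> prob (G k \<union> G' k)"
        using ev by (intro finite_measure_mono_AE) auto
      also have "\<dots> \<le> prob (G k) + prob (G' k)" using ev by (intro measure_Un_le)
      finally show ?thesis
        using simple_integral_tail[OF z(1) \<epsilon> e] unfolding Q_def z(3) by linarith
    qed
    have le: "prob {w. \<bar>X w - X' w\<bar> > 3 * \<epsilon>} \<le> prob (A k) + prob (A' k) + (prob (G k) + prob (G' k)) + ?n * e / \<epsilon>\<^sup>2" for k
    proof -
      have "{w. \<bar>X w - X' w\<bar> > 3 * \<epsilon>} \<subseteq> (A k \<union> A' k) \<union> Q k"
        unfolding A_def A'_def Q_def by auto
      then have "prob {w. \<bar>X w - X' w\<bar> > 3 * \<epsilon>} \<le> prob ((A k \<union> A' k) \<union> Q k)"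
        using ev by (intro finite_measure_mono) auto
      also have "\<dots> \<le> prob (A k \<union> A' k) + prob (Q k)" using ev by (intro measure_Un_le) auto
      also have "prob (A k \<union> A' k) \<le> prob (A k) + prob (A' k)" using ev by (intro measure_Un_le) auto
      finally show ?thesis using Q[of k] by linarith
    qed
    have "(\<lambda>k. prob (A k) + prob (A' k) + (prob (G k) + prob (G' k)) + ?n * e / \<epsilon>\<^sup>2) \<longlonglongrightarrow> 0 + 0 + (0 + 0) + ?n * e / \<epsilon>\<^sup>2"
      unfolding A_def A'_def G_def G'_def using \<epsilon> e by (intro tendsto_add tendsto_const I I' E E') auto
    from LIMSEQ_le_const[OF this] le show ?thesis by auto
  qed
  have zero: "prob {w. \<bar>X w - X' w\<bar> > 3 * \<epsilon>} = 0" if \<epsilon>: "\<epsilon> > 0" for \<epsilon> :: real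
  proof -
    \<comment> \<open>The parameter \<open>e\<close> is free; this choice turns the bound into
      \<open>\<eta>\<close>.\<close>
    have "prob {w. \<bar>X w - X' w\<bar> > 3 * \<epsilon>} \<le> 0 + \<eta>" if \<eta>: "\<eta> > 0" for \<eta>
      using bound[OF \<epsilon>, of "\<eta> * \<epsilon>\<^sup>2 / ?n"] \<epsilon> \<eta> by simp
    then have "prob {w. \<bar>X w - X' w\<bar> > 3 * \<epsilon>} \<le> 0" by (rule field_le_epsilon)
    then show ?thesis using measure_nonneg[of M] by (meson antisym)
  qed
  have "AE w in M. \<bar>X w - X' w\<bar> \<le> 3 * (1 / real (Suc k))" for k
  proof -
    have "{w. \<bar>X w - X' w\<bar> > 3 * (1 / real (Suc k))} \<in> events" by (intro measurable_Collect_gt) auto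
    then show ?thesis using zero[of "1 / real (Suc k)"] prob_eq_0[of "{w. \<bar>X w - X' w\<bar> > 3 * (1 / real (Suc k))}"]
      by (simp add: not_less)
  qed
  then have "AE w in M. \<forall>k. \<bar>X w - X' w\<bar> \<le> 3 * (1 / real (Suc k))" unfolding AE_all_countable by blast
  then show ?thesis
  proof eventually_elim
    case (elim w)
    have "(\<lambda>k. 3 * (1 / real (Suc k))) \<longlonglongrightarrow> 3 * 0"
      by (intro tendsto_mult tendsto_const LIMSEQ_Suc[OF lim_1_over_n])
    then have "\<bar>X w - X' w\<bar> \<le> 3 * 0" using elim by (intro LIMSEQ_le_const) auto
    then show ?case by simp
  qed
qed

text \<open>Existence makes the choice in \<open>stoch_integral\<close> meaningful, and uniqueness
  lets it inherit the approximation and the zero mean from \<open>ito_limit\<close>.\<close>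

lemma stoch_integral_approx:
  assumes d: "L2_density u v"
  obtains m t \<xi> where "\<And>k. simple (m k) (t k) (\<xi> k)"
    "AE w in M. (\<lambda>k. sq_dist (simple_process (m k) (t k) (\<xi> k)) v w) \<longlonglongrightarrow> 0"
    "AE w in M. (\<lambda>k. sint (m k) (t k) (\<xi> k) w) \<longlonglongrightarrow> stoch_integral \<nu> \<beta> u w"
    "integrable M (stoch_integral \<nu> \<beta> u)" "expectation (stoch_integral \<nu> \<beta> u) = 0"
proof -
  obtain m t \<xi> X where s: "\<And>k. simple (m k) (t k) (\<xi> k)"
    and l: "AE w in M. (\<lambda>k. sq_dist (simple_process (m k) (t k) (\<xi> k)) v w) \<longlonglongrightarrow> 0"
      "AE w in M. (\<lambda>k. sint (m k) (t k) (\<xi> k) w) \<longlonglongrightarrow> X w"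
    and X: "integrable M X" "expectation X = 0"
    using ito_limit[OF d] by blast
  have h: "has_stoch_integral \<nu> \<beta> u X"
    by (rule has_stoch_integral_of_AE_limit[OF d s l]) (use X in auto)
  then have h': "has_stoch_integral \<nu> \<beta> u (stoch_integral \<nu> \<beta> u)" unfolding stoch_integral_def by (rule someI[of "has_stoch_integral \<nu> \<beta> u"])
  have eq: "AE w in M. X w = stoch_integral \<nu> \<beta> u w" by (rule has_stoch_integral_unique[OF d h h'])
  have m: "stoch_integral \<nu> \<beta> u \<in> borel_measurable M" using h' by (simp add: has_stoch_integral_def)
  have "AE w in M. (\<lambda>k. sint (m k) (t k) (\<xi> k) w) \<longlonglongrightarrow> stoch_integral \<nu> \<beta> u w"
    using l(2) eq by eventually_elim simp
  moreover have "integrable M (stoch_integral \<nu> \<beta> u)"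
    by (rule integrable_cong_AE_imp[OF X(1) m]) (use eq in \<open>auto elim: eventually_mono\<close>)
  moreover have "expectation (stoch_integral \<nu> \<beta> u) = 0"
    using integral_cong_AE[OF _ m eq] X by auto
  ultimately show ?thesis using that[OF s l(1)] by blast
qed

end

section \<open>Girsanov's theorem\<close>

context path_brownian
begin

definition simple_exp :: "nat \<Rightarrow> (nat \<Rightarrow> real) \<Rightarrow> (nat \<Rightarrow> 'n path \<Rightarrow> real ^ 'n) \<Rightarrow> 'n path \<Rightarrow> real" where
  "simple_exp m t \<xi> w = exp (- sint m t \<xi> w - simple_energy m t \<xi> w / 2)"

lemma simple_exp_nonneg [simp]: "0 \<le> simple_exp m t \<xi> w"
  by (simp add: simple_exp_def)

text \<open>After freezing the past, the exponential factor shifts the Gaussian density by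
  \<open>(t - s) *\<^sub>R \<xi> w\<close>, and translating the variable removes the drift from the
  argument of \<open>G\<close>. So under the weight the increment plus its drift behaves as the
  plain increment did.\<close>

lemma girsanov_step:
  fixes s t :: real
  assumes st: "0 \<le> s" "s < t" "t \<le> 1"
    and Q [measurable]: "Q \<in> borel_measurable (F s)" and \<xi> [measurable]: "\<xi> \<in> borel_measurable (F s)"
    and A [measurable]: "A \<in> borel_measurable (F s)" and G [measurable]: "G \<in> borel_measurable borel"
  shows "(\<integral>\<^sup>+w. Q w * ennreal (exp (- (\<xi> w \<bullet> incr s t w) - (t - s) * (norm (\<xi> w))\<^sup>2 / 2))
        * G (A w + incr s t w + (t - s) *\<^sub>R \<xi> w) \<partial>M)
      = (\<integral>\<^sup>+w. Q w * (\<integral>\<^sup>+(y :: real ^ 'n). G (A w + y) * ennreal (gauss_density (t - s) y) \<partial>lborel) \<partial>M)"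
proof -
  let ?h = "\<lambda>w x. Q w * ennreal (exp (- (\<xi> w \<bullet> x) - (t - s) * (norm (\<xi> w))\<^sup>2 / 2)) * G (A w + x + (t - s) *\<^sub>R \<xi> w)"
  have "(\<integral>\<^sup>+w. ?h w (incr s t w) \<partial>M) = (\<integral>\<^sup>+w. (\<integral>\<^sup>+x. ?h w x * ennreal (gauss_density (t - s) x) \<partial>lborel) \<partial>M)"
    by (rule freezing[OF st]) measurable
  also have "\<dots> = (\<integral>\<^sup>+w. Q w * (\<integral>\<^sup>+(y :: real ^ 'n). G (A w + y) * ennreal (gauss_density (t - s) y) \<partial>lborel) \<partial>M)"
  proof (rule nn_integral_cong)
    fix w
    have "?h w x * ennreal (gauss_density (t - s) x)
        = Q w * (G (A w + (x + (t - s) *\<^sub>R \<xi> w)) * ennreal (gauss_density (t - s) (x + (t - s) *\<^sub>R \<xi> w)))" for x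
    proof -
      have "ennreal (exp (- (\<xi> w \<bullet> x) - (t - s) * (norm (\<xi> w))\<^sup>2 / 2)) * ennreal (gauss_density (t - s) x)
          = ennreal (gauss_density (t - s) (x + (t - s) *\<^sub>R \<xi> w))"
        using gauss_density_shift[of "t - s" "\<xi> w" x] st by (simp add: ennreal_mult[symmetric])
      moreover have "q * e * g * z = q * (g * (e * z))" for q e g z :: ennreal by (simp add: ac_simps)
      ultimately show ?thesis by (simp only: add.assoc)
    qed
    then have "(\<integral>\<^sup>+x. ?h w x * ennreal (gauss_density (t - s) x) \<partial>lborel)
        = (\<integral>\<^sup>+x. Q w * (G (A w + (x + (t - s) *\<^sub>R \<xi> w)) * ennreal (gauss_density (t - s) (x + (t - s) *\<^sub>R \<xi> w))) \<partial>lborel)"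
      by simp
    also have "\<dots> = (\<integral>\<^sup>+y. Q w * (G (A w + y) * ennreal (gauss_density (t - s) y)) \<partial>lborel)"
      by (rule lborel_nn_integral_translation[where f = "\<lambda>y. Q w * (G (A w + y) * ennreal (gauss_density (t - s) y))"]) measurable
    also have "\<dots> = Q w * (\<integral>\<^sup>+y. G (A w + y) * ennreal (gauss_density (t - s) y) \<partial>lborel)"
      by (rule nn_integral_cmult) measurable
    finally show "(\<integral>\<^sup>+x. ?h w x * ennreal (gauss_density (t - s) x) \<partial>lborel) = \<dots>" .
  qed
  finally show ?thesis .
qed

lemma simple_exp_Suc:
  "simple_exp (Suc k) t \<xi> w = simple_exp k t \<xi> w * exp (- (\<xi> k w \<bullet> incr (t k) (t (Suc k)) w) - (t (Suc k) - t k) * (norm (\<xi> k w))\<^sup>2 / 2)"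
  unfolding simple_exp_def simple_integral_Suc exp_add[symmetric] by (simp add: simple_energy_def field_simps)

lemma simple_exp_measurable_F:
  assumes si: "simple m t \<xi>"
  shows "simple_exp m t \<xi> \<in> borel_measurable (F (t m))"
proof -
  have [measurable]: "sint m t \<xi> \<in> borel_measurable (F (t m))" by (rule simple_integral_measurable_F[OF si])
  have [measurable]: "simple_energy m t \<xi> \<in> borel_measurable (F (t m))"
    unfolding simple_energy_def[abs_def] using simple_integrand_mono_le[OF si]
    by (intro borel_measurable_sum borel_measurable_times borel_measurable_const borel_measurable_power
        measurable_compose[OF _ borel_measurable_norm] simple_measurable[OF si]) auto
  show ?thesis unfolding simple_exp_def[abs_def] by measurable
qed

lemma simple_exp_measurable: "simple m t \<xi> \<Longrightarrow> simple_exp m t \<xi> \<in> borel_measurable M"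
  by (rule F_measurable_M[OF simple_exp_measurable_F])

text \<open>The case \<open>G = 1\<close> of \<open>girsanov_step\<close>: each further exponential
  factor has conditional expectation one.\<close>

lemma simple_exp_martingale:
  assumes si: "simple m t \<xi>" and k: "k \<le> m" and Q: "Q \<in> borel_measurable (F (t k))"
  shows "(\<integral>\<^sup>+w. Q w * ennreal (simple_exp m t \<xi> w) \<partial>M) = (\<integral>\<^sup>+w. Q w * ennreal (simple_exp k t \<xi> w) \<partial>M)"
  using k
proof (induction m rule: dec_induct)
  case (step j)
  then have sj: "simple j t \<xi>" and j: "j < m" using simple_integrand_restrict[OF si] k by auto
  have st: "0 \<le> t j" "t j < t (Suc j)" "t (Suc j) \<le> 1"
    using simple_integrand_bounds[OF si] j si by (auto simp: simple_integrand_def)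
  have "Q \<in> borel_measurable (F (t j))"
    using Q simple_integrand_mono_le[OF si, of k j] step j by (intro F_mono[OF _ Q]) auto
  then have QR: "(\<lambda>w. Q w * ennreal (simple_exp j t \<xi> w)) \<in> borel_measurable (F (t j))"
    using simple_exp_measurable_F[OF sj] by measurable
  have "(\<integral>\<^sup>+w. Q w * ennreal (simple_exp (Suc j) t \<xi> w) \<partial>M)
      = (\<integral>\<^sup>+w. Q w * ennreal (simple_exp j t \<xi> w) * (\<integral>\<^sup>+(y :: real ^ 'n). 1 * ennreal (gauss_density (t (Suc j) - t j) y) \<partial>lborel) \<partial>M)"
    using girsanov_step[OF st QR simple_measurable[OF si j order_refl], of "\<lambda>_. 0" "\<lambda>_. 1"]
    by (simp add: simple_exp_Suc ennreal_mult' mult.assoc)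
  also have "\<dots> = (\<integral>\<^sup>+w. Q w * ennreal (simple_exp j t \<xi> w) \<partial>M)"
    using st by (simp add: nn_integral_gauss_density)
  finally show ?case using step by simp
qed simp

lemma simple_exp_expectation:
  assumes si: "simple m t \<xi>"
  shows "(\<integral>\<^sup>+w. ennreal (simple_exp m t \<xi> w) \<partial>M) = 1"
  using simple_exp_martingale[OF si, of 0 "\<lambda>_. 1"]
  by (simp add: simple_exp_def simple_integral_def simple_energy_def emeasure_space_1[simplified])

text \<open>That \<open>C\<close> does not depend on \<open>Q\<close> expresses independence from
  the past under the weighted measure. The last cell is integrated out first, which replaces
  \<open>G\<close> by its Gaussian average \<open>G'\<close>; hence \<open>G\<close> is arbitrary in
  the induction.\<close>

lemma simple_girsanov_grid:
  assumes si: "simple m t \<xi>" and ac: "a \<le> c" "c \<le> m" and G: "G \<in> borel_measurable borel"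
  shows "\<exists>C. \<forall>Q \<in> borel_measurable (F (t a)).
    (\<integral>\<^sup>+w. Q w * ennreal (simple_exp m t \<xi> w)
        * G (\<Sum>i\<in>{a..<c}. incr (t i) (t (Suc i)) w + (t (Suc i) - t i) *\<^sub>R \<xi> i w) \<partial>M)
      = C * (\<integral>\<^sup>+w. Q w * ennreal (simple_exp m t \<xi> w) \<partial>M)"
proof -
  let ?S = "\<lambda>j w. \<Sum>i\<in>{a..<j}. incr (t i) (t (Suc i)) w + (t (Suc i) - t i) *\<^sub>R \<xi> i w"
  have S: "?S j \<in> borel_measurable (F (t j))" if "j \<le> m" for j
    using simple_integrand_bounds[OF si] simple_integrand_mono_le[OF si] that
    by (intro borel_measurable_sum borel_measurable_add measurable_incr_F borel_measurable_scaleR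
        borel_measurable_const simple_measurable[OF si]) auto
  have main: "\<exists>C. \<forall>Q \<in> borel_measurable (F (t a)).
    (\<integral>\<^sup>+w. Q w * ennreal (simple_exp j t \<xi> w) * G (?S j w) \<partial>M) = C * (\<integral>\<^sup>+w. Q w * ennreal (simple_exp a t \<xi> w) \<partial>M)"
    if "a \<le> j" "j \<le> m" "G \<in> borel_measurable borel" for j G
    using that
  proof (induction j arbitrary: G rule: dec_induct)
    case base
    have sa: "simple a t \<xi>" using simple_integrand_restrict[OF si] base by simp
    show ?case
    proof (intro exI[of _ "G 0"] ballI)
      fix Q :: "'n path \<Rightarrow> ennreal" assume "Q \<in> borel_measurable (F (t a))"
      then have [measurable]: "Q \<in> borel_measurable M" by (rule F_measurable_M)
      have [measurable]: "simple_exp a t \<xi> \<in> borel_measurable M" by (rule simple_exp_measurable[OF sa])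
      show "(\<integral>\<^sup>+w. Q w * ennreal (simple_exp a t \<xi> w) * G (?S a w) \<partial>M) = G 0 * (\<integral>\<^sup>+w. Q w * ennreal (simple_exp a t \<xi> w) \<partial>M)"
        by (simp add: nn_integral_cmult mult.commute[of _ "G 0"])
    qed
  next
    case (step j)
    have j: "j < m" and sj: "simple j t \<xi>" using step simple_integrand_restrict[OF si] by auto
    have st: "0 \<le> t j" "t j < t (Suc j)" "t (Suc j) \<le> 1"
      using simple_integrand_bounds[OF si] j si by (auto simp: simple_integrand_def)
    note [measurable] = step.prems(2)
    define G' where "G' = (\<lambda>z. \<integral>\<^sup>+(y :: real ^ 'n). G (z + y) * ennreal (gauss_density (t (Suc j) - t j) y) \<partial>lborel)"
    have G': "G' \<in> borel_measurable borel" unfolding G'_def by measurable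
    obtain C where C: "\<And>Q. Q \<in> borel_measurable (F (t a)) \<Longrightarrow>
      (\<integral>\<^sup>+w. Q w * ennreal (simple_exp j t \<xi> w) * G' (?S j w) \<partial>M) = C * (\<integral>\<^sup>+w. Q w * ennreal (simple_exp a t \<xi> w) \<partial>M)"
      using step.IH[OF less_imp_le[OF j] G'] by blast
    show ?case
    proof (intro exI[of _ C] ballI)
      fix Q :: "'n path \<Rightarrow> ennreal" assume Q: "Q \<in> borel_measurable (F (t a))"
      have "Q \<in> borel_measurable (F (t j))"
        using simple_integrand_mono_le[OF si, of a j] step j by (intro F_mono[OF _ Q]) auto
      then have QR: "(\<lambda>w. Q w * ennreal (simple_exp j t \<xi> w)) \<in> borel_measurable (F (t j))"
        using simple_exp_measurable_F[OF sj] by measurable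
      have Sj: "?S (Suc j) w = ?S j w + incr (t j) (t (Suc j)) w + (t (Suc j) - t j) *\<^sub>R \<xi> j w" for w
        using step.hyps by simp
      have "(\<integral>\<^sup>+w. Q w * ennreal (simple_exp (Suc j) t \<xi> w) * G (?S (Suc j) w) \<partial>M)
          = (\<integral>\<^sup>+w. Q w * ennreal (simple_exp j t \<xi> w) * G' (?S j w) \<partial>M)"
        using girsanov_step[OF st QR simple_measurable[OF si j order_refl] S step.prems(2)] j
        unfolding Sj G'_def by (simp add: simple_exp_Suc ennreal_mult' mult.assoc)
      then show "(\<integral>\<^sup>+w. Q w * ennreal (simple_exp (Suc j) t \<xi> w) * G (?S (Suc j) w) \<partial>M)
          = C * (\<integral>\<^sup>+w. Q w * ennreal (simple_exp a t \<xi> w) \<partial>M)" using C[OF Q] by simp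
    qed
  qed
  obtain C where C: "\<And>Q. Q \<in> borel_measurable (F (t a)) \<Longrightarrow>
      (\<integral>\<^sup>+w. Q w * ennreal (simple_exp c t \<xi> w) * G (?S c w) \<partial>M) = C * (\<integral>\<^sup>+w. Q w * ennreal (simple_exp a t \<xi> w) \<partial>M)"
    using main[OF ac G] by blast
  show ?thesis
  proof (intro exI[of _ C] ballI)
    fix Q :: "'n path \<Rightarrow> ennreal" assume Q: "Q \<in> borel_measurable (F (t a))"
    have Qc: "Q \<in> borel_measurable (F (t c))"
      using simple_integrand_mono_le[OF si, of a c] ac by (intro F_mono[OF _ Q]) auto
    \<comment> \<open>The cells after \<open>c\<close> are removed by the martingale property, with
      \<open>G\<close> of the sum counted among what is known at time \<open>t c\<close>.\<close>
    have QG: "(\<lambda>w. Q w * G (?S c w)) \<in> borel_measurable (F (t c))"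
      using Qc measurable_compose[OF S[OF ac(2)] G] by measurable
    have "(\<integral>\<^sup>+w. Q w * ennreal (simple_exp m t \<xi> w) * G (?S c w) \<partial>M) = (\<integral>\<^sup>+w. Q w * ennreal (simple_exp c t \<xi> w) * G (?S c w) \<partial>M)"
      using simple_exp_martingale[OF si ac(2) QG] by (simp add: mult.assoc mult.commute mult.left_commute)
    also have "\<dots> = C * (\<integral>\<^sup>+w. Q w * ennreal (simple_exp m t \<xi> w) \<partial>M)"
      using C[OF Q] simple_exp_martingale[OF si _ Q] ac by simp
    finally show "(\<integral>\<^sup>+w. Q w * ennreal (simple_exp m t \<xi> w) * G (?S c w) \<partial>M) = \<dots>" .
  qed
qed

definition simple_drift :: "nat \<Rightarrow> (nat \<Rightarrow> real) \<Rightarrow> (nat \<Rightarrow> 'n path \<Rightarrow> real ^ 'n) \<Rightarrow> real \<Rightarrow> real \<Rightarrow> 'n path \<Rightarrow> real ^ 'n" where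
  "simple_drift m t \<xi> s r w = (LINT x|lborel. indicator {s<..r} x *\<^sub>R simple_process m t \<xi> w x)"

text \<open>The times \<open>s\<close> and \<open>r\<close> need not belong to the grid of the
  integrand; adding them changes neither the process, nor its integral, nor its energy.\<close>

lemma simple_girsanov:
  fixes s r :: real
  assumes si: "simple m t \<xi>" and sr: "0 \<le> s" "s < r" "r \<le> 1"
    and G: "G \<in> borel_measurable borel" and Q: "Q \<in> borel_measurable (F s)"
  shows "(\<integral>\<^sup>+w. Q w * ennreal (simple_exp m t \<xi> w) * G (incr s r w + simple_drift m t \<xi> s r w) \<partial>M)
      = (\<integral>\<^sup>+w. ennreal (simple_exp m t \<xi> w) * G (incr s r w + simple_drift m t \<xi> s r w) \<partial>M)
        * (\<integral>\<^sup>+w. Q w * ennreal (simple_exp m t \<xi> w) \<partial>M)"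
proof -
  define S where "S = t ` {..m} \<union> {s, r}"
  have S: "finite S" "S \<subseteq> {0..1}" "t ` {..m} \<subseteq> S"
    using simple_integrand_bounds[OF si] sr by (auto simp: S_def)
  define T where "T = (\<lambda>j. sorted_list_of_set S ! j)"
  define k where "k = card S - 1"
  define \<zeta> where "\<zeta> = (\<lambda>j w. simple_process m t \<xi> w (sorted_list_of_set S ! Suc j))"
  note ref = simple_integrand_refine[OF si S, folded T_def k_def \<zeta>_def]
  note sz = ref(1) and pz = ref(2)
  have Iz: "sint k T \<zeta> w = sint m t \<xi> w" for w by (rule ref(3))
  have Ez: "simple_energy k T \<zeta> w = simple_energy m t \<xi> w" for w
    using nn_integral_simple_process_sq[OF sz, of w] nn_integral_simple_process_sq[OF si, of w]
      simple_energy_nonneg[OF sz] simple_energy_nonneg[OF si] unfolding pz by simp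
  have Rz: "simple_exp k T \<zeta> w = simple_exp m t \<xi> w" for w by (simp add: simple_exp_def Iz Ez)
  obtain a c where a: "a \<le> k" "T a = s" and c: "c \<le> k" "T c = r"
    using ref(4) by (auto simp: S_def image_iff set_eq_iff) (metis atMost_iff)
  have "a < c" using simple_integrand_mono_le[OF sz, of c a] a c sr by (cases "a < c") auto
  have D: "(\<Sum>i\<in>{a..<c}. incr (T i) (T (Suc i)) w + (T (Suc i) - T i) *\<^sub>R \<zeta> i w) = incr s r w + simple_drift m t \<xi> s r w" for w
  proof -
    have "(\<Sum>i\<in>{a..<c}. incr (T i) (T (Suc i)) w) = incr s r w"
      using sum_Suc_diff'[of a c "\<lambda>i. b w (T i)"] \<open>a < c\<close> a c by (simp add: incr_def)
    moreover have "(\<Sum>i\<in>{a..<c}. (T (Suc i) - T i) *\<^sub>R \<zeta> i w) = simple_drift m t \<xi> s r w"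
    proof -
      have "has_bochner_integral lborel (\<lambda>x. \<Sum>i\<in>{a..<c}. indicator {T i<..T (Suc i)} x *\<^sub>R \<zeta> i w) (\<Sum>i\<in>{a..<c}. (T (Suc i) - T i) *\<^sub>R \<zeta> i w)"
        using c sz by (intro has_bochner_integral_sum has_bochner_integral_indicator_Ioc) (auto simp: simple_integrand_def less_imp_le)
      moreover have "(\<Sum>i\<in>{a..<c}. indicator {T i<..T (Suc i)} x *\<^sub>R \<zeta> i w) = indicator {s<..r} x *\<^sub>R simple_process m t \<xi> w x" for x
      proof -
        have "indicator {s<..r} x *\<^sub>R simple_process k T \<zeta> w x
            = (\<Sum>i<k. (indicator {s<..r} x * indicator {T i<..T (Suc i)} x) *\<^sub>R \<zeta> i w)"
          unfolding simple_process_def scaleR_sum_right scaleR_scaleR ..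
        also have "\<dots> = (\<Sum>i\<in>{a..<c}. indicator {T i<..T (Suc i)} x *\<^sub>R \<zeta> i w)"
        proof (rule sum.mono_neutral_cong_right)
          have "(indicator {s<..r} x * indicator {T i<..T (Suc i)} x :: real) = 0" if i: "i \<in> {..<k} - {a..<c}" for i
          proof -
            consider "Suc i \<le> a" | "c \<le> i" using i by force
            then have "T (Suc i) \<le> s \<or> r \<le> T i"
              using simple_integrand_mono_le[OF sz, of "Suc i" a] simple_integrand_mono_le[OF sz, of c i] a c i by cases auto
            then show ?thesis by (auto simp: indicator_def)
          qed
          then show "\<forall>i\<in>{..<k} - {a..<c}. (indicator {s<..r} x * indicator {T i<..T (Suc i)} x) *\<^sub>R \<zeta> i w = 0"
            by simp
          fix i assume i: "i \<in> {a..<c}"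
          have "s \<le> T i" "T (Suc i) \<le> r"
            using simple_integrand_mono_le[OF sz, of a i] simple_integrand_mono_le[OF sz, of "Suc i" c] a c i by auto
          then show "(indicator {s<..r} x * indicator {T i<..T (Suc i)} x) *\<^sub>R \<zeta> i w = indicator {T i<..T (Suc i)} x *\<^sub>R \<zeta> i w"
            by (auto simp: indicator_def)
        qed (use c in auto)
        finally show ?thesis by (simp add: pz)
      qed
      ultimately show ?thesis
        unfolding simple_drift_def by (simp add: has_bochner_integral_iff)
    qed
    ultimately show ?thesis by (simp add: sum.distrib)
  qed
  obtain C where C: "\<And>Q. Q \<in> borel_measurable (F s) \<Longrightarrow>
    (\<integral>\<^sup>+w. Q w * ennreal (simple_exp m t \<xi> w) * G (incr s r w + simple_drift m t \<xi> s r w) \<partial>M)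
      = C * (\<integral>\<^sup>+w. Q w * ennreal (simple_exp m t \<xi> w) \<partial>M)"
    using simple_girsanov_grid[OF sz less_imp_le[OF \<open>a < c\<close>] c(1) G] unfolding D Rz a by blast
  \<comment> \<open>With \<open>Q = 1\<close> the weight has total mass one, which identifies
    \<open>C\<close>.\<close>
  have "(\<integral>\<^sup>+w. ennreal (simple_exp m t \<xi> w) * G (incr s r w + simple_drift m t \<xi> s r w) \<partial>M) = C"
    using C[of "\<lambda>_. 1"] simple_exp_expectation[OF si] by simp
  then show ?thesis using C[OF Q] by simp
qed

end

section \<open>Limit passages from simple integrands to the drift\<close>

lemma tendsto_zero_of_scaled_bound:
  fixes x e :: "nat \<Rightarrow> real"
  assumes e: "e \<longlonglongrightarrow> 0" and x: "\<And>k. 0 \<le> x k" and C: "0 \<le> C"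
    and le: "\<And>\<eta> k. 0 < \<eta> \<Longrightarrow> x k \<le> \<eta> * C + D \<eta> * e k"
  shows "x \<longlonglongrightarrow> 0"
proof (rule tendstoI)
  fix \<delta> :: real assume \<delta>: "0 < \<delta>"
  define \<eta> where "\<eta> = \<delta> / (2 * (C + 1))"
  have \<eta>: "0 < \<eta>" "\<eta> * C \<le> \<delta> / 2" using \<delta> C by (auto simp: \<eta>_def field_simps)
  have "(\<lambda>k. D \<eta> * e k) \<longlonglongrightarrow> D \<eta> * 0" by (intro tendsto_mult tendsto_const e)
  then have "\<forall>\<^sub>F k in sequentially. D \<eta> * e k < \<delta> / 2" using \<delta> by (intro order_tendstoD) auto
  then show "\<forall>\<^sub>F k in sequentially. dist (x k) 0 < \<delta>"
  proof eventually_elim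
    case (elim k)
    then show ?case using le[OF \<eta>(1), of k] \<eta>(2) x[of k] by (simp add: dist_real_def)
  qed
qed

text \<open>Young's inequality with a free parameter \<open>\<eta>\<close> bounds each deviation by
  a term of order \<open>\<eta>\<close> plus a multiple of the L2 error, which is the shape that
  \<open>tendsto_zero_of_scaled_bound\<close> expects.\<close>

lemma square_integrable_limits:
  fixes p :: "nat \<Rightarrow> real \<Rightarrow> 'b::euclidean_space" and q :: "real \<Rightarrow> 'b"
  assumes pm: "\<And>k. p k \<in> borel_measurable borel" and qm: "q \<in> borel_measurable borel"
    and p2: "\<And>k. (\<integral>\<^sup>+s. ennreal ((norm (p k s))\<^sup>2) \<partial>lborel) < \<infinity>" and q2: "(\<integral>\<^sup>+s. ennreal ((norm (q s))\<^sup>2) \<partial>lborel) < \<infinity>"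
    and lim: "(\<lambda>k. \<integral>\<^sup>+s. ennreal ((norm (p k s - q s))\<^sup>2) \<partial>lborel) \<longlonglongrightarrow> 0"
  shows "(\<lambda>k. LINT s|lborel. (norm (p k s))\<^sup>2) \<longlonglongrightarrow> (LINT s|lborel. (norm (q s))\<^sup>2)"
    and "s0 \<le> r0 \<Longrightarrow> (\<lambda>k. LINT s|lborel. indicator {s0<..r0} s *\<^sub>R p k s) \<longlonglongrightarrow> (LINT s|lborel. indicator {s0<..r0} s *\<^sub>R q s)"
proof -
  note [measurable] = pm qm
  have pi: "integrable lborel (\<lambda>s. (norm (p k s))\<^sup>2)" for k
    using p2[of k] by (intro integrableI_bounded) auto
  have qi: "integrable lborel (\<lambda>s. (norm (q s))\<^sup>2)"
    using q2 by (intro integrableI_bounded) auto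
  have di: "integrable lborel (\<lambda>s. (norm (p k s - q s))\<^sup>2)" for k
  proof (rule Bochner_Integration.integrable_bound)
    show "integrable lborel (\<lambda>s. 2 * (norm (p k s))\<^sup>2 + 2 * (norm (q s))\<^sup>2)" using pi qi by simp
    show "AE s in lborel. norm ((norm (p k s - q s))\<^sup>2) \<le> norm (2 * (norm (p k s))\<^sup>2 + 2 * (norm (q s))\<^sup>2)"
      using norm_diff_sq_le[of "p k _" "q _" 0] by simp
  qed measurable
  define e where "e = (\<lambda>k. LINT s|lborel. (norm (p k s - q s))\<^sup>2)"
  have e0: "0 \<le> e k" for k by (simp add: e_def)
  have "(\<lambda>k. ennreal (e k)) \<longlonglongrightarrow> ennreal 0"
    using lim by (simp add: nn_integral_eq_integral[OF di] e_def)
  then have e: "e \<longlonglongrightarrow> 0" using e0 by (subst (asm) tendsto_ennreal_iff) auto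
  have pt: "\<bar>(norm a)\<^sup>2 - (norm c)\<^sup>2\<bar> \<le> \<eta> * (norm c)\<^sup>2 + (1 + 1 / \<eta>) * (norm (a - c))\<^sup>2" if \<eta>: "0 < \<eta>" for a c :: 'b and \<eta>
  proof -
    define d where "d = norm (a - c)"
    have d: "0 \<le> d" "\<bar>norm a - norm c\<bar> \<le> d" unfolding d_def by (auto simp: norm_triangle_ineq3)
    have "\<bar>(norm a)\<^sup>2 - (norm c)\<^sup>2\<bar> = \<bar>norm a - norm c\<bar> * (norm a + norm c)"
      by (simp add: power2_eq_square square_diff_square_factored abs_mult mult.commute)
    also have "\<dots> \<le> d * (2 * norm c + d)" using d by (intro mult_mono) auto
    also have "\<dots> \<le> \<eta> * (norm c)\<^sup>2 + (1 + 1 / \<eta>) * d\<^sup>2"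
    proof -
      have "0 \<le> (\<eta> * norm c - d)\<^sup>2 / \<eta>" using \<eta> by simp
      also have "\<dots> = \<eta> * (norm c)\<^sup>2 - 2 * norm c * d + d\<^sup>2 / \<eta>"
        using \<eta> by (simp add: power2_diff power_mult_distrib field_simps power2_eq_square)
      finally show ?thesis by (simp add: algebra_simps power2_eq_square)
    qed
    finally show ?thesis by (simp add: d_def)
  qed
  show "(\<lambda>k. LINT s|lborel. (norm (p k s))\<^sup>2) \<longlonglongrightarrow> (LINT s|lborel. (norm (q s))\<^sup>2)"
  proof (rule LIM_zero_cancel, rule tendsto_rabs_zero_cancel, rule tendsto_zero_of_scaled_bound[OF e])
    fix \<eta> :: real and k assume \<eta>: "0 < \<eta>"
    have "\<bar>(LINT s|lborel. (norm (p k s))\<^sup>2) - (LINT s|lborel. (norm (q s))\<^sup>2)\<bar>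
        \<le> (LINT s|lborel. \<bar>(norm (p k s))\<^sup>2 - (norm (q s))\<^sup>2\<bar>)"
      unfolding Bochner_Integration.integral_diff[OF pi qi, symmetric] by (rule integral_abs_bound)
    also have "\<dots> \<le> (LINT s|lborel. \<eta> * (norm (q s))\<^sup>2 + (1 + 1 / \<eta>) * (norm (p k s - q s))\<^sup>2)"
      using pi qi di pt[OF \<eta>] by (intro integral_mono) auto
    also have "\<dots> = \<eta> * (LINT s|lborel. (norm (q s))\<^sup>2) + (1 + 1 / \<eta>) * e k"
      using qi di by (simp add: e_def)
    finally show "\<bar>(LINT s|lborel. (norm (p k s))\<^sup>2) - (LINT s|lborel. (norm (q s))\<^sup>2)\<bar>
        \<le> \<eta> * (LINT s|lborel. (norm (q s))\<^sup>2) + (1 + 1 / \<eta>) * e k" .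
  qed auto
  assume sr: "s0 \<le> r0"
  have ind: "integrable lborel (\<lambda>s. indicator {s0<..r0} s *\<^sub>R g s)" if [measurable]: "g \<in> borel_measurable borel"
      and g: "integrable lborel (\<lambda>s. (norm (g s))\<^sup>2)" for g :: "real \<Rightarrow> 'b"
  proof (rule Bochner_Integration.integrable_bound)
    show "integrable lborel (\<lambda>s. indicator {s0<..r0} s + (norm (g s))\<^sup>2)"
      using g sr by (intro Bochner_Integration.integrable_add integrable_real_indicator) auto
    have "norm (g s) \<le> 1 + (norm (g s))\<^sup>2" for s
      using zero_le_power2[of "norm (g s) - 1"] norm_ge_zero[of "g s"] unfolding power2_diff power_one by linarith
    then show "AE s in lborel. norm (indicat_real {s0<..r0} s *\<^sub>R g s) \<le> norm (indicator {s0<..r0} s + (norm (g s))\<^sup>2)"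
      by (auto simp: indicator_def)
  qed measurable
  show "(\<lambda>k. LINT s|lborel. indicator {s0<..r0} s *\<^sub>R p k s) \<longlonglongrightarrow> (LINT s|lborel. indicator {s0<..r0} s *\<^sub>R q s)"
  proof (rule LIM_zero_cancel, rule tendsto_norm_zero_cancel, rule tendsto_zero_of_scaled_bound[OF e])
    fix \<eta> :: real and k assume \<eta>: "0 < \<eta>"
    have pt': "norm (indicator {s0<..r0} s *\<^sub>R p k s - indicator {s0<..r0} s *\<^sub>R q s) \<le> \<eta> * indicator {s0<..r0} s + 1 / \<eta> * (norm (p k s - q s))\<^sup>2" for s
    proof -
      have "0 \<le> (\<eta> - norm (p k s - q s))\<^sup>2 / \<eta>" using \<eta> by simp
      also have "\<dots> = \<eta> - 2 * norm (p k s - q s) + 1 / \<eta> * (norm (p k s - q s))\<^sup>2"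
        using \<eta> by (simp add: power2_diff field_simps power2_eq_square)
      finally have le: "2 * norm (p k s - q s) \<le> \<eta> + 1 / \<eta> * (norm (p k s - q s))\<^sup>2" by simp
      have "norm (p k s - q s) \<le> 2 * norm (p k s - q s)" by simp
      from this le have "norm (p k s - q s) \<le> \<eta> + 1 / \<eta> * (norm (p k s - q s))\<^sup>2" by (rule order_trans)
      then show ?thesis using \<eta> by (auto simp: indicator_def)
    qed
    have "norm ((LINT s|lborel. indicator {s0<..r0} s *\<^sub>R p k s) - (LINT s|lborel. indicator {s0<..r0} s *\<^sub>R q s))
        \<le> (LINT s|lborel. norm (indicator {s0<..r0} s *\<^sub>R p k s - indicator {s0<..r0} s *\<^sub>R q s))"
      unfolding Bochner_Integration.integral_diff[OF ind[OF pm pi] ind[OF qm qi], symmetric] by (rule integral_norm_bound)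
    also have "\<dots> \<le> (LINT s|lborel. \<eta> * indicator {s0<..r0} s + 1 / \<eta> * (norm (p k s - q s))\<^sup>2)"
      using ind[OF pm pi] ind[OF qm qi] di sr pt'
      by (intro integral_mono Bochner_Integration.integrable_add integrable_mult_right integrable_real_indicator integrable_norm Bochner_Integration.integrable_diff) auto
    also have "\<dots> = \<eta> * (r0 - s0) + 1 / \<eta> * e k"
      using di sr by (simp add: e_def)
    finally show "norm ((LINT s|lborel. indicator {s0<..r0} s *\<^sub>R p k s) - (LINT s|lborel. indicator {s0<..r0} s *\<^sub>R q s)) \<le> \<eta> * (r0 - s0) + 1 / \<eta> * e k" .
  qed (use sr in auto)
qed

lemma cm_density_increment:
  assumes g: "is_cm_density h g" and sr: "0 \<le> s" "s \<le> r" "r \<le> 1"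
  shows "integrable lborel (\<lambda>x. indicator {s<..r} x *\<^sub>R g x)"
    and "(LINT x|lborel. indicator {s<..r} x *\<^sub>R g x) = path_val h r - path_val h s"
proof -
  have int: "set_integrable lborel {0..1} g"
    using g by (intro set_integrable_of_square) (auto simp: is_cm_density_def)
  show "integrable lborel (\<lambda>x. indicator {s<..r} x *\<^sub>R g x)"
  proof -
    have "{s<..r} \<subseteq> {0..1}" using sr by auto
    from set_integrable_subset[OF int _ this] show ?thesis by (simp add: set_integrable_def)
  qed
  have i1: "integrable lborel (\<lambda>x. indicator {0..a} x *\<^sub>R g x)" if "a \<le> 1" for a
    using set_integrable_subset[OF int, of "{0..a}"] that by (simp add: set_integrable_def)
  have "(LINT x|lborel. indicator {s<..r} x *\<^sub>R g x) = (LINT x|lborel. indicator {0..r} x *\<^sub>R g x - indicator {0..s} x *\<^sub>R g x)"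
    using sr by (intro Bochner_Integration.integral_cong) (auto simp: indicator_def)
  also have "\<dots> = (LINT x:{0..r}|lborel. g x) - (LINT x:{0..s}|lborel. g x)"
    unfolding set_lebesgue_integral_def using sr by (intro Bochner_Integration.integral_diff i1) auto
  also have "\<dots> = path_val h r - path_val h s"
    using g sr by (simp add: is_cm_density_def)
  finally show "(LINT x|lborel. indicator {s<..r} x *\<^sub>R g x) = path_val h r - path_val h s" .
qed

text \<open>For densities of total mass one, almost sure convergence to a density of total mass one
  is convergence in L1, by Scheffe's lemma. Here it pays off that the Girsanov exponential has
  expectation one.\<close>

lemma (in prob_space) expectation_tendsto_Scheffe:
  fixes \<rho> :: "nat \<Rightarrow> 'a \<Rightarrow> real"
  assumes m [measurable]: "\<And>k. \<rho> k \<in> borel_measurable M" "r \<in> borel_measurable M" "\<And>k. h k \<in> borel_measurable M" "h' \<in> borel_measurable M"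
    and pos: "\<And>k w. 0 \<le> \<rho> k w" "\<And>w. 0 \<le> r w"
    and one: "\<And>k. (\<integral>\<^sup>+w. ennreal (\<rho> k w) \<partial>M) = 1" "(\<integral>\<^sup>+w. ennreal (r w) \<partial>M) = 1"
    and lim: "AE w in M. (\<lambda>k. \<rho> k w) \<longlonglongrightarrow> r w" "AE w in M. (\<lambda>k. h k w) \<longlonglongrightarrow> (h' w :: real)"
    and h: "\<And>k w. 0 \<le> h k w \<and> h k w \<le> 1" "\<And>w. 0 \<le> h' w \<and> h' w \<le> 1"
  shows "(\<lambda>k. expectation (\<lambda>w. \<rho> k w * h k w)) \<longlonglongrightarrow> expectation (\<lambda>w. r w * h' w)"
proof -
  have ik: "integrable M (\<rho> k)" for k using one(1)[of k] pos by (intro integrableI_nonneg) auto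
  have ir: "integrable M r" using one(2) pos by (intro integrableI_nonneg) auto
  have i1: "integrable M (\<lambda>w. \<rho> k w * h k w)" for k
    by (rule Bochner_Integration.integrable_bound[OF ik[of k]]) (use h pos in \<open>auto simp: abs_mult intro!: mult_left_le\<close>)
  have i2: "integrable M (\<lambda>w. r w * g w)" if [measurable]: "g \<in> borel_measurable M" and "\<And>w. 0 \<le> g w \<and> g w \<le> 1" for g
    by (rule Bochner_Integration.integrable_bound[OF ir]) (use that pos in \<open>auto simp: abs_mult intro!: mult_left_le\<close>)
  have "(\<lambda>k. \<integral>\<^sup>+w. ennreal (norm (\<rho> k w - r w)) \<partial>M) \<longlonglongrightarrow> 0"
    by (rule Scheffe_lemma2[OF m(1) ir lim(1)]) (use pos one in auto)
  moreover have "(\<integral>\<^sup>+w. ennreal (norm (\<rho> k w - r w)) \<partial>M) = ennreal (expectation (\<lambda>w. \<bar>\<rho> k w - r w\<bar>))" for k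
    using ik ir by (subst nn_integral_eq_integral) auto
  ultimately have "(\<lambda>k. ennreal (expectation (\<lambda>w. \<bar>\<rho> k w - r w\<bar>))) \<longlonglongrightarrow> ennreal 0" by simp
  then have L1: "(\<lambda>k. expectation (\<lambda>w. \<bar>\<rho> k w - r w\<bar>)) \<longlonglongrightarrow> 0"
    by (subst (asm) tendsto_ennreal_iff) auto
  have L2: "(\<lambda>k. expectation (\<lambda>w. r w * h k w)) \<longlonglongrightarrow> expectation (\<lambda>w. r w * h' w)"
  proof (rule integral_dominated_convergence[OF _ _ ir])
    show "AE w in M. (\<lambda>k. r w * h k w) \<longlonglongrightarrow> r w * h' w"
      using lim(2) by eventually_elim (intro tendsto_mult tendsto_const)
    show "AE w in M. norm (r w * h k w) \<le> r w" for k
      using h pos by (auto simp: abs_mult intro!: mult_left_le)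
  qed measurable
  have "(\<lambda>k. expectation (\<lambda>w. \<rho> k w * h k w) - expectation (\<lambda>w. r w * h k w)) \<longlonglongrightarrow> 0"
  proof (rule Lim_null_comparison[OF _ L1], intro always_eventually allI)
    fix k
    have "norm (expectation (\<lambda>w. \<rho> k w * h k w) - expectation (\<lambda>w. r w * h k w)) = \<bar>expectation (\<lambda>w. (\<rho> k w - r w) * h k w)\<bar>"
      using i1[of k] i2[OF m(3) h(1), of k] by (simp add: algebra_simps)
    also have "\<dots> \<le> expectation (\<lambda>w. \<bar>(\<rho> k w - r w) * h k w\<bar>)" by (rule integral_abs_bound)
    also have "\<dots> \<le> expectation (\<lambda>w. \<bar>\<rho> k w - r w\<bar>)"
    proof (rule integral_mono)
      have "integrable M (\<lambda>w. \<rho> k w * h k w - r w * h k w)" using i1[of k] i2[OF m(3) h(1), of k] by simp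
      then show "integrable M (\<lambda>w. \<bar>(\<rho> k w - r w) * h k w\<bar>)" by (simp add: left_diff_distrib)
      show "\<bar>(\<rho> k w - r w) * h k w\<bar> \<le> \<bar>\<rho> k w - r w\<bar>" for w
        using h(1)[of k w] by (auto simp: abs_mult intro!: mult_left_le)
    qed (use ik ir in auto)
    finally show "norm (expectation (\<lambda>w. \<rho> k w * h k w) - expectation (\<lambda>w. r w * h k w)) \<le> expectation (\<lambda>w. \<bar>\<rho> k w - r w\<bar>)" .
  qed
  from tendsto_add[OF this L2] show ?thesis by simp
qed

section \<open>Independence of the increments of the shifted Brownian motion under the tilted
  measure\<close>

locale girsanov_drift = path_brownian +
  fixes u :: "'a path \<Rightarrow> 'a path"
  assumes u2: "u \<in> Lpa 2 \<nu>" and exp_one: "(\<integral>w. girsanov_exp \<nu> \<beta> u w \<partial>completion \<nu>) = 1"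
begin

abbreviation "\<rho> \<equiv> girsanov_exp \<nu> \<beta> u"
abbreviation "Mt \<equiv> density M (\<lambda>w. ennreal (\<rho> w))"

lemma \<rho>_pos: "0 < \<rho> w"
  by (simp add: girsanov_exp_def)

lemma \<rho>_integrable: "integrable M \<rho>"
  using exp_one not_integrable_integral_eq by force

lemma \<rho>_measurable [measurable]: "\<rho> \<in> borel_measurable M"
  using \<rho>_integrable by auto

lemma nn_integral_\<rho>: "(\<integral>\<^sup>+w. ennreal (\<rho> w) \<partial>M) = 1"
  using exp_one \<rho>_pos by (subst nn_integral_eq_integral[OF \<rho>_integrable]) (auto intro: less_imp_le)

lemma prob_space_Mt: "prob_space Mt"
  by (rule prob_spaceI) (simp add: emeasure_density nn_integral_\<rho>)

lemma AE_Mt_iff: "(AE w in Mt. P w) \<longleftrightarrow> (AE w in M. P w)"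
  using \<rho>_pos by (simp add: AE_density ennreal_less_zero_iff)

lemma measurable_u: "u \<in> M \<rightarrow>\<^sub>M path_borel"
  using u2 by (simp add: Lpa_def)

text \<open>The increment of \<open>\<beta> + u\<close>, available before any map \<open>U\<close>
  is fixed.\<close>

definition Yincr :: "real \<Rightarrow> real \<Rightarrow> 'a path \<Rightarrow> real ^ 'a" where
  "Yincr s r w = incr s r w + (path_val (u w) r - path_val (u w) s)"

lemma measurable_Yincr [measurable]: "Yincr s r \<in> borel_measurable M"
  unfolding Yincr_def[abs_def] using measurable_path_val_M[OF measurable_u] by measurable

lemma simple_drift_measurable:
  assumes "simple m t \<xi>"
  shows "simple_drift m t \<xi> s r \<in> borel_measurable M"
proof -
  note [measurable (raw)] = measurable_time_comp[OF simple_process_measurable[OF assms]]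
  show ?thesis unfolding simple_drift_def[abs_def] by measurable
qed

lemma girsanov_approx:
  obtains m t \<xi> where "\<And>k. simple (m k) (t k) (\<xi> k)"
    "AE w in M. (\<lambda>k. simple_exp (m k) (t k) (\<xi> k) w) \<longlonglongrightarrow> \<rho> w"
    "\<And>s r. 0 \<le> s \<Longrightarrow> s \<le> r \<Longrightarrow> r \<le> 1 \<Longrightarrow>
      AE w in M. (\<lambda>k. incr s r w + simple_drift (m k) (t k) (\<xi> k) s r w) \<longlonglongrightarrow> Yincr s r w"
proof -
  obtain v where d: "L2_density u v" using Lpa2_density[OF u2] by blast
  obtain m t \<xi> where s: "\<And>k. simple (m k) (t k) (\<xi> k)"
    and l: "AE w in M. (\<lambda>k. sq_dist (simple_process (m k) (t k) (\<xi> k)) v w) \<longlonglongrightarrow> 0"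
    and I: "AE w in M. (\<lambda>k. sint (m k) (t k) (\<xi> k) w) \<longlonglongrightarrow> stoch_integral \<nu> \<beta> u w"
    and "integrable M (stoch_integral \<nu> \<beta> u)" "expectation (stoch_integral \<nu> \<beta> u) = 0"
    by (rule stoch_integral_approx[OF d]) blast
  have v: "(\<lambda>(w, s). v w s) \<in> borel_measurable (M \<Otimes>\<^sub>M lborel)" using d by (simp add: L2_density_def)
  have vm: "v w \<in> borel_measurable borel" for w
    by (rule measurable_time_comp[OF v, of "\<lambda>_. w"]) auto
  have pm: "simple_process (m k) (t k) (\<xi> k) w \<in> borel_measurable borel" for k w
    by (rule measurable_time_comp[OF simple_process_measurable[OF s], of "\<lambda>_. w"]) auto
  have p2: "(\<integral>\<^sup>+r. ennreal ((norm (simple_process (m k) (t k) (\<xi> k) w r))\<^sup>2) \<partial>lborel) < \<infinity>" for k w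
    by (simp add: nn_integral_simple_process_sq[OF s])
  have pe: "(LINT r|lborel. (norm (simple_process (m k) (t k) (\<xi> k) w r))\<^sup>2) = simple_energy (m k) (t k) (\<xi> k) w" for k w
    using has_bochner_integral_simple_comp[OF s[of k], of "\<lambda>x. (norm x)\<^sup>2" w]
    by (simp add: simple_energy_def has_bochner_integral_iff)
  have cn: "AE w in M. (\<integral>\<^sup>+r. ennreal ((norm (v w r))\<^sup>2) \<partial>lborel) = ennreal ((cm_norm (u w))\<^sup>2)"
    by (rule L2_density_cm_norm[OF d])
  have lim1: "AE w in M. (\<lambda>k. simple_exp (m k) (t k) (\<xi> k) w) \<longlonglongrightarrow> \<rho> w"
    using l I cn
  proof eventually_elim
    case (elim w)
    have q2: "(\<integral>\<^sup>+r. ennreal ((norm (v w r))\<^sup>2) \<partial>lborel) < \<infinity>" using elim(3) by simp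
    have "(LINT r|lborel. (norm (v w r))\<^sup>2) = (cm_norm (u w))\<^sup>2"
      using elim(3) vm[of w] by (subst (asm) nn_integral_eq_integrable) auto
    then have "(\<lambda>k. simple_energy (m k) (t k) (\<xi> k) w) \<longlonglongrightarrow> (cm_norm (u w))\<^sup>2"
      using square_integrable_limits(1)[OF pm vm p2 q2 elim(1)] by (simp add: pe)
    then show ?case
      unfolding simple_exp_def girsanov_exp_def by (intro tendsto_intros elim(2)) auto
  qed
  have lim2: "AE w in M. (\<lambda>k. incr s r w + simple_drift (m k) (t k) (\<xi> k) s r w) \<longlonglongrightarrow> Yincr s r w"
    if sr: "0 \<le> s" "s \<le> r" "r \<le> 1" for s r
  proof -
    have "AE w in M. is_cm_density (u w) (v w)" using d by (simp add: L2_density_def)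
    then show ?thesis
      using l cn
    proof eventually_elim
      case (elim w)
      have q2: "(\<integral>\<^sup>+r. ennreal ((norm (v w r))\<^sup>2) \<partial>lborel) < \<infinity>" using elim(3) by simp
      have "(\<lambda>k. simple_drift (m k) (t k) (\<xi> k) s r w) \<longlonglongrightarrow> path_val (u w) r - path_val (u w) s"
        using square_integrable_limits(2)[OF pm vm p2 q2 elim(2) sr(2)] cm_density_increment(2)[OF elim(1) sr]
        by (simp add: simple_drift_def)
      then show ?case unfolding Yincr_def by (intro tendsto_add tendsto_const)
    qed
  qed
  show ?thesis by (rule that[OF s lim1 lim2])
qed

text \<open>For each simple approximation the factorisation is \<open>simple_girsanov\<close>;
  continuity and boundedness of \<open>g\<close> let all three expectations pass to the
  limit.\<close>

lemma Yincr_factor_continuous: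
  fixes g :: "real ^ 'a \<Rightarrow> real"
  assumes sr: "0 \<le> s" "s < r" "r \<le> 1" and A: "A \<in> sets (F s)"
    and g: "continuous_on UNIV g" "\<And>x. 0 \<le> g x \<and> g x \<le> 1"
  shows "expectation (\<lambda>w. \<rho> w * (indicator A w * g (Yincr s r w)))
    = expectation (\<lambda>w. \<rho> w * g (Yincr s r w)) * expectation (\<lambda>w. \<rho> w * indicator A w)"
proof -
  have gm [measurable]: "g \<in> borel_measurable borel" by (rule borel_measurable_continuous_onI[OF g(1)])
  have AM [measurable]: "A \<in> events" using A subalgebra_F[of s] by (auto simp: subalgebra_def)
  obtain m t \<xi> where s: "\<And>k. simple (m k) (t k) (\<xi> k)"
    and l: "AE w in M. (\<lambda>k. simple_exp (m k) (t k) (\<xi> k) w) \<longlonglongrightarrow> \<rho> w"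
    and D: "\<And>s r. 0 \<le> s \<Longrightarrow> s \<le> r \<Longrightarrow> r \<le> 1 \<Longrightarrow>
      AE w in M. (\<lambda>k. incr s r w + simple_drift (m k) (t k) (\<xi> k) s r w) \<longlonglongrightarrow> Yincr s r w"
    by (rule girsanov_approx) blast
  define R where "R = (\<lambda>k. simple_exp (m k) (t k) (\<xi> k))"
  define Z where "Z = (\<lambda>k w. incr s r w + simple_drift (m k) (t k) (\<xi> k) s r w)"
  have [measurable]: "R k \<in> borel_measurable M" "Z k \<in> borel_measurable M" for k
    unfolding R_def Z_def using simple_exp_measurable[OF s] simple_drift_measurable[OF s] by auto
  have l': "AE w in M. (\<lambda>k. R k w) \<longlonglongrightarrow> \<rho> w" using l by (simp add: R_def)
  have R0: "0 \<le> R k w" for k w by (simp add: R_def)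
  have R1: "(\<integral>\<^sup>+w. ennreal (R k w) \<partial>M) = 1" for k unfolding R_def by (rule simple_exp_expectation[OF s])
  have Ri: "integrable M (R k)" for k using R0 R1[of k] by (intro integrableI_nonneg) auto
  have gZ: "AE w in M. (\<lambda>k. g (Z k w)) \<longlonglongrightarrow> g (Yincr s r w)"
    using D[OF sr(1) less_imp_le[OF sr(2)] sr(3)]
  proof eventually_elim
    case (elim w)
    have "isCont g (Yincr s r w)" using g(1) by (simp add: continuous_on_eq_continuous_at)
    then show ?case unfolding Z_def using elim by (rule isCont_tendsto_compose)
  qed
  have int: "integrable M (\<lambda>w. R k w * f w)" if [measurable]: "f \<in> borel_measurable M" and "\<And>w. 0 \<le> f w \<and> f w \<le> 1" for f k
    by (rule Bochner_Integration.integrable_bound[OF Ri[of k]]) (use that R0 in \<open>auto simp: abs_mult intro!: mult_left_le\<close>)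
  have factor: "expectation (\<lambda>w. R k w * (indicator A w * g (Z k w)))
    = expectation (\<lambda>w. R k w * g (Z k w)) * expectation (\<lambda>w. R k w * indicator A w)" for k
  proof -
    have nn: "(\<integral>\<^sup>+w. ennreal (R k w * f w) \<partial>M) = ennreal (expectation (\<lambda>w. R k w * f w))"
      if "f \<in> borel_measurable M" "\<And>w. 0 \<le> f w \<and> f w \<le> 1" for f
      using int[OF that] R0 that by (intro nn_integral_eq_integral) auto
    have "(\<integral>\<^sup>+w. indicator A w * ennreal (R k w) * ennreal (g (Z k w)) \<partial>M)
        = (\<integral>\<^sup>+w. ennreal (R k w) * ennreal (g (Z k w)) \<partial>M) * (\<integral>\<^sup>+w. indicator A w * ennreal (R k w) \<partial>M)"
      unfolding R_def Z_def by (rule simple_girsanov[OF s sr]) (use A in auto)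
    moreover have "indicator A w * ennreal (R k w) * ennreal (g (Z k w)) = ennreal (R k w * (indicator A w * g (Z k w)))"
      "ennreal (R k w) * ennreal (g (Z k w)) = ennreal (R k w * g (Z k w))"
      "indicator A w * ennreal (R k w) = ennreal (R k w * indicator A w)" for w
      using R0[of k w] g(2)[of "Z k w"] by (auto simp: indicator_def ennreal_mult)
    ultimately have "ennreal (expectation (\<lambda>w. R k w * (indicator A w * g (Z k w))))
        = ennreal (expectation (\<lambda>w. R k w * g (Z k w))) * ennreal (expectation (\<lambda>w. R k w * indicator A w))"
      using g(2) by (simp add: nn[symmetric] indicator_def)
    also have "\<dots> = ennreal (expectation (\<lambda>w. R k w * g (Z k w)) * expectation (\<lambda>w. R k w * indicator A w))"
      using R0 g(2) by (intro ennreal_mult[symmetric] Bochner_Integration.integral_nonneg) auto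
    finally show ?thesis
      using R0 g(2) by (subst (asm) ennreal_inj) (auto intro!: Bochner_Integration.integral_nonneg mult_nonneg_nonneg)
  qed
  have lim: "(\<lambda>k. expectation (\<lambda>w. R k w * h k w)) \<longlonglongrightarrow> expectation (\<lambda>w. \<rho> w * h' w)"
    if "\<And>k. h k \<in> borel_measurable M" "h' \<in> borel_measurable M" "AE w in M. (\<lambda>k. h k w) \<longlonglongrightarrow> h' w"
      "\<And>k w. 0 \<le> h k w \<and> h k w \<le> 1" "\<And>w. 0 \<le> h' w \<and> h' w \<le> 1" for h h'
    using that l' R0 R1 \<rho>_pos nn_integral_\<rho>
    by (intro expectation_tendsto_Scheffe) (auto intro: less_imp_le)
  have "(\<lambda>k. expectation (\<lambda>w. R k w * (indicator A w * g (Z k w)))) \<longlonglongrightarrow> expectation (\<lambda>w. \<rho> w * (indicator A w * g (Yincr s r w)))"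
    by (rule lim) (use gZ g(2) in \<open>auto simp: indicator_def elim!: eventually_mono intro!: tendsto_mult\<close>)
  moreover have "(\<lambda>k. expectation (\<lambda>w. R k w * g (Z k w)) * expectation (\<lambda>w. R k w * indicator A w))
    \<longlonglongrightarrow> expectation (\<lambda>w. \<rho> w * g (Yincr s r w)) * expectation (\<lambda>w. \<rho> w * indicator A w)"
    by (intro tendsto_mult lim) (use gZ g(2) in \<open>auto simp: indicator_def\<close>)
  ultimately show ?thesis unfolding factor by (rule LIMSEQ_unique)
qed

lemma Yincr_factor_open:
  assumes sr: "0 \<le> s" "s < r" "r \<le> 1" and A: "A \<in> sets (F s)" and U: "open (U :: (real ^ 'a) set)"
  shows "expectation (\<lambda>w. \<rho> w * (indicator A w * indicator U (Yincr s r w)))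
    = expectation (\<lambda>w. \<rho> w * indicator U (Yincr s r w)) * expectation (\<lambda>w. \<rho> w * indicator A w)"
\<comment> \<open>The distance \<open>infdist\<close> to the empty set is \<open>0\<close> by
  convention, so the whole space is treated apart.\<close>
proof (cases "U = UNIV")
  case True
  then show ?thesis using exp_one by simp
next
  case False
  have AM [measurable]: "A \<in> events" using A subalgebra_F[of s] by (auto simp: subalgebra_def)
  have Um [measurable]: "U \<in> sets borel" using U by simp
  \<comment> \<open>Continuous functions that increase to the indicator of the open set.\<close>
  define g where "g = (\<lambda>(k::nat) x. min 1 (real k * infdist x (- U)))"
  have g01: "0 \<le> g k x \<and> g k x \<le> 1" for k x by (simp add: g_def infdist_nonneg)
  have gc: "continuous_on UNIV (g k)" for k unfolding g_def by (intro continuous_intros)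
  have [measurable]: "g k \<in> borel_measurable borel" for k by (rule borel_measurable_continuous_onI[OF gc])
  have gl: "(\<lambda>k. g k x) \<longlonglongrightarrow> indicator U x" for x
  proof (cases "x \<in> U")
    case True
    have "infdist x (- U) \<noteq> 0" using False True U in_closed_iff_infdist_zero[of "- U" x] by (auto simp: closed_Compl)
    then have d: "0 < infdist x (- U)" using infdist_nonneg[of x "- U"] by linarith
    obtain K :: nat where K: "1 < real K * infdist x (- U)" using reals_Archimedean3[OF d] by blast
    have "g k x = 1" if "k \<ge> K" for k
    proof -
      have "real K * infdist x (- U) \<le> real k * infdist x (- U)" using that d by (intro mult_right_mono) auto
      then show ?thesis using K by (simp add: g_def)
    qed
    then have "\<forall>\<^sub>F k in sequentially. g k x = indicator U x" using True by (auto simp: eventually_sequentially)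
    then show ?thesis by (rule tendsto_eventually)
  next
    case False
    then show ?thesis by (simp add: g_def)
  qed
  have lim: "(\<lambda>k. expectation (\<lambda>w. \<rho> w * (f w * g k (Yincr s r w)))) \<longlonglongrightarrow> expectation (\<lambda>w. \<rho> w * (f w * indicator U (Yincr s r w)))"
    if [measurable]: "f \<in> borel_measurable M" and f: "\<And>w. 0 \<le> f w \<and> f w \<le> 1" for f
  proof (rule integral_dominated_convergence[OF _ _ \<rho>_integrable])
    show "AE w in M. (\<lambda>k. \<rho> w * (f w * g k (Yincr s r w))) \<longlonglongrightarrow> \<rho> w * (f w * indicator U (Yincr s r w))"
      by (intro AE_I2 tendsto_mult tendsto_const gl)
    show "AE w in M. norm (\<rho> w * (f w * g k (Yincr s r w))) \<le> \<rho> w" for k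
    proof (rule AE_I2)
      fix w
      have "f w * g k (Yincr s r w) \<le> 1 * 1" using f[of w] g01[of k "Yincr s r w"] by (intro mult_mono) auto
      then show "norm (\<rho> w * (f w * g k (Yincr s r w))) \<le> \<rho> w"
        using f[of w] g01[of k "Yincr s r w"] \<rho>_pos[of w] by (auto simp: abs_mult intro!: mult_left_le)
    qed
  qed measurable
  have "(\<lambda>k. expectation (\<lambda>w. \<rho> w * (indicator A w * g k (Yincr s r w)))) \<longlonglongrightarrow> expectation (\<lambda>w. \<rho> w * (indicator A w * indicator U (Yincr s r w)))"
    by (rule lim) (auto simp: indicator_def)
  moreover have "(\<lambda>k. expectation (\<lambda>w. \<rho> w * g k (Yincr s r w)) * expectation (\<lambda>w. \<rho> w * indicator A w))
    \<longlonglongrightarrow> expectation (\<lambda>w. \<rho> w * indicator U (Yincr s r w)) * expectation (\<lambda>w. \<rho> w * indicator A w)"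
    using lim[of "\<lambda>_. 1"] by (intro tendsto_mult tendsto_const) auto
  ultimately show ?thesis
    unfolding Yincr_factor_continuous[OF sr A gc g01] by (rule LIMSEQ_unique)
qed

lemma measure_Mt: "A \<in> events \<Longrightarrow> measure Mt A = expectation (\<lambda>w. \<rho> w * indicator A w)"
proof -
  assume A: "A \<in> events"
  have "emeasure Mt A = (\<integral>\<^sup>+w. ennreal (\<rho> w * indicator A w) \<partial>M)"
    using A \<rho>_pos by (simp add: emeasure_density indicator_def) (intro nn_integral_cong, simp add: less_imp_le)
  also have "\<dots> = ennreal (expectation (\<lambda>w. \<rho> w * indicator A w))"
    using A \<rho>_pos by (intro nn_integral_eq_integral integrable_real_mult_indicator \<rho>_integrable AE_I2 mult_nonneg_nonneg) (auto intro: less_imp_le)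
  finally show ?thesis
    using \<rho>_pos by (simp add: measure_def less_imp_le Bochner_Integration.integral_nonneg)
qed

text \<open>Preimages of open sets are closed under intersection and generate all events of the
  increment, so independence extends from them.\<close>

lemma Yincr_indep:
  assumes sr: "0 \<le> s" "s < r" "r \<le> 1" and A: "A \<in> sets (F s)" and B: "B \<in> sets borel"
  shows "measure Mt (A \<inter> (Yincr s r -` B \<inter> space Mt)) = measure Mt A * measure Mt (Yincr s r -` B \<inter> space Mt)"
proof -
  interpret Mt: prob_space Mt by (rule prob_space_Mt)
  have ev: "Yincr s r -` B \<in> events" if "B \<in> sets borel" for B
    using measurable_sets[OF measurable_Yincr that, of s r] by simp
  have AM: "A \<in> events" if "A \<in> sets (F s)" for A using that subalgebra_F[of s] by (auto simp: subalgebra_def)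
  have "Mt.indep_set (sigma_sets (space Mt) (sets (F s))) (sigma_sets (space Mt) {Yincr s r -` U | U. open U})"
  proof (rule Mt.indep_set_sigma_sets)
    show "Mt.indep_set (sets (F s)) {Yincr s r -` U | U. open U}"
    proof (rule Mt.indep_setI)
      fix A V assume A: "A \<in> sets (F s)" and "V \<in> {Yincr s r -` U | U. open U}"
      then obtain U where U: "open U" "V = Yincr s r -` U" by auto
      have V: "V \<in> events" unfolding U(2) using U(1) by (intro ev) auto
      have i: "indicator (A \<inter> V) w = (indicator A w * indicator U (Yincr s r w) :: real)"
        "indicator V w = (indicator U (Yincr s r w) :: real)" for w
        by (auto simp: U(2) indicator_def)
      show "Mt.prob (A \<inter> V) = Mt.prob A * Mt.prob V"
        using Yincr_factor_open[OF sr A U(1)] AM[OF A] V by (simp add: measure_Mt i sets.Int)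
    qed (use AM ev in auto)
    show "Int_stable (sets (F s))" by (auto simp: Int_stable_def)
    have "Yincr s r -` U \<inter> Yincr s r -` U' \<in> {Yincr s r -` U | U. open U}" if "open U" "open U'" for U U'
      using open_Int[OF that] by (intro CollectI exI[of _ "U \<inter> U'"]) auto
    then show "Int_stable {Yincr s r -` U | U. open U}" by (auto simp: Int_stable_def)
  qed
  moreover have "Yincr s r -` B \<in> sigma_sets (space Mt) {Yincr s r -` U | U. open U}"
  proof -
    have "Yincr s r \<in> sigma UNIV {Yincr s r -` U | U. open U} \<rightarrow>\<^sub>M borel"
      by (rule borel_measurableI) (auto simp: sets_measure_of)
    from measurable_sets[OF this B] show ?thesis by (simp add: sets_measure_of)
  qed
  moreover have "A \<in> sigma_sets (space Mt) (sets (F s))" using A by (rule sigma_sets.Basic)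
  ultimately show ?thesis using Mt.indep_setD by simp
qed

lemma Yincr_freezing:
  assumes sr: "0 \<le> s" "s < r" "r \<le> 1" and h: "case_prod h \<in> borel_measurable (F s \<Otimes>\<^sub>M borel)"
  shows "(\<integral>\<^sup>+w. h w (Yincr s r w) \<partial>Mt) = (\<integral>\<^sup>+w. (\<integral>\<^sup>+w'. h w (Yincr s r w') \<partial>Mt) \<partial>Mt)"
proof -
  interpret Mt: prob_space Mt by (rule prob_space_Mt)
  show ?thesis
    by (rule Mt.nn_integral_freezing[OF _ _ _ h])
      (use subalgebra_F[of s] Yincr_indep[OF sr] in \<open>auto simp: subalgebra_def\<close>)
qed

end

section \<open>The filtration generated by the transformed Brownian motion\<close>

locale girsanov_map = girsanov_drift +
  fixes U :: "'a path \<Rightarrow> 'a path"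
  assumes U_measurable: "U \<in> completion \<nu> \<rightarrow>\<^sub>M path_borel"
    and U_adapted: "adapted_process \<nu> U"
    and U_law: "law (density (completion \<nu>) (\<lambda>w. ennreal (girsanov_exp \<nu> \<beta> u w))) U = law \<nu> id"
    and U_beta: "AE w in \<nu>. \<beta> (U w) = \<beta> w + u w"
begin

lemma U_measurable_nu: "U \<in> M \<rightarrow>\<^sub>M \<nu>"
  using U_measurable by (simp add: measurable_def sets_nu)

lemma nn_integral_U:
  assumes f: "f \<in> borel_measurable \<nu>"
  shows "(\<integral>\<^sup>+w. f (U w) \<partial>Mt) = (\<integral>\<^sup>+w. f w \<partial>M)"
proof -
  have f': "f \<in> borel_measurable path_borel" using f by (simp add: measurable_def sets_nu)
  have "(\<integral>\<^sup>+w. f (U w) \<partial>Mt) = (\<integral>\<^sup>+w. f w \<partial>law Mt U)"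
    unfolding law_def using U_measurable f' by (subst nn_integral_distr) auto
  also have "\<dots> = (\<integral>\<^sup>+w. f w \<partial>law \<nu> id)" by (simp add: U_law)
  also have "\<dots> = (\<integral>\<^sup>+w. f w \<partial>\<nu>)"
    unfolding law_def using f' measurable_ident_sets[OF sets_nu]
    by (subst nn_integral_distr) (auto simp: id_def)
  finally show ?thesis by (simp add: nn_integral_completion)
qed

text \<open>\<open>U\<close> carries the tilted measure to \<open>\<nu>\<close>, and
  \<open>\<rho> > 0\<close> makes the tilted measure equivalent to \<open>M\<close>. This is what
  allows almost sure statements to be composed with \<open>U\<close>.\<close>

lemma U_null_vimage:
  assumes "N \<in> null_sets \<nu>"
  shows "U -` N \<in> null_sets M"
proof -
  have ev: "U -` N \<in> events" using measurable_sets[OF U_measurable_nu, of N] assms by auto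
  have "emeasure Mt (U -` N) = (\<integral>\<^sup>+w. indicator (U -` N) w \<partial>Mt)"
    using ev by simp
  also have "\<dots> = (\<integral>\<^sup>+w. indicator N (U w) \<partial>Mt)"
    by (intro nn_integral_cong) (simp add: indicator_def)
  also have "\<dots> = (\<integral>\<^sup>+w. indicator N w \<partial>M)" using assms by (intro nn_integral_U) auto
  also have "\<dots> = 0" using assms by (simp add: null_sets_def)
  finally have "U -` N \<in> null_sets Mt" using ev by (intro null_setsI) auto
  then have "AE w in Mt. w \<notin> U -` N" by (rule AE_not_in)
  then show ?thesis unfolding AE_Mt_iff using ev by (simp add: AE_iff_null vimage_def)
qed

lemma U_measurable_M: "U \<in> M \<rightarrow>\<^sub>M M"
proof (rule completion.measurable_completion2[OF U_measurable_nu])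
  show "null_sets \<nu> \<subseteq> null_sets (distr M \<nu> U)"
  proof
    fix N assume N: "N \<in> null_sets \<nu>"
    have "emeasure M (U -` N) = 0" using U_null_vimage[OF N] by (rule null_setsD1)
    then have "emeasure (distr M \<nu> U) N = 0"
      using N by (subst emeasure_distr[OF U_measurable_nu]) (auto simp del: emeasure_completion)
    then show "N \<in> null_sets (distr M \<nu> U)" using N by (intro null_setsI) auto
  qed
qed

lemma U_null_vimage_M: "N \<in> null_sets M \<Longrightarrow> U -` N \<in> null_sets M"
proof -
  assume "N \<in> null_sets M"
  then obtain N' where "N' \<in> null_sets \<nu>" "N \<subseteq> N'" by (auto simp: null_sets_completion_iff2)
  then show "U -` N \<in> null_sets M"
    by (intro null_sets_completion_subset[OF _ U_null_vimage[of N']]) auto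
qed

lemma AE_U: "AE w in M. P w \<Longrightarrow> AE w in M. P (U w)"
proof -
  assume "AE w in M. P w"
  then obtain N where "{w \<in> space M. \<not> P w} \<subseteq> N" "N \<in> null_sets M" by (auto simp: eventually_ae_filter)
  then show "AE w in M. P (U w)" by (intro AE_I'[OF U_null_vimage_M[of N]]) auto
qed

lemma U_measurable_F:
  assumes t: "t \<in> {0..1}"
  shows "U \<in> F t \<rightarrow>\<^sub>M F t"
proof (rule measurable_sigma_sets[OF sets_filtr])
  fix A assume "A \<in> {{w. path_val (id w) s \<in> A} |s A. s \<in> {0..t} \<and> A \<in> sets borel} \<union> null_sets M"
  then show "U -` A \<inter> space (F t) \<in> sets (F t)"
  proof
    assume "A \<in> {{w. path_val (id w) s \<in> A} |s A. s \<in> {0..t} \<and> A \<in> sets borel}"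
    then obtain s B where A: "A = {w. path_val w s \<in> B}" "s \<in> {0..t}" "B \<in> sets borel" by auto
    have "(\<lambda>w. path_val (U w) s) \<in> borel_measurable (F s)"
      using U_adapted A t by (auto simp: adapted_process_def)
    then have "(\<lambda>w. path_val (U w) s) \<in> borel_measurable (F t)"
      using A by (intro F_mono[of s t]) auto
    from measurable_sets[OF this A(3)] show ?thesis by (simp add: A vimage_def)
  qed (auto intro: null_sets_in_filtr U_null_vimage_M)
qed auto

text \<open>A composition rather than the almost surely equal \<open>\<beta> + u\<close>, so that
  the generating events of \<open>FY\<close> are literally preimages under \<open>U\<close>.\<close>

definition Y :: "'a path \<Rightarrow> 'a path" where
  "Y w = \<beta> (U w)"

abbreviation "FY \<equiv> filtr \<nu> Y"

lemma Y_AE: "AE w in M. \<forall>t. path_val (Y w) t = b w t + path_val (u w) t"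
  using U_beta by (auto simp: AE_completion_iff Y_def elim!: eventually_mono)

lemma Y_measurable: "Y \<in> M \<rightarrow>\<^sub>M path_borel"
  unfolding Y_def[abs_def] by (rule measurable_compose[OF U_measurable_M measurable_beta])

lemma Y_measurable_F:
  assumes "0 \<le> s" "s \<le> t" "t \<le> 1"
  shows "(\<lambda>w. path_val (Y w) s) \<in> borel_measurable (F t)"
  unfolding Y_def using assms by (intro measurable_compose[OF U_measurable_F b_measurable_F]) auto

lemma subalgebra_FY: "subalgebra M (FY t)"
  by (rule subalgebra_filtr[OF Y_measurable])

lemma FY_subset_F: "t \<in> {0..1} \<Longrightarrow> sets (FY t) \<subseteq> sets (F t)"
  by (intro sets_filtr_subset Y_measurable_F) (auto intro: null_sets_in_filtr)

lemma FY_measurable_F: "t \<in> {0..1} \<Longrightarrow> f \<in> FY t \<rightarrow>\<^sub>M N \<Longrightarrow> f \<in> F t \<rightarrow>\<^sub>M N"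
  using FY_subset_F[of t] unfolding measurable_def by auto

lemma Y_measurable_FY: "s \<in> {0..t} \<Longrightarrow> (\<lambda>w. path_val (Y w) s) \<in> borel_measurable (FY t)"
  by (rule path_val_measurable_filtr)

text \<open>Increments of \<open>Y\<close> after \<open>t\<close> are independent of
  \<open>F t\<close> under the tilted measure, so against anything known at \<open>t\<close> the
  future of \<open>Y\<close> acts through its value at \<open>t\<close> alone. The times are
  integrated out one by one, the most distant first; \<open>h\<close> averages over an independent
  copy of the increment.\<close>

lemma Y_markov:
  assumes g: "\<And>s. g s \<in> borel_measurable borel" and t: "0 \<le> t" "t \<le> 1"
    and ts: "sorted_wrt (<) (t # ts)" "set ts \<subseteq> {0..1}"
  shows "\<exists>h \<in> borel_measurable borel. \<forall>Z \<in> borel_measurable (F t).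
    (\<integral>\<^sup>+w. Z w * prod_list (map (\<lambda>s. g s (path_val (Y w) s)) ts) \<partial>Mt)
      = (\<integral>\<^sup>+w. Z w * (h (path_val (Y w) t) :: ennreal) \<partial>Mt)"
  using t ts
proof (induction ts arbitrary: t)
  case Nil
  show ?case by (intro bexI[of _ "\<lambda>_. 1"]) auto
next
  case (Cons s ts)
  have s: "0 \<le> s" "s \<le> 1" "t < s" using Cons.prems by auto
  interpret Mt: prob_space Mt by (rule prob_space_Mt)
  have sts: "sorted_wrt (<) (s # ts)" "set ts \<subseteq> {0..1}" using Cons.prems by auto
  obtain h' where h' [measurable]: "h' \<in> borel_measurable borel" and H: "\<And>Z. Z \<in> borel_measurable (F s) \<Longrightarrow>
    (\<integral>\<^sup>+w. Z w * prod_list (map (\<lambda>s. g s (path_val (Y w) s)) ts) \<partial>Mt) = (\<integral>\<^sup>+w. Z w * (h' (path_val (Y w) s)) \<partial>Mt)"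
    using Cons.IH[OF s(1,2) sts] by blast
  note [measurable] = g
  define G where "G = (\<lambda>y. g s y * h' y)"
  have [measurable]: "G \<in> borel_measurable borel" unfolding G_def by measurable
  define h where "h = (\<lambda>y. \<integral>\<^sup>+w. G (y + Yincr t s w) \<partial>Mt)"
  have h: "h \<in> borel_measurable borel" unfolding h_def by measurable
  show ?case
  proof (intro bexI[OF _ h] ballI)
    fix Z :: "'a path \<Rightarrow> ennreal" assume Z [measurable]: "Z \<in> borel_measurable (F t)"
    have Zs: "Z \<in> borel_measurable (F s)" using s by (intro F_mono[OF _ Z]) auto
    note [measurable] = Y_measurable_F[OF Cons.prems(1) order_refl Cons.prems(2)]
    have "(\<lambda>w. g s (path_val (Y w) s)) \<in> borel_measurable (F s)"
      using s by (intro measurable_compose[OF Y_measurable_F g]) auto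
    then have "(\<lambda>w. Z w * g s (path_val (Y w) s)) \<in> borel_measurable (F s)" using Zs by measurable
    from H[OF this] have "(\<integral>\<^sup>+w. Z w * prod_list (map (\<lambda>s. g s (path_val (Y w) s)) (s # ts)) \<partial>Mt)
        = (\<integral>\<^sup>+w. Z w * G (path_val (Y w) s) \<partial>Mt)"
      by (simp add: G_def mult.assoc)
    also have "\<dots> = (\<integral>\<^sup>+w. Z w * G (path_val (Y w) t + Yincr t s w) \<partial>Mt)"
    proof (intro nn_integral_cong_AE)
      have "AE w in M. Z w * G (path_val (Y w) s) = Z w * G (path_val (Y w) t + Yincr t s w)"
        using Y_AE by eventually_elim (simp add: Yincr_def incr_def)
      then show "AE w in Mt. Z w * G (path_val (Y w) s) = Z w * G (path_val (Y w) t + Yincr t s w)"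
        unfolding AE_Mt_iff .
    qed
    also have "\<dots> = (\<integral>\<^sup>+w. (\<integral>\<^sup>+w'. Z w * G (path_val (Y w) t + Yincr t s w') \<partial>Mt) \<partial>Mt)"
      using Cons.prems s by (intro Yincr_freezing[where h = "\<lambda>w x. Z w * G (path_val (Y w) t + x)"]) measurable
    also have "\<dots> = (\<integral>\<^sup>+w. Z w * h (path_val (Y w) t) \<partial>Mt)"
      unfolding h_def by (intro nn_integral_cong nn_integral_cmult) measurable
    finally show "(\<integral>\<^sup>+w. Z w * prod_list (map (\<lambda>s. g s (path_val (Y w) s)) (s # ts)) \<partial>Mt) = \<dots>" .
  qed
qed

definition Y_cylinder :: "real set \<Rightarrow> (real \<Rightarrow> (real ^ 'a) set) \<Rightarrow> 'a path set" where
  "Y_cylinder S A = {w. \<forall>s\<in>S. path_val (Y w) s \<in> A s}"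

text \<open>Cylinder events only up to null sets: \<open>FY\<close> contains all null sets, and this
  way they become members while the system stays closed under intersection.\<close>

definition Y_cylinder_sets :: "'a path set set" where
  "Y_cylinder_sets = {B \<in> sets (FY 1). \<exists>S A. finite S \<and> S \<subseteq> {0..1} \<and> (\<forall>s. A s \<in> sets borel) \<and>
      (AE w in M. w \<in> B \<longleftrightarrow> w \<in> Y_cylinder S A)}"

lemma Y_cylinder_sets_Int_stable: "Int_stable Y_cylinder_sets"
proof (rule Int_stableI)
  fix B B' assume B: "B \<in> Y_cylinder_sets" and B': "B' \<in> Y_cylinder_sets"
  obtain S A where S: "finite S" "S \<subseteq> {0..1}" "\<forall>s. A s \<in> sets borel" "AE w in M. w \<in> B \<longleftrightarrow> w \<in> Y_cylinder S A"
    using B by (auto simp: Y_cylinder_sets_def)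
  obtain S' A' where S': "finite S'" "S' \<subseteq> {0..1}" "\<forall>s. A' s \<in> sets borel" "AE w in M. w \<in> B' \<longleftrightarrow> w \<in> Y_cylinder S' A'"
    using B' by (auto simp: Y_cylinder_sets_def)
  let ?A = "\<lambda>s. (if s \<in> S then A s else UNIV) \<inter> (if s \<in> S' then A' s else UNIV)"
  have cyl: "Y_cylinder S A \<inter> Y_cylinder S' A' = Y_cylinder (S \<union> S') ?A"
    by (auto simp: Y_cylinder_def)
  have "AE w in M. w \<in> B \<inter> B' \<longleftrightarrow> w \<in> Y_cylinder (S \<union> S') ?A"
    unfolding cyl[symmetric] using S(4) S'(4) by eventually_elim blast
  then show "B \<inter> B' \<in> Y_cylinder_sets"
    unfolding Y_cylinder_sets_def using B B' S S'
    by (intro CollectI conjI exI[of _ "S \<union> S'"] exI[of _ ?A]) (auto simp: Y_cylinder_sets_def)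
qed

lemma sigma_sets_Y_cylinder_sets: "sigma_sets UNIV Y_cylinder_sets = sets (FY 1)"
proof
  show "sigma_sets UNIV Y_cylinder_sets \<subseteq> sets (FY 1)"
    using sets.sigma_sets_subset[of Y_cylinder_sets "FY 1"] by (auto simp: Y_cylinder_sets_def)
  show "sets (FY 1) \<subseteq> sigma_sets UNIV Y_cylinder_sets"
    unfolding sets_filtr
  proof (rule sigma_sets_mono', rule subsetI)
    fix B assume "B \<in> {{w. path_val (Y w) s \<in> A} |s A. s \<in> {0..1} \<and> A \<in> sets borel} \<union> null_sets M"
    then show "B \<in> Y_cylinder_sets"
    proof
      assume "B \<in> {{w. path_val (Y w) s \<in> A} |s A. s \<in> {0..1} \<and> A \<in> sets borel}"
      then obtain s A where B: "B = {w. path_val (Y w) s \<in> A}" "s \<in> {0..1}" "A \<in> sets borel" by auto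
      have "B \<in> sets (FY 1)" using measurable_sets[OF Y_measurable_FY[OF B(2)] B(3)] by (simp add: B(1) vimage_def)
      then show ?thesis
        unfolding Y_cylinder_sets_def using B
        by (intro CollectI conjI exI[of _ "{s}"] exI[of _ "\<lambda>_. A"]) (auto simp: Y_cylinder_def)
    next
      assume B: "B \<in> null_sets M"
      then have "AE w in M. w \<notin> B" by (rule AE_not_in)
      then have "AE w in M. w \<in> B \<longleftrightarrow> w \<in> Y_cylinder {0} (\<lambda>_. {})" by eventually_elim (simp add: Y_cylinder_def)
      then show ?thesis
        unfolding Y_cylinder_sets_def using B
        by (intro CollectI conjI exI[of _ "{0}"] exI[of _ "\<lambda>_. {}"]) (auto intro: null_sets_in_filtr)
    qed
  qed
qed

lemma FY_subalgebra_Mt: "subalgebra Mt (FY t)"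
  using subalgebra_FY[of t] by (simp add: subalgebra_def)

text \<open>The factors at times up to \<open>t\<close> are known in \<open>FY t\<close>, and those
  after \<open>t\<close> collapse by \<open>Y_markov\<close> to a function of \<open>Y\<close> at
  \<open>t\<close>. So the cylinder may be replaced by an \<open>FY t\<close>-measurable factor,
  against which \<open>Z\<close> and its conditional expectation integrate alike.\<close>

lemma nn_integral_Y_cylinder:
  assumes t: "t \<in> {0..1}" and Z: "Z \<in> borel_measurable (F t)"
    and S: "finite S" "S \<subseteq> {0..1}" "\<And>s. A s \<in> sets borel"
  shows "(\<integral>\<^sup>+w. Z w * indicator (Y_cylinder S A) w \<partial>Mt)
    = (\<integral>\<^sup>+w. nn_cond_exp Mt (FY t) Z w * indicator (Y_cylinder S A) w \<partial>Mt)"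
proof -
  interpret Mt: prob_space Mt by (rule prob_space_Mt)
  interpret fm: finite_measure_subalgebra Mt "FY t"
    by unfold_locales (rule FY_subalgebra_Mt)
  have ZM [measurable]: "Z \<in> borel_measurable Mt" using F_measurable_M[OF Z] by simp
  define ts where "ts = sorted_list_of_set {s \<in> S. t < s}"
  have ts: "sorted_wrt (<) (t # ts)" "set ts \<subseteq> {0..1}" "set ts = {s \<in> S. t < s}" "distinct ts"
    using S by (auto simp: ts_def)
  define past where "past = (\<lambda>w. \<Prod>s\<in>{s \<in> S. s \<le> t}. indicator (A s) (path_val (Y w) s) :: ennreal)"
  have past: "past \<in> borel_measurable (FY t)"
    unfolding past_def
  proof (rule borel_measurable_prod_ennreal)
    fix s assume "s \<in> {s \<in> S. s \<le> t}"
    then have [measurable]: "(\<lambda>w. path_val (Y w) s) \<in> borel_measurable (FY t)" using S by (intro Y_measurable_FY) auto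
    note [measurable] = S(3)[of s]
    show "(\<lambda>w. indicator (A s) (path_val (Y w) s) :: ennreal) \<in> borel_measurable (FY t)" by measurable
  qed
  have pastF: "past \<in> borel_measurable (F t)" by (rule FY_measurable_F[OF t past])
  have ind: "indicator (Y_cylinder S A) w = past w * prod_list (map (\<lambda>s. indicator (A s) (path_val (Y w) s)) ts)" for w
  proof -
    have fin: "finite {s \<in> S. s \<le> t}" "finite (set ts)" "{s \<in> S. s \<le> t} \<inter> set ts = {}"
      using S(1) unfolding ts(3) by auto
    have un: "{s \<in> S. s \<le> t} \<union> set ts = S" unfolding ts(3) by auto
    have "indicator (Y_cylinder S A) w = (\<Prod>s\<in>S. indicator (A s) (path_val (Y w) s) :: ennreal)"
      using S(1) by (auto simp: Y_cylinder_def indicator_def prod_zero_iff intro: prod.neutral)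
    also have "\<dots> = (\<Prod>s\<in>{s \<in> S. s \<le> t} \<union> set ts. indicator (A s) (path_val (Y w) s))"
      by (simp only: un)
    also have "(\<Prod>s\<in>{s \<in> S. s \<le> t} \<union> set ts. indicator (A s) (path_val (Y w) s) :: ennreal)
        = past w * (\<Prod>s\<in>set ts. indicator (A s) (path_val (Y w) s))"
      unfolding past_def by (rule prod.union_disjoint[OF fin])
    finally show ?thesis by (simp only: prod.distinct_set_conv_list[OF ts(4)])
  qed
  have "\<exists>h \<in> borel_measurable borel. \<forall>Z \<in> borel_measurable (F t).
    (\<integral>\<^sup>+w. Z w * prod_list (map (\<lambda>s. indicator (A s) (path_val (Y w) s)) ts) \<partial>Mt)
      = (\<integral>\<^sup>+w. Z w * (h (path_val (Y w) t) :: ennreal) \<partial>Mt)"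
    using t S(3) by (intro Y_markov ts) auto
  then obtain h where h: "h \<in> borel_measurable borel" and H: "\<And>Z. Z \<in> borel_measurable (F t) \<Longrightarrow>
    (\<integral>\<^sup>+w. Z w * prod_list (map (\<lambda>s. indicator (A s) (path_val (Y w) s)) ts) \<partial>Mt)
      = (\<integral>\<^sup>+w. Z w * (h (path_val (Y w) t) :: ennreal) \<partial>Mt)" by blast
  have red: "(\<integral>\<^sup>+w. X w * indicator (Y_cylinder S A) w \<partial>Mt) = (\<integral>\<^sup>+w. past w * h (path_val (Y w) t) * X w \<partial>Mt)"
    if X: "X \<in> borel_measurable (F t)" for X
    using H[OF borel_measurable_times_ennreal[OF X pastF]] unfolding ind by (simp add: ac_simps)
  have meas: "(\<lambda>w. past w * h (path_val (Y w) t)) \<in> borel_measurable (FY t)"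
    using past measurable_compose[OF Y_measurable_FY h] t by (intro borel_measurable_times_ennreal) auto
  have "(\<integral>\<^sup>+w. past w * h (path_val (Y w) t) * Z w \<partial>Mt)
      = (\<integral>\<^sup>+w. past w * h (path_val (Y w) t) * nn_cond_exp Mt (FY t) Z w \<partial>Mt)"
    by (rule fm.nn_cond_exp_intg[symmetric, OF meas ZM])
  then show ?thesis
    using red[OF Z] red[OF FY_measurable_F[OF t borel_measurable_nn_cond_exp]] by simp
qed

text \<open>Two finite measures that agree on the cylinders agree on \<open>FY 1\<close>. In other
  words, under the tilted measure the future of \<open>Y\<close> adds nothing to what its past tells
  about \<open>Z\<close>.\<close>

lemma nn_integral_FY:
  assumes t: "t \<in> {0..1}" and Z: "Z \<in> borel_measurable (F t)" and fin: "(\<integral>\<^sup>+w. Z w \<partial>Mt) < \<infinity>"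
    and f: "f \<in> borel_measurable (FY 1)"
  shows "(\<integral>\<^sup>+w. f w * Z w \<partial>Mt) = (\<integral>\<^sup>+w. f w * nn_cond_exp Mt (FY t) Z w \<partial>Mt)"
proof -
  have ZM: "Z \<in> borel_measurable Mt" using F_measurable_M[OF Z] by simp
  have ZtM: "nn_cond_exp Mt (FY t) Z \<in> borel_measurable Mt"
    using measurable_from_subalg[OF FY_subalgebra_Mt borel_measurable_nn_cond_exp] by blast
  have id: "(\<lambda>w. w) \<in> Mt \<rightarrow>\<^sub>M FY 1" by (rule measurable_from_subalg[OF FY_subalgebra_Mt[of 1]]) simp
  \<comment> \<open>The push-forward under the identity restricts the weighted measure to
    \<open>FY 1\<close>.\<close>
  define \<mu> where "\<mu> = (\<lambda>X. distr (density Mt X) (FY 1) (\<lambda>w. w))"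
  have em: "emeasure (\<mu> X) B = (\<integral>\<^sup>+w. X w * indicator B w \<partial>Mt)"
    if X: "X \<in> borel_measurable Mt" and B: "B \<in> sets (FY 1)" for X B
  proof -
    have "B \<in> sets Mt" using B FY_subalgebra_Mt[of 1] by (auto simp: subalgebra_def)
    then show ?thesis unfolding \<mu>_def using id X B by (simp add: emeasure_distr emeasure_density)
  qed
  have gen: "emeasure (\<mu> Z) B = emeasure (\<mu> (nn_cond_exp Mt (FY t) Z)) B" if "B \<in> Y_cylinder_sets" for B
  proof -
    obtain S A where B: "B \<in> sets (FY 1)" and S: "finite S" "S \<subseteq> {0..1}" "\<And>s. A s \<in> sets borel"
      and eq: "AE w in M. w \<in> B \<longleftrightarrow> w \<in> Y_cylinder S A" using \<open>B \<in> Y_cylinder_sets\<close> by (auto simp: Y_cylinder_sets_def)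
    have "(\<integral>\<^sup>+w. X w * indicator B w \<partial>Mt) = (\<integral>\<^sup>+w. X w * indicator (Y_cylinder S A) w \<partial>Mt)" for X
      by (intro nn_integral_cong_AE, unfold AE_Mt_iff) (use eq in \<open>auto elim!: eventually_mono simp: indicator_def\<close>)
    then show ?thesis
      unfolding em[OF ZM B] em[OF ZtM B] using nn_integral_Y_cylinder[OF t Z S] by simp
  qed
  have "\<mu> Z = \<mu> (nn_cond_exp Mt (FY t) Z)"
  proof (rule measure_eqI_generator_eq[OF Y_cylinder_sets_Int_stable _ gen])
    show "Y_cylinder_sets \<subseteq> Pow UNIV" by simp
    show "sets (\<mu> Z) = sigma_sets UNIV Y_cylinder_sets" "sets (\<mu> (nn_cond_exp Mt (FY t) Z)) = sigma_sets UNIV Y_cylinder_sets"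
      by (simp_all add: \<mu>_def sigma_sets_Y_cylinder_sets)
    have UN: "UNIV \<in> sets (FY 1)" using sets.top[of "FY 1"] by simp
    then show "range (\<lambda>i::nat. UNIV) \<subseteq> Y_cylinder_sets"
      unfolding Y_cylinder_sets_def by (auto intro!: exI[of _ "{}"] simp: Y_cylinder_def)
    show "emeasure (\<mu> Z) UNIV \<noteq> \<infinity>" for i :: nat using em[OF ZM UN] fin by simp
  qed auto
  moreover have "(\<integral>\<^sup>+w. f w \<partial>\<mu> X) = (\<integral>\<^sup>+w. f w * X w \<partial>Mt)" if X: "X \<in> borel_measurable Mt" for X
  proof -
    have fM: "f \<in> borel_measurable Mt" by (rule measurable_from_subalg[OF FY_subalgebra_Mt f])
    have "(\<integral>\<^sup>+w. f w \<partial>\<mu> X) = (\<integral>\<^sup>+w. f w \<partial>density Mt X)"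
      unfolding \<mu>_def using id f by (subst nn_integral_distr) auto
    also have "\<dots> = (\<integral>\<^sup>+w. f w * X w \<partial>Mt)"
      using X fM by (subst nn_integral_density) (auto simp: mult.commute)
    finally show ?thesis .
  qed
  ultimately show ?thesis using ZM ZtM by metis
qed

text \<open>Bayes' formula: \<open>M\<close> has density \<open>1 / \<rho>\<close> with respect to
  the tilted measure. Being \<open>FY 1\<close>-measurable, this density can be absorbed into the
  test function of \<open>nn_integral_FY\<close>. So conditioning on \<open>FY 1\<close> under
  \<open>M\<close> agrees with conditioning on \<open>FY t\<close> under the tilted measure, whose
  result is known at time \<open>t\<close>.\<close>

lemma immersion:
  assumes \<rho>Y: "\<rho> \<in> borel_measurable (FY 1)"
    and t: "t \<in> {0..1}" and Z: "Z \<in> borel_measurable (F t)" and bd: "\<And>w. \<bar>Z w\<bar> \<le> C"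
  shows "real_cond_exp M (FY 1) Z \<in> borel_measurable (F t)"
proof -
  interpret fm: finite_measure_subalgebra M "FY 1"
    by unfold_locales (rule subalgebra_FY)
  \<comment> \<open>Shifted to be nonnegative, as \<open>nn_cond_exp\<close> requires; the constant
    is subtracted again at the end.\<close>
  define X where "X = (\<lambda>w. Z w + C)"
  have X0: "0 \<le> X w" "X w \<le> 2 * C" for w using bd[of w] by (auto simp: X_def)
  have XF: "X \<in> borel_measurable (F t)" unfolding X_def using Z by measurable
  have XM [measurable]: "X \<in> borel_measurable M" by (rule F_measurable_M[OF XF])
  have Xi: "integrable M X" by (rule integrable_const_bound[of _ "2 * C"]) (use X0 in auto)
  have XF': "(\<lambda>w. ennreal (X w)) \<in> borel_measurable (F t)" using XF by measurable
  define Xt where "Xt = nn_cond_exp Mt (FY t) (\<lambda>w. ennreal (X w))"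
  have XtF: "Xt \<in> borel_measurable (F t)" unfolding Xt_def by (intro FY_measurable_F[OF t] borel_measurable_nn_cond_exp)
  have XtM [measurable]: "Xt \<in> borel_measurable M" by (rule F_measurable_M[OF XtF])
  have fin: "(\<integral>\<^sup>+w. ennreal (X w) \<partial>Mt) < \<infinity>"
  proof -
    interpret Mt: prob_space Mt by (rule prob_space_Mt)
    have "(\<integral>\<^sup>+w. ennreal (X w) \<partial>Mt) \<le> (\<integral>\<^sup>+w. ennreal (2 * C) \<partial>Mt)" using X0 by (intro nn_integral_mono ennreal_leI)
    also have "\<dots> < \<infinity>" using Mt.emeasure_space_1 by (simp add: ennreal_mult_less_top)
    finally show ?thesis .
  qed
  have toM: "(\<integral>\<^sup>+w. f w * x w \<partial>M) = (\<integral>\<^sup>+w. (f w * ennreal (1 / \<rho> w)) * x w \<partial>Mt)"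
    if [measurable]: "f \<in> borel_measurable M" "x \<in> borel_measurable M" for f x
  proof -
    have "ennreal (\<rho> w) * (f w * ennreal (1 / \<rho> w) * x w) = f w * x w" for w
    proof -
      have "ennreal (\<rho> w) * ennreal (1 / \<rho> w) = 1" using \<rho>_pos[of w] by (simp add: ennreal_mult[symmetric])
      then show ?thesis by (metis mult.assoc mult.commute mult.left_neutral)
    qed
    then show ?thesis by (subst nn_integral_density) auto
  qed
  have eq: "(\<integral>\<^sup>+w. indicator B w * ennreal (X w) \<partial>M) = (\<integral>\<^sup>+w. indicator B w * Xt w \<partial>M)" if B: "B \<in> sets (FY 1)" for B
  proof -
    have BM [measurable]: "B \<in> events" using B subalgebra_FY[of 1] by (auto simp: subalgebra_def)
    have "(\<lambda>w. indicator B w * ennreal (1 / \<rho> w)) \<in> borel_measurable (FY 1)" using \<rho>Y B by measurable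
    from nn_integral_FY[OF t XF' fin this] show ?thesis by (simp add: toM Xt_def[symmetric])
  qed
  have "UNIV \<in> sets (FY 1)" using sets.top[of "FY 1"] by simp
  from eq[OF this] have "(\<integral>\<^sup>+w. Xt w \<partial>M) = ennreal (expectation X)"
    using X0 by (simp add: nn_integral_eq_integral[OF Xi])
  then have fin': "(\<integral>\<^sup>+w. Xt w \<partial>M) < \<infinity>" by simp
  then have top: "AE w in M. Xt w \<noteq> \<infinity>" by (intro nn_integral_noteq_infinite) auto
  define X' where "X' = (\<lambda>w. enn2real (Xt w))"
  have X'F: "X' \<in> borel_measurable (F t)" unfolding X'_def using XtF by measurable
  have X'FY: "X' \<in> borel_measurable (FY 1)"
  proof -
    have "Xt \<in> borel_measurable (FY t)" unfolding Xt_def by simp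
    then have "Xt \<in> borel_measurable (FY 1)" using sets_filtr_mono[of t 1 \<nu> Y] t by (auto simp: measurable_def)
    then show ?thesis unfolding X'_def by measurable
  qed
  have XtX': "AE w in M. Xt w = ennreal (X' w)" using top by eventually_elim (simp add: X'_def less_top)
  have X'i: "integrable M X'"
  proof (rule integrableI_nonneg)
    have "(\<integral>\<^sup>+w. ennreal (X' w) \<partial>M) = (\<integral>\<^sup>+w. Xt w \<partial>M)" using XtX' by (intro nn_integral_cong_AE) (auto elim: eventually_mono)
    then show "(\<integral>\<^sup>+w. ennreal (X' w) \<partial>M) < \<infinity>" using fin' by simp
  qed (auto simp: X'_def)
  have ce: "AE w in M. real_cond_exp M (FY 1) X w = X' w"
  proof (rule fm.real_cond_exp_charact[OF _ Xi X'i X'FY])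
    fix B assume B: "B \<in> sets (FY 1)"
    have BM [measurable]: "B \<in> events" using B subalgebra_FY[of 1] by (auto simp: subalgebra_def)
    have nn: "ennreal (set_lebesgue_integral M B x) = (\<integral>\<^sup>+w. indicator B w * ennreal (x w) \<partial>M)"
      if "integrable M x" "\<And>w. 0 \<le> x w" for x
    proof -
      have "(\<integral>\<^sup>+w. indicator B w * ennreal (x w) \<partial>M) = (\<integral>\<^sup>+w. ennreal (indicator B w *\<^sub>R x w) \<partial>M)"
        by (intro nn_integral_cong) (auto simp: indicator_def)
      also have "\<dots> = ennreal (LINT w|M. indicator B w *\<^sub>R x w)"
        using that BM by (intro nn_integral_eq_integral integrable_mult_indicator) auto
      finally show ?thesis by (simp add: set_lebesgue_integral_def)
    qed
    have "(\<integral>\<^sup>+w. indicator B w * Xt w \<partial>M) = (\<integral>\<^sup>+w. indicator B w * ennreal (X' w) \<partial>M)"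
      using XtX' by (intro nn_integral_cong_AE) (auto elim: eventually_mono)
    then have "ennreal (set_lebesgue_integral M B X) = ennreal (set_lebesgue_integral M B X')"
      using eq[OF B] nn[OF Xi] nn[OF X'i] X0 by (simp add: X'_def)
    then show "set_lebesgue_integral M B X = set_lebesgue_integral M B X'"
      using X0 by (subst (asm) ennreal_inj) (auto simp: set_lebesgue_integral_def X'_def intro!: Bochner_Integration.integral_nonneg)
  qed
  have ZM [measurable]: "Z \<in> borel_measurable M" by (rule F_measurable_M[OF Z])
  have "AE w in M. real_cond_exp M (FY 1) Z w = X' w - C"
  proof -
    have 1: "AE w in M. real_cond_exp M (FY 1) (\<lambda>w. X w - C) w = real_cond_exp M (FY 1) X w - real_cond_exp M (FY 1) (\<lambda>_. C) w"
      using Xi by (intro fm.real_cond_exp_diff) auto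
    have 2: "AE w in M. real_cond_exp M (FY 1) (\<lambda>_. C) w = C" by (intro fm.real_cond_exp_F_meas) auto
    have 3: "(\<lambda>w. X w - C) = Z" by (simp add: X_def)
    show ?thesis using 1 2 ce unfolding 3 by eventually_elim simp
  qed
  then have eq': "AE w in M. X' w - C = real_cond_exp M (FY 1) Z w" by eventually_elim simp
  have "(\<lambda>w. X' w - C) \<in> borel_measurable (F t)" using X'F by measurable
  moreover have "real_cond_exp M (FY 1) Z \<in> borel_measurable M"
    by (rule measurable_from_subalg[OF subalgebra_FY borel_measurable_cond_exp])
  ultimately show ?thesis using eq' by (rule F_AE_cong)
qed

end

section \<open>Innovations\<close>

lemma borel_measurable_vec_component [measurable (raw)]:
  fixes f :: "'a \<Rightarrow> real ^ ('n::finite)"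
  assumes "f \<in> borel_measurable M"
  shows "(\<lambda>x. f x $ i) \<in> borel_measurable M"
  using borel_measurable_inner[OF assms borel_measurable_const, of "axis i 1"] by (simp add: inner_axis)

lemma integrable_mult_L2:
  fixes X Z :: "'a \<Rightarrow> real"
  assumes [measurable]: "X \<in> borel_measurable M" "Z \<in> borel_measurable M"
    and "integrable M (\<lambda>w. (X w)\<^sup>2)" "integrable M (\<lambda>w. (Z w)\<^sup>2)"
  shows "integrable M (\<lambda>w. X w * Z w)"
proof (rule Bochner_Integration.integrable_bound)
  show "integrable M (\<lambda>w. (X w)\<^sup>2 + (Z w)\<^sup>2)" using assms by simp
  have "\<bar>x * z\<bar> \<le> x\<^sup>2 + z\<^sup>2" for x z :: real
  proof -
    have "0 \<le> (\<bar>x\<bar> - \<bar>z\<bar>)\<^sup>2" by simp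
    then have "2 * \<bar>x * z\<bar> \<le> x\<^sup>2 + z\<^sup>2" by (simp add: power2_diff abs_mult)
    moreover have "0 \<le> \<bar>x * z\<bar>" by simp
    ultimately show ?thesis by linarith
  qed
  then show "AE w in M. norm (X w * Z w) \<le> norm ((X w)\<^sup>2 + (Z w)\<^sup>2)" by simp
qed measurable

text \<open>The contraction is the conditional Jensen inequality for the square.\<close>

lemma (in finite_measure_subalgebra) cond_exp_L2:
  assumes [measurable]: "X \<in> borel_measurable M" and X2: "integrable M (\<lambda>w. (X w)\<^sup>2)"
  shows "integrable M X" and "integrable M (\<lambda>w. (real_cond_exp M F X w)\<^sup>2)"
    and "(\<integral>w. (real_cond_exp M F X w)\<^sup>2 \<partial>M) \<le> (\<integral>w. (X w)\<^sup>2 \<partial>M)"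
proof -
  have X: "integrable M X"
  proof (rule Bochner_Integration.integrable_bound)
    show "integrable M (\<lambda>w. 1 + (X w)\<^sup>2)" using X2 by simp
    have "\<bar>x\<bar> \<le> 1 + x\<^sup>2" for x :: real
      using zero_le_power2[of "\<bar>x\<bar> - 1"] abs_ge_zero[of x] unfolding power2_diff power_one power2_abs by linarith
    then show "AE w in M. norm (X w) \<le> norm (1 + (X w)\<^sup>2)" by simp
  qed measurable
  then show "integrable M X" .
  have conv: "convex_on UNIV (\<lambda>x::real. x\<^sup>2)"
    by (rule convex_on_realI[where f' = "\<lambda>x. 2 * x"]) (auto intro!: derivative_eq_intros)
  have J: "AE w in M. (real_cond_exp M F X w)\<^sup>2 \<le> real_cond_exp M F (\<lambda>w. (X w)\<^sup>2) w"
    by (rule real_cond_exp_jensens_inequality(2)[OF X _ _ X2 conv, where a = 0 and b = 0]) auto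
  have c2: "integrable M (real_cond_exp M F (\<lambda>w. (X w)\<^sup>2))" by (rule real_cond_exp_int(1)[OF X2])
  show i: "integrable M (\<lambda>w. (real_cond_exp M F X w)\<^sup>2)"
    by (rule Bochner_Integration.integrable_bound[OF c2]) (use J in \<open>auto elim!: eventually_mono\<close>)
  have "(\<integral>w. (real_cond_exp M F X w)\<^sup>2 \<partial>M) \<le> (\<integral>w. real_cond_exp M F (\<lambda>w. (X w)\<^sup>2) w \<partial>M)"
    by (rule integral_mono_AE[OF i c2 J])
  then show "(\<integral>w. (real_cond_exp M F X w)\<^sup>2 \<partial>M) \<le> (\<integral>w. (X w)\<^sup>2 \<partial>M)"
    using real_cond_exp_int(2)[OF X2] by simp
qed

lemma integral_square_le:
  fixes f :: "real \<Rightarrow> real"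
  assumes [measurable]: "f \<in> borel_measurable borel" and f2: "integrable lborel (\<lambda>x. (f x)\<^sup>2)" and st: "s < t"
  shows "(LINT x|lborel. indicator {s<..t} x * f x)\<^sup>2 \<le> (t - s) * (LINT x|lborel. indicator {s<..t} x * (f x)\<^sup>2)"
proof -
  let ?I = "indicator {s<..t} :: real \<Rightarrow> real"
  have I: "integrable lborel ?I" using st by (intro integrable_real_indicator) auto
  have i2: "integrable lborel (\<lambda>x. ?I x * (f x)\<^sup>2)"
    by (rule Bochner_Integration.integrable_bound[OF f2]) (auto simp: indicator_def)
  have i1: "integrable lborel (\<lambda>x. ?I x * f x)"
  proof (rule Bochner_Integration.integrable_bound)
    show "integrable lborel (\<lambda>x. ?I x + ?I x * (f x)\<^sup>2)" using I i2 by simp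
    have "\<bar>x\<bar> \<le> 1 + x\<^sup>2" for x :: real
      using zero_le_power2[of "\<bar>x\<bar> - 1"] abs_ge_zero[of x] unfolding power2_diff power_one power2_abs by linarith
    then show "AE x in lborel. norm (?I x * f x) \<le> norm (?I x + ?I x * (f x)\<^sup>2)" by (auto simp: indicator_def)
  qed measurable
  define c where "c = (LINT x|lborel. ?I x * f x)"
  \<comment> \<open>\<open>m\<close> is the mean of \<open>f\<close> over the interval; the claim is
    the nonnegativity of the variance.\<close>
  define m where "m = c / (t - s)"
  have "0 \<le> (LINT x|lborel. ?I x * (f x - m)\<^sup>2)" by simp
  also have "(LINT x|lborel. ?I x * (f x - m)\<^sup>2) = (LINT x|lborel. ?I x * (f x)\<^sup>2 - 2 * m * (?I x * f x) + m\<^sup>2 * ?I x)"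
    by (intro Bochner_Integration.integral_cong) (auto simp: power2_diff algebra_simps)
  also have "\<dots> = (LINT x|lborel. ?I x * (f x)\<^sup>2) - 2 * m * c + m\<^sup>2 * (t - s)"
    using i1 i2 I st by (simp add: c_def)
  also have "\<dots> = (LINT x|lborel. ?I x * (f x)\<^sup>2) - c\<^sup>2 / (t - s)"
  proof -
    have "m * (t - s) = c" using st by (simp add: m_def)
    then have "m\<^sup>2 * (t - s) = m * c" "2 * m * c = 2 * (m * c)" "c\<^sup>2 / (t - s) = m * c"
      by (simp_all add: power2_eq_square mult.assoc m_def)
    then show ?thesis by simp
  qed
  finally show ?thesis using st by (simp add: c_def field_simps)
qed

context girsanov_map
begin

abbreviation "cexp \<equiv> real_cond_exp M (FY 1)"

sublocale FY1: finite_measure_subalgebra M "FY 1"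
  by unfold_locales (rule subalgebra_FY)

lemma incr_component_L2:
  assumes "0 \<le> s" "s < t" "t \<le> 1"
  shows "integrable M (\<lambda>w. (incr s t w $ i)\<^sup>2)"
proof -
  have "integrable M (\<lambda>w. (axis i 1 \<bullet> incr s t w)\<^sup>2)"
    by (rule incr_second_moment(1)[OF assms]) auto
  then show ?thesis by (simp add: inner_axis')
qed

lemma incr_component_orthogonal:
  assumes st: "0 \<le> s" "s < t" "t \<le> 1" and Z: "Z \<in> borel_measurable (F s)" and Z2: "integrable M (\<lambda>w. (Z w)\<^sup>2)"
  shows "expectation (\<lambda>w. Z w * incr s t w $ i) = 0"
proof -
  have "(\<lambda>w. Z w *\<^sub>R axis i (1::real)) \<in> borel_measurable (F s)" using Z by measurable
  from incr_mean_zero(2)[OF st this] Z2 show ?thesis by (simp add: inner_axis' power_mult_distrib)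
qed

text \<open>The part of the increment that \<open>Y\<close> leaves undetermined; the conditioning is
  on the whole path of \<open>Y\<close>, not on its past.\<close>

definition innov :: "'a \<Rightarrow> real \<Rightarrow> real \<Rightarrow> 'a path \<Rightarrow> real" where
  "innov i s t w = incr s t w $ i - cexp (\<lambda>w. incr s t w $ i) w"

text \<open>Conditional expectation is self-adjoint, so it may be moved from the later increment to
  the earlier one. There \<open>immersion\<close> keeps the result known at time \<open>t\<close>,
  and the later increment is orthogonal to everything known when it starts.\<close>

lemma cexp_incr_orthogonal:
  assumes \<rho>Y: "\<rho> \<in> borel_measurable (FY 1)" and st: "0 \<le> s" "s < t" "t \<le> s'" "s' < t'" "t' \<le> 1"
  shows "expectation (\<lambda>w. incr s t w $ i * cexp (\<lambda>w. incr s' t' w $ i) w) = 0"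
proof -
  let ?d = "\<lambda>w. incr s t w $ i" and ?d' = "\<lambda>w. incr s' t' w $ i"
  have dm [measurable]: "?d \<in> borel_measurable M" "?d' \<in> borel_measurable M" by measurable
  have d2: "integrable M (\<lambda>w. (?d w)\<^sup>2)" "integrable M (\<lambda>w. (?d' w)\<^sup>2)" using st by (auto intro: incr_component_L2)
  \<comment> \<open>\<open>immersion\<close> speaks of bounded variables, so the earlier increment
    is truncated; dominated convergence removes the truncation.\<close>
  define dk where "dk = (\<lambda>(k::nat) w. max (- real k) (min (real k) (?d w)))"
  have dkF: "dk k \<in> borel_measurable (F t)" for k
  proof -
    have [measurable]: "incr s t \<in> borel_measurable (F t)" using st by (intro measurable_incr_F) auto
    show ?thesis unfolding dk_def by measurable
  qed
  have [measurable]: "dk k \<in> borel_measurable M" for k by (rule F_measurable_M[OF dkF])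
  have dkb: "\<bar>dk k w\<bar> \<le> real k" "\<bar>dk k w\<bar> \<le> \<bar>?d w\<bar>" for k w by (auto simp: dk_def)
  have dk2: "integrable M (\<lambda>w. (dk k w)\<^sup>2)" for k
    by (rule Bochner_Integration.integrable_bound[OF d2(1)]) (use dkb(2)[of k] in \<open>auto simp: abs_le_square_iff\<close>)
  note c' = FY1.cond_exp_L2[OF dm(2) d2(2)]
  have zero: "expectation (\<lambda>w. dk k w * cexp ?d' w) = 0" for k
  proof -
    note ck = FY1.cond_exp_L2[OF _ dk2[of k]]
    have "cexp (dk k) \<in> borel_measurable (F t)"
      using st by (intro immersion[OF \<rho>Y _ dkF dkb(1)]) auto
    then have cF: "cexp (dk k) \<in> borel_measurable (F s')" using st by (intro F_mono[of t s']) auto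
    have "expectation (\<lambda>w. cexp ?d' w * dk k w) = expectation (\<lambda>w. cexp ?d' w * cexp (dk k) w)"
      using c' dk2 by (intro FY1.real_cond_exp_intg(2)[symmetric] integrable_mult_L2) auto
    also have "\<dots> = expectation (\<lambda>w. cexp (dk k) w * cexp ?d' w)" by (simp add: mult.commute)
    also have "\<dots> = expectation (\<lambda>w. cexp (dk k) w * ?d' w)"
      using ck d2 by (intro FY1.real_cond_exp_intg(2) integrable_mult_L2) auto
    also have "\<dots> = 0" using st ck by (intro incr_component_orthogonal cF) auto
    finally show ?thesis by (simp add: mult.commute)
  qed
  have "(\<lambda>k. expectation (\<lambda>w. dk k w * cexp ?d' w)) \<longlonglongrightarrow> expectation (\<lambda>w. ?d w * cexp ?d' w)"
  proof (rule integral_dominated_convergence[where w = "\<lambda>w. \<bar>?d w * cexp ?d' w\<bar>"])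
    show "integrable M (\<lambda>w. \<bar>?d w * cexp ?d' w\<bar>)" using d2 c' by (intro integrable_abs integrable_mult_L2) auto
    show "AE w in M. (\<lambda>k. dk k w * cexp ?d' w) \<longlonglongrightarrow> ?d w * cexp ?d' w"
    proof (intro AE_I2 tendsto_mult tendsto_const)
      fix w
      obtain K :: nat where K: "\<bar>?d w\<bar> \<le> real K" using real_arch_simple by blast
      have "dk k w = ?d w" if "k \<ge> K" for k
      proof -
        have "\<bar>?d w\<bar> \<le> real k" using K that by linarith
        then show ?thesis by (auto simp: dk_def)
      qed
      then have "\<forall>\<^sub>F k in sequentially. dk k w = ?d w" by (auto simp: eventually_sequentially)
      then show "(\<lambda>k. dk k w) \<longlonglongrightarrow> ?d w" by (rule tendsto_eventually)
    qed
    show "AE w in M. norm (dk k w * cexp ?d' w) \<le> \<bar>?d w * cexp ?d' w\<bar>" for k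
      using dkb(2)[of k] by (auto simp: abs_mult intro!: mult_right_mono)
  qed measurable
  then show ?thesis unfolding zero by (simp add: LIMSEQ_const_iff)
qed

lemma innov_measurable [measurable]: "innov i s t \<in> borel_measurable M"
  unfolding innov_def[abs_def] by measurable

lemma innov_L2:
  assumes "0 \<le> s" "s < t" "t \<le> 1"
  shows "integrable M (\<lambda>w. (innov i s t w)\<^sup>2)"
proof -
  have m: "(\<lambda>w. incr s t w $ i) \<in> borel_measurable M" by measurable
  note d2 = incr_component_L2[OF assms, of i]
  note c = FY1.cond_exp_L2[OF m d2]
  have "integrable M (\<lambda>w. (incr s t w $ i) * cexp (\<lambda>w. incr s t w $ i) w)" using d2 c by (intro integrable_mult_L2) auto
  then show ?thesis unfolding innov_def power2_diff using d2 c by (simp add: mult.assoc)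
qed

text \<open>Of the four products, the first vanishes by independence of the past, the second by
  \<open>cexp_incr_orthogonal\<close>, and the remaining two cancel because conditioning is an
  orthogonal projection.\<close>

lemma innov_orthogonal:
  assumes \<rho>Y: "\<rho> \<in> borel_measurable (FY 1)" and st: "0 \<le> s" "s < t" "t \<le> s'" "s' < t'" "t' \<le> 1"
  shows "expectation (\<lambda>w. innov i s t w * innov i s' t' w) = 0"
proof -
  let ?d = "\<lambda>w. incr s t w $ i" and ?d' = "\<lambda>w. incr s' t' w $ i"
  have m [measurable]: "?d \<in> borel_measurable M" "?d' \<in> borel_measurable M" by measurable
  have d2: "integrable M (\<lambda>w. (?d w)\<^sup>2)" "integrable M (\<lambda>w. (?d' w)\<^sup>2)" using st by (auto intro: incr_component_L2)
  note c = FY1.cond_exp_L2[OF m(1) d2(1)] and c' = FY1.cond_exp_L2[OF m(2) d2(2)]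
  have i: "integrable M (\<lambda>w. ?d w * ?d' w)" "integrable M (\<lambda>w. ?d w * cexp ?d' w)"
    "integrable M (\<lambda>w. cexp ?d w * ?d' w)" "integrable M (\<lambda>w. cexp ?d w * cexp ?d' w)"
    using d2 c c' by (auto intro!: integrable_mult_L2)
  have "?d \<in> borel_measurable (F s')"
  proof -
    have [measurable]: "incr s t \<in> borel_measurable (F s')" using st by (intro measurable_incr_F) auto
    show ?thesis by measurable
  qed
  then have 1: "expectation (\<lambda>w. ?d w * ?d' w) = 0" using st d2 by (intro incr_component_orthogonal) auto
  have 2: "expectation (\<lambda>w. ?d w * cexp ?d' w) = 0" by (rule cexp_incr_orthogonal[OF \<rho>Y st])
  have 3: "expectation (\<lambda>w. cexp ?d w * cexp ?d' w) = expectation (\<lambda>w. cexp ?d w * ?d' w)"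
    using i by (intro FY1.real_cond_exp_intg(2)) auto
  have "expectation (\<lambda>w. innov i s t w * innov i s' t' w)
    = expectation (\<lambda>w. (?d w * ?d' w - ?d w * cexp ?d' w) - (cexp ?d w * ?d' w - cexp ?d w * cexp ?d' w))"
    unfolding innov_def by (simp add: algebra_simps)
  also have "\<dots> = 0" using i by (simp add: 1 2 3)
  finally show ?thesis .
qed

end

section \<open>Bounding the innovations by the energy of the drift\<close>

context girsanov_map
begin

definition drift_energy :: "('a path \<Rightarrow> real \<Rightarrow> real ^ 'a) \<Rightarrow> real \<Rightarrow> real \<Rightarrow> ennreal" where
  "drift_energy v s t = (\<integral>\<^sup>+w. (\<integral>\<^sup>+x. indicator {s<..t} x * ennreal ((norm (v w x))\<^sup>2) \<partial>lborel) \<partial>M)"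

lemma drift_energy_add:
  assumes v: "(\<lambda>(w, s). v w s) \<in> borel_measurable (M \<Otimes>\<^sub>M lborel)" and st: "s \<le> t" "t \<le> r"
  shows "drift_energy v s r = drift_energy v s t + drift_energy v t r"
proof -
  note [measurable (raw)] = measurable_time_comp[OF v]
  have "indicator {s<..r} x * e = indicator {s<..t} x * e + indicator {t<..r} x * (e :: ennreal)" for x e
    using st by (auto simp: indicator_def)
  then show ?thesis unfolding drift_energy_def by (simp add: nn_integral_add)
qed

lemma drift_energy_finite:
  assumes "L2_density u v"
  shows "drift_energy v s t < \<infinity>"
proof -
  have "drift_energy v s t \<le> (\<integral>\<^sup>+w. (\<integral>\<^sup>+x. ennreal ((norm (v w x))\<^sup>2) \<partial>lborel) \<partial>M)"
    unfolding drift_energy_def by (intro nn_integral_mono) (auto simp: indicator_def)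
  also have "\<dots> < \<infinity>" using assms by (simp add: L2_density_def)
  finally show ?thesis .
qed

definition drift_incr :: "'a \<Rightarrow> real \<Rightarrow> real \<Rightarrow> 'a path \<Rightarrow> real" where
  "drift_incr i s t w = (path_val (u w) t - path_val (u w) s) $ i"

lemma drift_incr_measurable [measurable]: "drift_incr i s t \<in> borel_measurable M"
  unfolding drift_incr_def[abs_def]
  by (intro borel_measurable_vec_component borel_measurable_diff measurable_path_val_M measurable_u)

text \<open>Cauchy--Schwarz in time. The factor \<open>t - s\<close> beside the additive energy is
  what makes sums of squares vanish as the mesh tends to zero.\<close>

lemma drift_incr_L2:
  assumes d: "L2_density u v" and st: "0 \<le> s" "s < t" "t \<le> 1"
  shows "integrable M (\<lambda>w. (drift_incr i s t w)\<^sup>2)"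
    and "expectation (\<lambda>w. (drift_incr i s t w)\<^sup>2) \<le> (t - s) * enn2real (drift_energy v s t)"
proof -
  have v: "(\<lambda>(w, s). v w s) \<in> borel_measurable (M \<Otimes>\<^sub>M lborel)" using d by (simp add: L2_density_def)
  note [measurable (raw)] = measurable_time_comp[OF v]
  have vm [measurable]: "v w \<in> borel_measurable borel" for w by measurable
  have "AE w in M. is_cm_density (u w) (v w)" using d by (simp add: L2_density_def)
  moreover have "AE w in M. (\<integral>\<^sup>+s. ennreal ((norm (v w s))\<^sup>2) \<partial>lborel) = ennreal ((cm_norm (u w))\<^sup>2)"
    by (rule L2_density_cm_norm[OF d])
  ultimately have pt: "AE w in M. ennreal ((drift_incr i s t w)\<^sup>2)
      \<le> ennreal (t - s) * (\<integral>\<^sup>+x. indicator {s<..t} x * ennreal ((norm (v w x))\<^sup>2) \<partial>lborel)"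
  proof eventually_elim
    case (elim w)
    let ?I = "indicator {s<..t} :: real \<Rightarrow> real"
    have ni: "integrable lborel (\<lambda>x. (norm (v w x))\<^sup>2)"
      by (rule integrableI_bounded) (use elim(2) in auto)
    have comp: "(v w x $ i)\<^sup>2 \<le> (norm (v w x))\<^sup>2" for x
      using power_mono[OF component_le_norm_cart[of "v w x" i] abs_ge_zero, of 2] by simp
    have ii: "integrable lborel (\<lambda>x. (v w x $ i)\<^sup>2)"
      by (rule Bochner_Integration.integrable_bound[OF ni]) (use comp in auto)
    have cmi: "integrable lborel (\<lambda>x. ?I x *\<^sub>R v w x)" "(LINT x|lborel. ?I x *\<^sub>R v w x) = path_val (u w) t - path_val (u w) s"
      using cm_density_increment[OF elim(1), of s t] st by auto
    have "drift_incr i s t w = (LINT x|lborel. ?I x *\<^sub>R v w x) \<bullet> axis i 1"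
      unfolding drift_incr_def cmi(2)[symmetric] by (simp add: inner_axis)
    also have "\<dots> = (LINT x|lborel. (?I x *\<^sub>R v w x) \<bullet> axis i 1)" using cmi(1) by (intro integral_inner_left[symmetric])
    also have "\<dots> = (LINT x|lborel. ?I x * (v w x $ i))" by (simp add: inner_axis)
    finally have "(drift_incr i s t w)\<^sup>2 \<le> (t - s) * (LINT x|lborel. ?I x * (v w x $ i)\<^sup>2)"
      using integral_square_le[of "\<lambda>x. v w x $ i", OF _ ii st(2)] by simp
    also have "(LINT x|lborel. ?I x * (v w x $ i)\<^sup>2) \<le> (LINT x|lborel. ?I x * (norm (v w x))\<^sup>2)"
    proof (rule integral_mono)
      show "integrable lborel (\<lambda>x. ?I x * (v w x $ i)\<^sup>2)"
        by (rule Bochner_Integration.integrable_bound[OF ii]) (auto simp: indicator_def)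
      show "integrable lborel (\<lambda>x. ?I x * (norm (v w x))\<^sup>2)"
        by (rule Bochner_Integration.integrable_bound[OF ni]) (auto simp: indicator_def)
      show "?I x * (v w x $ i)\<^sup>2 \<le> ?I x * (norm (v w x))\<^sup>2" for x
        using comp[of x] by (auto simp: indicator_def)
    qed
    finally have "(drift_incr i s t w)\<^sup>2 \<le> (t - s) * (LINT x|lborel. ?I x * (norm (v w x))\<^sup>2)"
      using st by simp
    then have "ennreal ((drift_incr i s t w)\<^sup>2) \<le> ennreal ((t - s) * (LINT x|lborel. ?I x * (norm (v w x))\<^sup>2))" by (rule ennreal_leI)
    also have "\<dots> = ennreal (t - s) * ennreal (LINT x|lborel. ?I x * (norm (v w x))\<^sup>2)"
      using st by (simp add: ennreal_mult')
    also have "ennreal (LINT x|lborel. ?I x * (norm (v w x))\<^sup>2) = (\<integral>\<^sup>+x. ennreal (?I x * (norm (v w x))\<^sup>2) \<partial>lborel)"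
      by (intro nn_integral_eq_integral[symmetric] Bochner_Integration.integrable_bound[OF ni]) (auto simp: indicator_def)
    also have "\<dots> = (\<integral>\<^sup>+x. indicator {s<..t} x * ennreal ((norm (v w x))\<^sup>2) \<partial>lborel)"
      by (intro nn_integral_cong) (auto simp: indicator_def)
    finally show ?case .
  qed
  have "(\<integral>\<^sup>+w. ennreal ((drift_incr i s t w)\<^sup>2) \<partial>M)
      \<le> (\<integral>\<^sup>+w. ennreal (t - s) * (\<integral>\<^sup>+x. indicator {s<..t} x * ennreal ((norm (v w x))\<^sup>2) \<partial>lborel) \<partial>M)"
    by (rule nn_integral_mono_AE[OF pt])
  also have "\<dots> = ennreal (t - s) * drift_energy v s t"
    unfolding drift_energy_def by (rule nn_integral_cmult) measurable
  also have "\<dots> = ennreal ((t - s) * enn2real (drift_energy v s t))"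
    using drift_energy_finite[OF d, of s t] st by (simp add: ennreal_mult less_top)
  finally have le: "(\<integral>\<^sup>+w. ennreal ((drift_incr i s t w)\<^sup>2) \<partial>M) \<le> ennreal ((t - s) * enn2real (drift_energy v s t))" .
  show i: "integrable M (\<lambda>w. (drift_incr i s t w)\<^sup>2)"
    using le_less_trans[OF le ennreal_less_top] by (intro integrableI_bounded) auto
  show "expectation (\<lambda>w. (drift_incr i s t w)\<^sup>2) \<le> (t - s) * enn2real (drift_energy v s t)"
    using le st by (simp add: nn_integral_eq_integral[OF i] ennreal_le_iff)
qed

text \<open>The increments of \<open>Y\<close> are \<open>FY 1\<close>-measurable, so that innovations only see the drift.\<close>

lemma innov_drift_bound:
  assumes d: "L2_density u v" and st: "0 \<le> s" "s < t" "t \<le> 1"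
  shows "expectation (\<lambda>w. (innov i s t w)\<^sup>2) \<le> 4 * ((t - s) * enn2real (drift_energy v s t))"
proof -
  let ?d = "\<lambda>w. incr s t w $ i" and ?e = "drift_incr i s t"
  have dm: "?d \<in> borel_measurable M" by measurable
  note d2 = incr_component_L2[OF st, of i]
  note e2 = drift_incr_L2[OF d st, of i]
  note cd = FY1.cond_exp_L2[OF dm d2] and ce = FY1.cond_exp_L2[OF drift_incr_measurable e2(1)]
  define y where "y = (\<lambda>w. (path_val (Y w) t - path_val (Y w) s) $ i)"
  have yFY: "y \<in> borel_measurable (FY 1)"
    unfolding y_def using st by (intro borel_measurable_vec_component borel_measurable_diff Y_measurable_FY) auto
  have yM: "y \<in> borel_measurable M" by (rule measurable_from_subalg[OF subalgebra_FY yFY])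
  have y: "AE w in M. y w = ?d w + ?e w"
    using Y_AE by eventually_elim (simp add: y_def incr_def drift_incr_def)
  have yi: "integrable M y"
    by (rule integrable_cong_AE_imp[of M "\<lambda>w. ?d w + ?e w"]) (use cd(1) ce(1) yM y in \<open>auto elim: eventually_mono\<close>)
  have "AE w in M. cexp (\<lambda>w. y w - ?e w) w = cexp y w - cexp ?e w" by (rule FY1.real_cond_exp_diff[OF yi ce(1)])
  moreover have "AE w in M. cexp y w = y w" by (rule FY1.real_cond_exp_F_meas[OF yi yFY])
  moreover have "AE w in M. cexp ?d w = cexp (\<lambda>w. y w - ?e w) w"
  proof (rule FY1.real_cond_exp_cong)
    show "AE w in M. ?d w = y w - ?e w" using y by eventually_elim simp
  qed (use yM in auto)
  \<comment> \<open>The increment of \<open>\<beta>\<close> is that of \<open>Y\<close> minus that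
    of \<open>u\<close>. The \<open>Y\<close> part is unchanged by conditioning and cancels, which
    leaves the innovation of the drift with the opposite sign.\<close>
  ultimately have eq: "AE w in M. (innov i s t w)\<^sup>2 = (?e w - cexp ?e w)\<^sup>2"
    using y by eventually_elim (simp add: innov_def power2_commute)
  \<comment> \<open>Conditioning does not increase the second moment, so both squares on the right
    contribute alike; this is the origin of the constant \<open>4\<close>.\<close>
  have le: "AE w in M. (innov i s t w)\<^sup>2 \<le> 2 * (?e w)\<^sup>2 + 2 * (cexp ?e w)\<^sup>2"
    using eq
  proof eventually_elim
    case (elim w)
    show ?case using zero_le_power2[of "?e w + cexp ?e w"] unfolding elim power2_diff power2_sum by linarith
  qed
  have "expectation (\<lambda>w. (innov i s t w)\<^sup>2) \<le> expectation (\<lambda>w. 2 * (?e w)\<^sup>2 + 2 * (cexp ?e w)\<^sup>2)"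
    using le e2(1) ce(2) by (intro integral_mono_AE innov_L2 st) auto
  also have "\<dots> = 2 * expectation (\<lambda>w. (?e w)\<^sup>2) + 2 * expectation (\<lambda>w. (cexp ?e w)\<^sup>2)" using e2(1) ce(2) by simp
  also have "\<dots> \<le> 4 * expectation (\<lambda>w. (?e w)\<^sup>2)" using ce(3) by simp
  also have "\<dots> \<le> 4 * ((t - s) * enn2real (drift_energy v s t))" using e2(2) by simp
  finally show ?thesis .
qed

lemma innov_add:
  assumes "0 \<le> s" "s < t" "t < r" "r \<le> 1"
  shows "AE w in M. innov i s r w = innov i s t w + innov i t r w"
proof -
  have int: "integrable M (\<lambda>w. incr x y w $ i)" if "0 \<le> x" "x < y" "y \<le> 1" for x y
    by (rule FY1.cond_exp_L2(1)) (use incr_component_L2[OF that] in auto)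
  have "(\<lambda>w. incr s r w $ i) = (\<lambda>w. incr s t w $ i + incr t r w $ i)" by (simp add: incr_def)
  moreover have "AE w in M. cexp (\<lambda>w. incr s t w $ i + incr t r w $ i) w = cexp (\<lambda>w. incr s t w $ i) w + cexp (\<lambda>w. incr t r w $ i) w"
    using assms by (intro FY1.real_cond_exp_add int) auto
  ultimately show ?thesis unfolding innov_def by (auto elim!: eventually_mono simp: incr_def)
qed

text \<open>The innovations form a square integrable martingale of finite variation, hence they vanish.\<close>

lemma innov_zero:
  assumes \<rho>Y: "\<rho> \<in> borel_measurable (FY 1)" and T: "0 < T" "T \<le> 1"
  shows "AE w in M. innov i 0 T w = 0"
proof -
  obtain v where d: "L2_density u v" using Lpa2_density[OF u2] by blast
  have v: "(\<lambda>(w, s). v w s) \<in> borel_measurable (M \<Otimes>\<^sub>M lborel)" using d by (simp add: L2_density_def)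
  let ?p = "\<lambda>s t. enn2real (drift_energy v s t)"
  have p_add: "?p s r = ?p s t + ?p t r" if "s \<le> t" "t \<le> r" for s t r
    using drift_energy_add[OF v that] drift_energy_finite[OF d] by (simp add: enn2real_plus)
  have bound: "expectation (\<lambda>w. (innov i 0 T w)\<^sup>2) \<le> 4 * T * ?p 0 T * (1 / real (Suc m))" for m
  proof -
    \<comment> \<open>On a partition into \<open>Suc m\<close> equal cells the second moments add up
      by orthogonality. Each is at most \<open>4 * \<delta>\<close> times the energy of its cell, so
      the total is of order \<open>1 / Suc m\<close>.\<close>
    define \<delta> where "\<delta> = T / real (Suc m)"
    have \<delta>: "0 < \<delta>" "real (Suc m) * \<delta> = T" using T by (simp_all add: \<delta>_def del: of_nat_Suc)
    have le1: "real k * \<delta> \<le> 1" if "k \<le> Suc m" for k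
    proof -
      have "real k * \<delta> \<le> real (Suc m) * \<delta>" using that \<delta>(1) by (intro mult_right_mono) auto
      then show ?thesis using \<delta>(2) T by linarith
    qed
    have "expectation (\<lambda>w. (innov i 0 (real (Suc k) * \<delta>) w)\<^sup>2) \<le> 4 * (\<delta> * ?p 0 (real (Suc k) * \<delta>))" if "k \<le> m" for k
      using that
    proof (induction k)
      case 0
      then show ?case using innov_drift_bound[OF d, of 0 \<delta> i] \<delta> le1[of 1] by simp
    next
      case (Suc k)
      define a where "a = real (Suc k) * \<delta>"
      define c where "c = real (Suc (Suc k)) * \<delta>"
      have a: "0 < a" "a < c" "c \<le> 1" "c - a = \<delta>"
      proof -
        show "0 < a" using \<delta>(1) by (simp add: a_def del: of_nat_Suc)
        show "c - a = \<delta>" by (simp add: a_def c_def algebra_simps)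
        then show "a < c" using \<delta>(1) by linarith
        show "c \<le> 1" unfolding c_def using Suc.prems by (intro le1) simp
      qed
      have IH: "expectation (\<lambda>w. (innov i 0 a w)\<^sup>2) \<le> 4 * (\<delta> * ?p 0 a)" using Suc by (simp add: a_def)
      have n2: "integrable M (\<lambda>w. (innov i 0 a w)\<^sup>2)" "integrable M (\<lambda>w. (innov i a c w)\<^sup>2)"
        using a by (auto intro: innov_L2)
      have cr: "integrable M (\<lambda>w. innov i 0 a w * innov i a c w)" using n2 by (intro integrable_mult_L2) auto
      have "expectation (\<lambda>w. (innov i 0 c w)\<^sup>2)
          = expectation (\<lambda>w. (innov i 0 a w)\<^sup>2 + (innov i a c w)\<^sup>2 + 2 * (innov i 0 a w * innov i a c w))"
      proof (rule integral_cong_AE)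
        show "AE w in M. (innov i 0 c w)\<^sup>2 = (innov i 0 a w)\<^sup>2 + (innov i a c w)\<^sup>2 + 2 * (innov i 0 a w * innov i a c w)"
          using innov_add[of 0 a c i] a by (auto elim!: eventually_mono simp: power2_sum)
      qed measurable
      also have "\<dots> = expectation (\<lambda>w. (innov i 0 a w)\<^sup>2) + expectation (\<lambda>w. (innov i a c w)\<^sup>2)"
        using n2 cr innov_orthogonal[OF \<rho>Y, of 0 a a c i] a by simp
      also have "\<dots> \<le> 4 * (\<delta> * ?p 0 a) + 4 * (\<delta> * ?p a c)"
        using IH innov_drift_bound[OF d, of a c i] a by auto
      also have "\<dots> = 4 * (\<delta> * ?p 0 c)" using p_add[of 0 a c] a by (simp add: algebra_simps)
      finally show ?case by (simp add: c_def)
    qed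
    from this[of m] show ?thesis using \<delta>(2) by (simp add: \<delta>_def mult_ac del: of_nat_Suc)
  qed
  have "(\<lambda>m. 4 * T * ?p 0 T * (1 / real (Suc m))) \<longlonglongrightarrow> 4 * T * ?p 0 T * 0"
    by (intro tendsto_mult tendsto_const LIMSEQ_Suc[OF lim_1_over_n])
  then have "expectation (\<lambda>w. (innov i 0 T w)\<^sup>2) \<le> 4 * T * ?p 0 T * 0"
    using bound by (intro LIMSEQ_le_const) auto
  moreover have "0 \<le> expectation (\<lambda>w. (innov i 0 T w)\<^sup>2)" by simp
  ultimately have "expectation (\<lambda>w. (innov i 0 T w)\<^sup>2) = 0" by linarith
  then have "AE w in M. (innov i 0 T w)\<^sup>2 = 0"
    using innov_L2[of 0 T i] T by (subst (asm) integral_nonneg_eq_0_iff_AE) auto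
  then show ?thesis by simp
qed

section \<open>Recovering the original events from the transformed Brownian motion\<close>

lemma b_measurable_FY:
  assumes \<rho>Y: "\<rho> \<in> borel_measurable (FY 1)" and t: "t \<in> {0..1}"
  shows "(\<lambda>w. b w t) \<in> borel_measurable (FY 1)"
proof -
  have b0: "AE w in M. b w 0 = 0" using bm by (simp add: brownian_motion_def AE_completion_iff)
  have null: "null_sets M \<subseteq> sets (FY 1)" by (auto intro: null_sets_in_filtr)
  have "(\<lambda>w. b w t $ i) \<in> borel_measurable (FY 1)" for i
  proof -
    have bM: "(\<lambda>w. b w t $ i) \<in> borel_measurable M"
      by (intro borel_measurable_vec_component measurable_path_val_M measurable_beta)
    \<comment> \<open>A vanishing innovation says that the increment from \<open>0\<close> to
      \<open>t\<close> equals its conditional expectation given \<open>FY 1\<close>. At time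
      \<open>0\<close> there is no increment, and the initial value is used instead.\<close>
    obtain X where X: "X \<in> borel_measurable (FY 1)" "AE w in M. X w = b w t $ i"
    proof (cases "t = 0")
      case True
      show ?thesis by (rule that[of "\<lambda>_. 0"]) (use b0 True in \<open>auto elim!: eventually_mono\<close>)
    next
      case False
      then have "AE w in M. innov i 0 t w = 0" using t by (intro innov_zero[OF \<rho>Y]) auto
      then have "AE w in M. cexp (\<lambda>w. incr 0 t w $ i) w = b w t $ i"
        using b0 by eventually_elim (simp add: innov_def incr_def)
      then show ?thesis by (rule that[OF borel_measurable_cond_exp])
    qed
    show ?thesis by (rule measurable_AE_cong_complete[OF X(1) bM subalgebra_FY null X(2)])
  qed
  then show ?thesis
    by (subst borel_measurable_euclidean_space) (auto simp: Basis_vec_def inner_axis)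
qed

lemma sets_nu_F: "sets \<nu> \<subseteq> sets (F 1)"
proof -
  have "(\<lambda>w. path_val w t) \<in> borel_measurable (F 1)" for t
  proof (cases "t \<in> {0..1}")
    case True
    then show ?thesis using path_val_measurable_filtr[OF True, of id \<nu>] by simp
  next
    case False
    have "(\<lambda>w. path_val w t) = (\<lambda>w :: 'a path. 0)" using path_val False by auto
    then show ?thesis by simp
  qed
  then have id: "(\<lambda>w. w) \<in> F 1 \<rightarrow>\<^sub>M path_borel" by (rule measurable_path_borelI)
  show ?thesis using measurable_sets[OF id] by (auto simp: sets_nu)
qed

text \<open>\<open>\<beta>\<close> generates the completed filtration of the coordinates, so once
  its values are functions of \<open>Y\<close>, every event is one of \<open>Y\<close>.\<close>

lemma sets_nu_FY:
  assumes \<rho>Y: "\<rho> \<in> borel_measurable (FY 1)"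
  shows "sets \<nu> \<subseteq> sets (FY 1)"
proof -
  have "sets (F 1) = sets (filtr \<nu> \<beta> 1)" using filtr_eq[of 1] by simp
  also have "\<dots> \<subseteq> sets (FY 1)"
    by (intro sets_filtr_subset b_measurable_FY[OF \<rho>Y]) (auto intro: null_sets_in_filtr)
  finally show ?thesis using sets_nu_F by blast
qed

lemma completion_AE_eq:
  assumes "C \<in> sets M"
  shows "\<exists>C' \<in> sets \<nu>. AE w in M. w \<in> C \<longleftrightarrow> w \<in> C'"
proof (intro bexI)
  show "main_part \<nu> C \<in> sets \<nu>" using assms by auto
  have "AE w in M. w \<notin> null_part \<nu> C" using AE_notin_null_part[OF assms] by (simp add: AE_completion_iff)
  then show "AE w in M. w \<in> C \<longleftrightarrow> w \<in> main_part \<nu> C"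
    by eventually_elim (use main_part_null_part_Un[OF assms] in auto)
qed

text \<open>The generating events are preimages under \<open>U\<close> of events of
  \<open>\<beta>\<close>. These lie only in the completion; \<open>AE_U\<close> shows that
  exchanging them for events of \<open>\<nu>\<close> changes the preimage by a null set.\<close>

lemma FY_vimage:
  assumes "B \<in> sets (FY 1)"
  shows "\<exists>B' \<in> sets \<nu>. AE w in M. w \<in> B \<longleftrightarrow> U w \<in> B'"
  using assms unfolding sets_filtr
proof (induction rule: sigma_sets.induct)
  case (Basic B)
  then show ?case
  proof
    assume "B \<in> {{w. path_val (Y w) s \<in> A} |s A. s \<in> {0..1} \<and> A \<in> sets borel}"
    then obtain s A where B: "B = {w. path_val (Y w) s \<in> A}" "A \<in> sets borel" by auto
    have "{w. b w s \<in> A} \<in> sets M"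
      using measurable_sets[OF measurable_path_val_M[OF measurable_beta] B(2), of s] by (simp add: vimage_def)
    then obtain C where "C \<in> sets \<nu>" "AE w in M. w \<in> {w. b w s \<in> A} \<longleftrightarrow> w \<in> C" using completion_AE_eq by blast
    then show ?thesis using AE_U[of "\<lambda>w. w \<in> {w. b w s \<in> A} \<longleftrightarrow> w \<in> C"] by (auto simp: B(1) Y_def)
  next
    assume "B \<in> null_sets M"
    then have "AE w in M. w \<notin> B" by (rule AE_not_in)
    then show ?thesis by (intro bexI[of _ "{}"]) auto
  qed
next
  case Empty
  show ?case by (intro bexI[of _ "{}"]) auto
next
  case (Compl B)
  then obtain B' where B': "B' \<in> sets \<nu>" "AE w in M. w \<in> B \<longleftrightarrow> U w \<in> B'" by auto
  show ?case
  proof (intro bexI)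
    show "space \<nu> - B' \<in> sets \<nu>" using B'(1) by (rule sets.compl_sets)
    show "AE w in M. w \<in> UNIV - B \<longleftrightarrow> U w \<in> space \<nu> - B'" using B'(2) by eventually_elim simp
  qed
next
  case (Union B)
  then obtain B' where B': "\<And>k. B' k \<in> sets \<nu>" "\<And>k. AE w in M. w \<in> B k \<longleftrightarrow> U w \<in> B' k" by metis
  have all: "AE w in M. \<forall>k. w \<in> B k \<longleftrightarrow> U w \<in> B' k" unfolding AE_all_countable using B'(2) by blast
  show ?case
  proof (intro bexI)
    show "(\<Union>k. B' k) \<in> sets \<nu>" using B'(1) by auto
    show "AE w in M. w \<in> (\<Union>k. B k) \<longleftrightarrow> U w \<in> (\<Union>k. B' k)" using all by eventually_elim auto
  qed
qed

end

section \<open>Attainment of the infimum\<close>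

text \<open>Squaring \<open>1 + x / 2 \<le> exp (x / 2)\<close> leaves the surplus
  \<open>x\<^sup>2 / 4\<close> over \<open>1 + x\<close>, as long as the left side is nonnegative;
  otherwise \<open>1 + x\<close> is negative.\<close>

lemma exp_eq_one_plus_imp_zero:
  fixes x :: real
  assumes "exp x = 1 + x"
  shows "x = 0"
proof (rule ccontr)
  assume "x \<noteq> 0"
  have "1 + x < exp x"
  proof (cases "0 \<le> 1 + x / 2")
    case True
    have "exp x = (exp (x / 2))\<^sup>2" by (simp add: power2_eq_square exp_add[symmetric])
    moreover have "(1 + x / 2)\<^sup>2 \<le> (exp (x / 2))\<^sup>2" using True by (intro power_mono exp_ge_add_one_self)
    moreover have "(1 + x / 2)\<^sup>2 = 1 + x + x\<^sup>2 / 4" by (simp add: power2_eq_square field_simps)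
    moreover have "0 < x\<^sup>2" using \<open>x \<noteq> 0\<close> by simp
    ultimately show ?thesis by linarith
  next
    case False
    then have "1 + x < 0" by linarith
    also have "0 < exp x" by simp
    finally show ?thesis .
  qed
  then show False using assms by simp
qed

lemma ext_expectation_integrable:
  assumes "integrable M X"
  shows "ext_expectation M X = ereal (\<integral>w. X w \<partial>M)"
proof -
  have "(\<integral>\<^sup>+w. ennreal (X w) \<partial>M) < \<infinity>" "(\<integral>\<^sup>+w. ennreal (- X w) \<partial>M) < \<infinity>"
    using assms by (auto simp: real_integrable_def less_top)
  then have "enn2ereal (\<integral>\<^sup>+w. ennreal (X w) \<partial>M) = ereal (enn2real (\<integral>\<^sup>+w. ennreal (X w) \<partial>M))"
    "enn2ereal (\<integral>\<^sup>+w. ennreal (- X w) \<partial>M) = ereal (enn2real (\<integral>\<^sup>+w. ennreal (- X w) \<partial>M))"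
    by (metis enn2ereal_ennreal enn2real_nonneg ennreal_enn2real infinity_ennreal_def)+
  then show ?thesis
    unfolding ext_expectation_def real_lebesgue_integral_def[OF assms] by simp
qed

lemma ext_expectation_eq_real:
  assumes [measurable]: "X \<in> borel_measurable M" and eq: "ext_expectation M X = ereal a"
  shows "integrable M X" "(\<integral>w. X w \<partial>M) = a"
proof -
  \<comment> \<open>If either part were infinite, their difference in \<open>ereal\<close> would be
    infinite, also when both are, and could not be the real number \<open>a\<close>.\<close>
  have "(\<integral>\<^sup>+w. ennreal (X w) \<partial>M) \<noteq> \<infinity> \<and> (\<integral>\<^sup>+w. ennreal (- X w) \<partial>M) \<noteq> \<infinity>"
    using eq unfolding ext_expectation_def
    by (cases "\<integral>\<^sup>+w. ennreal (X w) \<partial>M"; cases "\<integral>\<^sup>+w. ennreal (- X w) \<partial>M") auto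
  then show i: "integrable M X" by (simp add: real_integrable_def)
  show "(\<integral>w. X w \<partial>M) = a" using ext_expectation_integrable[OF i] eq by simp
qed

section \<open>The density relation and left invertibility\<close>

context girsanov_map
begin

lemma nn_integral_U_completion:
  assumes f: "f \<in> borel_measurable M"
  shows "(\<integral>\<^sup>+w. f (U w) \<partial>Mt) = (\<integral>\<^sup>+w. f w \<partial>M)"
proof -
  obtain g where g: "g \<in> borel_measurable \<nu>" "AE w in \<nu>. f w = g w" using completion_ex_borel_measurable[OF f] by blast
  have eq: "AE w in M. f w = g w" using g(2) by (simp add: AE_completion_iff)
  have "(\<integral>\<^sup>+w. f (U w) \<partial>Mt) = (\<integral>\<^sup>+w. g (U w) \<partial>Mt)"
    using AE_U[OF eq] by (intro nn_integral_cong_AE) (simp add: AE_Mt_iff)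
  also have "\<dots> = (\<integral>\<^sup>+w. f w \<partial>M)"
    unfolding nn_integral_U[OF g(1)] using eq by (intro nn_integral_cong_AE) (auto elim: eventually_mono)
  finally show ?thesis .
qed

lemma nn_integral_\<rho>_U:
  assumes f [measurable]: "f \<in> borel_measurable M"
  shows "(\<integral>\<^sup>+w. ennreal (\<rho> w) * f (U w) \<partial>M) = (\<integral>\<^sup>+w. f w \<partial>M)"
proof -
  have [measurable]: "(\<lambda>w. f (U w)) \<in> borel_measurable M" by (rule measurable_compose[OF U_measurable_M f])
  show ?thesis unfolding nn_integral_U_completion[OF f, symmetric] by (simp add: nn_integral_density)
qed

lemma nn_integral_law:
  assumes "f \<in> borel_measurable path_borel"
  shows "(\<integral>\<^sup>+w. f w \<partial>law M U) = (\<integral>\<^sup>+w. f (U w) \<partial>M)"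
  unfolding law_def using assms U_measurable by (simp add: nn_integral_distr)

lemma sets_law: "sets (law M U) = sets \<nu>"
  by (simp add: law_def sets_nu)

lemma law_absolutely_continuous: "absolutely_continuous \<nu> (law M U)"
  unfolding absolutely_continuous_def
proof
  fix N assume N: "N \<in> null_sets \<nu>"
  have "emeasure (law M U) N = emeasure M (U -` N)"
    using N U_measurable by (simp add: law_def emeasure_distr sets_nu null_sets_def del: emeasure_completion)
  also have "\<dots> = 0" using U_null_vimage[OF N] by (rule null_setsD1)
  finally show "N \<in> null_sets (law M U)" using N by (intro null_setsI) (auto simp: sets_law)
qed

text \<open>In the following \<open>L\<close> plays the role of the density \<open>e\<^sup>-\<^sup>f / E[e\<^sup>-\<^sup>f]\<close>.\<close>

lemma RN_deriv_law:
  assumes L: "L \<in> borel_measurable M" and rel: "AE w in M. ennreal (\<rho> w) * L (U w) = 1"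
  shows "AE w in \<nu>. RN_deriv \<nu> (law M U) w = L w"
proof -
  interpret nu: prob_space \<nu> by (rule prob_nu)
  obtain g where g: "g \<in> borel_measurable \<nu>" "AE w in \<nu>. L w = g w" using completion_ex_borel_measurable[OF L] by blast
  have "density \<nu> g = law M U"
  proof (rule measure_eqI)
    show "sets (density \<nu> g) = sets (law M U)" by (simp add: sets_law)
    fix A assume "A \<in> sets (density \<nu> g)"
    then have A: "A \<in> sets \<nu>" by simp
    have ind: "(\<lambda>w. indicator A w :: ennreal) \<in> borel_measurable path_borel" using A by (simp add: sets_nu)
    have indM: "(\<lambda>w. indicator A w :: ennreal) \<in> borel_measurable M"
      by (rule borel_measurable_indicator[OF sets_completionI_sets[OF A]])
    have "emeasure (density \<nu> g) A = (\<integral>\<^sup>+w. g w * indicator A w \<partial>\<nu>)" using g A by (simp add: emeasure_density)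
    also have "\<dots> = (\<integral>\<^sup>+w. L w * indicator A w \<partial>\<nu>)" using g(2) by (intro nn_integral_cong_AE) (auto elim: eventually_mono)
    also have "\<dots> = (\<integral>\<^sup>+w. L w * indicator A w \<partial>M)" by (simp add: nn_integral_completion)
    also have "\<dots> = (\<integral>\<^sup>+w. ennreal (\<rho> w) * (L (U w) * indicator A (U w)) \<partial>M)"
      using L indM by (intro nn_integral_\<rho>_U[symmetric]) measurable
    also have "\<dots> = (\<integral>\<^sup>+w. indicator A (U w) \<partial>M)"
      using rel by (intro nn_integral_cong_AE) (auto elim!: eventually_mono simp: mult.assoc[symmetric])
    also have "\<dots> = emeasure (law M U) A"
      using A by (simp add: nn_integral_law[OF ind, symmetric] sets_law)
    finally show "emeasure (density \<nu> g) A = emeasure (law M U) A" .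
  qed
  from nu.RN_deriv_unique[OF g(1) this] have "AE w in \<nu>. g w = RN_deriv \<nu> (law M U) w" .
  then show ?thesis using g(2) by eventually_elim simp
qed

text \<open>An event of \<open>\<nu>\<close> belongs to \<open>filtr \<nu> \<beta> 1\<close>, and
  \<open>U\<close> pulls the generators of this filtration back to events of \<open>Y\<close> or to
  null sets. So the equality of the two filtrations makes \<open>U\<close> itself a function of
  \<open>Y\<close>.\<close>

lemma U_measurable_FY: "U \<in> FY 1 \<rightarrow>\<^sub>M \<nu>"
proof -
  have "U \<in> FY 1 \<rightarrow>\<^sub>M filtr \<nu> \<beta> 1"
  proof (rule measurable_sigma_sets[OF sets_filtr])
    fix A assume "A \<in> {{w. path_val (\<beta> w) s \<in> A} |s A. s \<in> {0..1} \<and> A \<in> sets borel} \<union> null_sets M"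
    then show "U -` A \<inter> space (FY 1) \<in> sets (FY 1)"
    proof
      assume "A \<in> {{w. path_val (\<beta> w) s \<in> A} |s A. s \<in> {0..1} \<and> A \<in> sets borel}"
      then obtain s B where A: "A = {w. path_val (\<beta> w) s \<in> B}" "s \<in> {0..1}" "B \<in> sets borel" by auto
      from measurable_sets[OF Y_measurable_FY[OF A(2)] A(3)] show ?thesis by (simp add: A(1) vimage_def Y_def)
    qed (auto intro: null_sets_in_filtr U_null_vimage_M)
  qed auto
  moreover have "sets \<nu> \<subseteq> sets (filtr \<nu> \<beta> 1)" using sets_nu_F filtr_eq[of 1] by simp
  ultimately show ?thesis by (auto simp: measurable_def)
qed

text \<open>The relation makes \<open>\<rho>\<close> the reciprocal of a function of
  \<open>U\<close>, hence \<open>FY 1\<close>-measurable. This is the hypothesis of the innovation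
  argument, after which every event is a preimage under \<open>U\<close> up to null sets.\<close>

lemma left_invertible_of_relation:
  assumes L: "L \<in> borel_measurable M" and rel: "AE w in M. ennreal (\<rho> w) * L (U w) = 1"
  shows "left_invertible \<nu> U"
proof -
  obtain g where g: "g \<in> borel_measurable \<nu>" "AE w in \<nu>. L w = g w" using completion_ex_borel_measurable[OF L] by blast
  have "AE w in M. L w = g w" using g(2) by (simp add: AE_completion_iff)
  from AE_U[OF this] rel have eq: "AE w in M. 1 / enn2real (g (U w)) = \<rho> w"
  proof eventually_elim
    case (elim w)
    then have "enn2real (ennreal (\<rho> w) * g (U w)) = 1" by simp
    then have "\<rho> w * enn2real (g (U w)) = 1" using \<rho>_pos[of w] by (simp add: enn2real_mult)
    then show ?case using \<rho>_pos[of w] by (metis less_numeral_extra(3) mult_zero_right nonzero_eq_divide_eq zero_neq_one)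
  qed
  have "(\<lambda>w. g (U w)) \<in> borel_measurable (FY 1)" by (rule measurable_compose[OF U_measurable_FY g(1)])
  then have "(\<lambda>w. 1 / enn2real (g (U w))) \<in> borel_measurable (FY 1)" by measurable
  then have \<rho>Y: "\<rho> \<in> borel_measurable (FY 1)"
    by (rule measurable_AE_cong_complete[OF _ \<rho>_measurable subalgebra_FY _ eq]) (auto intro: null_sets_in_filtr)
  have "\<exists>V \<in> path_borel \<rightarrow>\<^sub>M path_borel. AE w in M. V (U w) = w"
  proof (rule left_inverse_exists)
    fix A :: "'a path set" assume "A \<in> sets path_borel"
    then have "A \<in> sets (FY 1)" using sets_nu_FY[OF \<rho>Y] by (auto simp: sets_nu)
    from FY_vimage[OF this] show "\<exists>B \<in> sets path_borel. AE w in M. w \<in> A \<longleftrightarrow> U w \<in> B" by (simp add: sets_nu)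
  qed
  then obtain V where V: "V \<in> path_borel \<rightarrow>\<^sub>M path_borel" "AE w in M. V (U w) = w" by blast
  have "V \<in> \<nu> \<rightarrow>\<^sub>M path_borel" using V(1) by (simp add: measurable_def sets_nu)
  then have "V \<in> M \<rightarrow>\<^sub>M path_borel" by (rule measurable_completion)
  then show ?thesis
    unfolding left_invertible_def using U_measurable law_absolutely_continuous V(2) by (auto simp: AE_completion_iff)
qed

text \<open>The left inverse turns every event, up to null sets, into the preimage under
  \<open>U\<close> of some event \<open>C\<close>. On such events the change of variables with
  weight \<open>\<rho>\<close> and the density of the image measure give the same value, so the left
  side of the relation and \<open>1\<close> are densities of the same measure.\<close>

lemma relation_of_left_invertible:
  assumes L: "L \<in> borel_measurable M" and inv: "left_invertible \<nu> U"
    and RN: "AE w in \<nu>. RN_deriv \<nu> (law M U) w = L w"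
  shows "AE w in M. ennreal (\<rho> w) * L (U w) = 1"
proof -
  interpret nu: prob_space \<nu> by (rule prob_nu)
  obtain V where V: "V \<in> M \<rightarrow>\<^sub>M path_borel" "AE w in M. V (U w) = w"
    using inv by (auto simp: left_invertible_def AE_completion_iff)
  note [measurable] = L measurable_compose[OF U_measurable_M L]
  have dens: "density \<nu> (RN_deriv \<nu> (law M U)) = law M U"
    by (rule nu.density_RN_deriv[OF law_absolutely_continuous sets_law])
  have lawint: "(\<integral>\<^sup>+w. indicator C (U w) \<partial>M) = (\<integral>\<^sup>+w. L w * indicator C w \<partial>M)" if C: "C \<in> sets \<nu>" for C
  proof -
    have ind: "(\<lambda>w. indicator C w :: ennreal) \<in> borel_measurable path_borel" using C by (simp add: sets_nu)
    have "(\<integral>\<^sup>+w. indicator C (U w) \<partial>M) = (\<integral>\<^sup>+w. indicator C w \<partial>density \<nu> (RN_deriv \<nu> (law M U)))"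
      unfolding dens nn_integral_law[OF ind] ..
    also have "\<dots> = (\<integral>\<^sup>+w. RN_deriv \<nu> (law M U) w * indicator C w \<partial>\<nu>)"
      using C by (subst nn_integral_density) auto
    also have "\<dots> = (\<integral>\<^sup>+w. L w * indicator C w \<partial>\<nu>)"
      using RN by (intro nn_integral_cong_AE) (auto elim!: eventually_mono)
    finally show ?thesis by (simp add: nn_integral_completion)
  qed
  have "UNIV \<in> sets \<nu>" using sets.top[of \<nu>] by simp
  from lawint[OF this] have lint1: "(\<integral>\<^sup>+w. L w \<partial>M) = 1"
    using emeasure_space_1 by simp
  have "density M (\<lambda>w. ennreal (\<rho> w) * L (U w)) = density M (\<lambda>_. 1)"
  proof (rule measure_eqI)
    fix A assume "A \<in> sets (density M (\<lambda>w. ennreal (\<rho> w) * L (U w)))"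
    then have A: "A \<in> sets M" by simp
    obtain A' where A': "A' \<in> sets \<nu>" "AE w in M. w \<in> A \<longleftrightarrow> w \<in> A'" using completion_AE_eq[OF A] by blast
    have "V -` A' \<in> sets M" using measurable_sets[OF V(1), of A'] A' by (simp add: sets_nu)
    from completion_AE_eq[OF this] obtain C where C: "C \<in> sets \<nu>" "AE w in M. w \<in> V -` A' \<longleftrightarrow> w \<in> C" by blast
    have AC: "AE w in M. w \<in> A \<longleftrightarrow> U w \<in> C"
      using AE_U[OF C(2)] V(2) A'(2) by eventually_elim simp
    have indM [measurable]: "(\<lambda>w. indicator C w :: ennreal) \<in> borel_measurable M"
      by (rule borel_measurable_indicator[OF sets_completionI_sets[OF C(1)]])
    have "emeasure (density M (\<lambda>w. ennreal (\<rho> w) * L (U w))) A = (\<integral>\<^sup>+w. ennreal (\<rho> w) * L (U w) * indicator A w \<partial>M)"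
      using A by (simp add: emeasure_density)
    also have "\<dots> = (\<integral>\<^sup>+w. ennreal (\<rho> w) * (L (U w) * indicator C (U w)) \<partial>M)"
      using AC by (intro nn_integral_cong_AE) (auto elim!: eventually_mono simp: indicator_def mult.assoc)
    also have "\<dots> = (\<integral>\<^sup>+w. L w * indicator C w \<partial>M)"
      by (rule nn_integral_\<rho>_U) measurable
    also have "\<dots> = (\<integral>\<^sup>+w. indicator C (U w) \<partial>M)" by (rule lawint[OF C(1), symmetric])
    also have "\<dots> = (\<integral>\<^sup>+w. 1 * indicator A w \<partial>M)"
      using AC by (intro nn_integral_cong_AE) (auto elim!: eventually_mono simp: indicator_def)
    also have "\<dots> = emeasure (density M (\<lambda>_. 1)) A" using A by (simp add: emeasure_density)
    finally show "emeasure (density M (\<lambda>w. ennreal (\<rho> w) * L (U w))) A = emeasure (density M (\<lambda>_. 1)) A" .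
  qed simp
  moreover have "(\<integral>\<^sup>+w. ennreal (\<rho> w) * L (U w) \<partial>M) \<noteq> \<infinity>"
    unfolding nn_integral_\<rho>_U[OF L] lint1 by simp
  ultimately show ?thesis by (intro finite_density_unique[THEN iffD1]) auto
qed

lemma cost_attained_iff:
  assumes f [measurable]: "f \<in> borel_measurable M" and f_int: "integrable M (\<lambda>w. exp (- f w))"
  defines "Z \<equiv> expectation (\<lambda>w. exp (- f w))"
  shows "cost \<nu> f U u = ereal (- ln Z) \<longleftrightarrow> (AE w in M. ennreal (\<rho> w) * ennreal (exp (- f (U w)) / Z) = 1)"
proof -
  have Z: "0 < Z"
  proof -
    have "Z \<noteq> 0"
    proof
      assume "Z = 0"
      then have "AE w in M. exp (- f w) = 0" using f_int unfolding Z_def by (subst (asm) integral_nonneg_eq_0_iff_AE) auto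
      then have "AE w in M. False" by eventually_elim simp
      then show False using AE_False by blast
    qed
    moreover have "0 \<le> Z" unfolding Z_def by (intro Bochner_Integration.integral_nonneg) simp
    ultimately show ?thesis by simp
  qed
  obtain v where d: "L2_density u v" using Lpa2_density[OF u2] by blast
  define X where "X = stoch_integral \<nu> \<beta> u"
  have X: "integrable M X" "expectation X = 0" using stoch_integral_approx[OF d] unfolding X_def by blast+
  have c2: "integrable M (\<lambda>w. (cm_norm (u w))\<^sup>2)" by (rule Lpa2_integrable[OF u2])
  have fU [measurable]: "(\<lambda>w. f (U w)) \<in> borel_measurable M" by (rule measurable_compose[OF U_measurable_M f])
  define K where "K = (\<lambda>w. f (U w) + (cm_norm (u w))\<^sup>2 / 2)"
  have [measurable]: "K \<in> borel_measurable M" unfolding K_def using c2 by measurable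
  have cost: "cost \<nu> f U u = ext_expectation M K" by (simp add: cost_def K_def)
  define g where "g = (\<lambda>w. - K w - X w - ln Z)"
  have rel: "\<rho> w * (exp (- f (U w)) / Z) = exp (g w)" for w
  proof -
    have "\<rho> w * (exp (- f (U w)) / Z) = exp (- X w - (cm_norm (u w))\<^sup>2 / 2) * (exp (- f (U w)) / exp (ln Z))"
      using Z by (simp add: X_def girsanov_exp_def)
    also have "\<dots> = exp (g w)"
      unfolding exp_diff[symmetric] exp_add[symmetric] by (simp add: g_def K_def algebra_simps)
    finally show ?thesis .
  qed
  have one_iff: "ennreal (\<rho> w) * ennreal (exp (- f (U w)) / Z) = 1 \<longleftrightarrow> g w = 0" for w
  proof -
    have "ennreal (\<rho> w) * ennreal (exp (- f (U w)) / Z) = ennreal (exp (g w))"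
      using Z \<rho>_pos[of w] by (simp add: ennreal_mult[symmetric] rel[symmetric])
    then show ?thesis by simp
  qed
  show ?thesis
    unfolding one_iff
  proof
    assume "AE w in M. g w = 0"
    \<comment> \<open>The cost is not known to be finite here; integrability of \<open>K\<close> is
      inferred from the integrable variable it equals.\<close>
    then have K: "AE w in M. - X w - ln Z = K w" by eventually_elim (simp add: g_def)
    have Xi: "integrable M (\<lambda>w. - X w - ln Z)" using X(1) by simp
    have Ki: "integrable M K" by (rule integrable_cong_AE_imp[OF Xi]) (use K in \<open>auto elim: eventually_mono\<close>)
    have "expectation K = expectation (\<lambda>w. - X w - ln Z)"
      by (rule integral_cong_AE) (use K X(1) in \<open>auto elim: eventually_mono\<close>)
    also have "\<dots> = - ln Z" using X by simp
    finally show "cost \<nu> f U u = ereal (- ln Z)" unfolding cost ext_expectation_integrable[OF Ki] by simp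
  next
    assume "cost \<nu> f U u = ereal (- ln Z)"
    \<comment> \<open>A real value of the extended expectation forces \<open>K\<close> to be
      integrable, so that \<open>g\<close> is integrable with mean zero.\<close>
    then have K: "integrable M K" "expectation K = - ln Z"
      unfolding cost by (auto dest: ext_expectation_eq_real[rotated])
    have gi: "integrable M g" unfolding g_def using K X by simp
    have g0: "expectation g = 0" unfolding g_def using K X by simp
    have [measurable]: "g \<in> borel_measurable M" using gi by simp
    have "(\<integral>\<^sup>+w. ennreal (exp (g w)) \<partial>M) = (\<integral>\<^sup>+w. ennreal (\<rho> w) * ennreal (exp (- f (U w)) / Z) \<partial>M)"
      using Z \<rho>_pos by (intro nn_integral_cong) (simp add: ennreal_mult[symmetric] rel[symmetric] less_imp_le)
    also have "\<dots> = (\<integral>\<^sup>+w. ennreal (exp (- f w) / Z) \<partial>M)"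
      by (rule nn_integral_\<rho>_U[where f = "\<lambda>w. ennreal (exp (- f w) / Z)"]) measurable
    also have "\<dots> = ennreal (expectation (\<lambda>w. exp (- f w) / Z))"
      using f_int Z by (intro nn_integral_eq_integral) auto
    also have "\<dots> = ennreal 1" using Z f_int by (simp add: Z_def[symmetric])
    finally have nn: "(\<integral>\<^sup>+w. ennreal (exp (g w)) \<partial>M) = ennreal 1" .
    have e: "integrable M (\<lambda>w. exp (g w))" "expectation (\<lambda>w. exp (g w)) = 1"
      using nn by (subst (asm) nn_integral_eq_integrable; simp)+
    define h where "h = (\<lambda>w. exp (g w) - 1 - g w)"
    have hi: "integrable M h" unfolding h_def using e gi by simp
    have "expectation h = 0" unfolding h_def using e gi g0 by simp
    moreover have "0 \<le> h w" for w using exp_ge_add_one_self[of "g w"] unfolding h_def by linarith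
    ultimately have "AE w in M. h w = 0" using hi by (subst (asm) integral_nonneg_eq_0_iff_AE) auto
    then show "AE w in M. g w = 0"
    proof eventually_elim
      case (elim w)
      then show ?case by (intro exp_eq_one_plus_imp_zero) (simp add: h_def)
    qed
  qed
qed

lemma attained_iff:
  assumes f [measurable]: "f \<in> borel_measurable M" and f_int: "integrable M (\<lambda>w. exp (- f w))"
  shows "cost \<nu> f U u = ereal (- ln (expectation (\<lambda>w. exp (- f w)))) \<longleftrightarrow>
    left_invertible \<nu> U \<and>
    (AE w in \<nu>. RN_deriv \<nu> (law M U) w = ennreal (exp (- f w) / expectation (\<lambda>w. exp (- f w))))"
proof -
  define L where "L = (\<lambda>w. ennreal (exp (- f w) / expectation (\<lambda>w. exp (- f w))))"
  have L: "L \<in> borel_measurable M" unfolding L_def by measurable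
  have "cost \<nu> f U u = ereal (- ln (expectation (\<lambda>w. exp (- f w)))) \<longleftrightarrow> (AE w in M. ennreal (\<rho> w) * L (U w) = 1)"
    unfolding L_def by (rule cost_attained_iff[OF f f_int])
  also have "\<dots> \<longleftrightarrow> left_invertible \<nu> U \<and> (AE w in \<nu>. RN_deriv \<nu> (law M U) w = L w)"
    using left_invertible_of_relation[OF L] RN_deriv_law[OF L] relation_of_left_invertible[OF L] by blast
  finally show ?thesis unfolding L_def .
qed

end

theorem theorem11:
  fixes \<nu> :: "('n::finite) path measure"
    and \<beta> :: "'n path \<Rightarrow> 'n path"
    and Dt :: "('n path \<Rightarrow> 'n path) set"
    and W :: "('n path \<Rightarrow> 'n path) \<Rightarrow> 'n path \<Rightarrow> 'n path"
    and f :: "'n path \<Rightarrow> real"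
  assumes "prob_space \<nu>" and "sets \<nu> = sets path_borel"
    and "brownian_motion \<nu> \<beta>"
    and "\<And>t. t \<in> {0..1} \<Longrightarrow> sets (filtr \<nu> \<beta> t) = sets (filtr \<nu> id t)"
    and "\<And>u. u \<in> Dt \<Longrightarrow> W u \<in> completion \<nu> \<rightarrow>\<^sub>M path_borel"
    and "AE w in \<nu>. W (\<lambda>_. 0) w = w"
    and i: "bounded_drifts \<nu> \<subseteq> Dt" "Dt \<subseteq> Gp 0 \<nu> \<beta>"
    and ii: "\<And>u. u \<in> Dt \<Longrightarrow> adapted_process \<nu> (W u)"
    and iii: "\<And>u. u \<in> Dt \<Longrightarrow>
        law (density (completion \<nu>) (\<lambda>w. ennreal (girsanov_exp \<nu> \<beta> u w))) (W u) = law \<nu> id"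
    and iv: "\<And>u. u \<in> Dt \<Longrightarrow> AE w in \<nu>. \<beta> (W u w) = \<beta> w + u w"
    and v: "\<And>u v. u \<in> Dt \<Longrightarrow> v \<in> Dt \<Longrightarrow> (\<lambda>w. v w + u (W v w)) \<in> Dt \<Longrightarrow>
        AE w in \<nu>. W u (W v w) = W (\<lambda>w. v w + u (W v w)) w"
    and v': "\<And>u v. u \<in> bounded_drifts \<nu> \<Longrightarrow> v \<in> bounded_drifts \<nu> \<Longrightarrow>
        AE w in \<nu>. W u (W v w) = W (\<lambda>w. v w + u (W v w)) w"
    and vi: "\<exists>Dtt. Dt \<subseteq> Dtt \<and> Dtt \<subseteq> Lpa 0 \<nu> \<and> Dt = Dtt \<inter> Gp 0 \<nu> \<beta> \<and>
        (\<forall>u\<in>Dt. (\<exists>v\<in>Gp 0 \<nu> \<beta>. AE w in \<nu>. u w + v (W u w) = 0) \<longrightarrow>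
                 (\<exists>v\<in>Dtt. AE w in \<nu>. u w + v (W u w) = 0))"
    and f_meas: "f \<in> borel_measurable (completion \<nu>)"
    and f_int: "integrable (completion \<nu>) (\<lambda>w. exp (- f w))"
    and f_var: "ereal (- ln (\<integral>w. exp (- f w) \<partial>completion \<nu>)) =
        (INF u\<in>Dt \<inter> Lpa 2 \<nu>. cost \<nu> f (W u) u)"
  shows "\<forall>u \<in> Dt \<inter> Lpa 2 \<nu>.
      cost \<nu> f (W u) u = (INF u\<in>Dt \<inter> Lpa 2 \<nu>. cost \<nu> f (W u) u) \<longleftrightarrow>
      left_invertible \<nu> (W u) \<and>
      (AE w in \<nu>. RN_deriv \<nu> (law (completion \<nu>) (W u)) w =
          ennreal (exp (- f w) / (\<integral>w. exp (- f w) \<partial>completion \<nu>)))"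
proof
  fix u assume u: "u \<in> Dt \<inter> Lpa 2 \<nu>"
  have uD: "u \<in> Dt" and u2: "u \<in> Lpa 2 \<nu>" using u by auto
  have "u \<in> Gp 0 \<nu> \<beta>" using uD i(2) by auto
  then have one: "(\<integral>w. girsanov_exp \<nu> \<beta> u w \<partial>completion \<nu>) = 1" by (simp add: Gp_def)
  \<comment> \<open>Every admissible \<open>u\<close> gives an instance of the preceding argument.
    By \<open>f_var\<close> the infimum is a fixed real number, so attaining it is an equation for
    the cost of this single \<open>u\<close>.\<close>
  interpret girsanov_map \<nu> \<beta> u "W u"
    by (intro girsanov_map.intro girsanov_drift.intro path_brownian.intro girsanov_drift_axioms.intro
      girsanov_map_axioms.intro assms(1-4) assms(5)[OF uD] u2 one ii[OF uD] iii[OF uD] iv[OF uD])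
  show "cost \<nu> f (W u) u = (INF u\<in>Dt \<inter> Lpa 2 \<nu>. cost \<nu> f (W u) u) \<longleftrightarrow>
      left_invertible \<nu> (W u) \<and>
      (AE w in \<nu>. RN_deriv \<nu> (law (completion \<nu>) (W u)) w =
          ennreal (exp (- f w) / (\<integral>w. exp (- f w) \<partial>completion \<nu>)))"
    unfolding f_var[symmetric] by (rule attained_iff[OF f_meas f_int])
qed

end
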